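(* Let $N=3$ and let $(u_1,u_2,u_3)$ be the solution of the three-layered transmission problem described in the context. Assume that $f_j=g_j=0$ for $t\le t_0$, $j=1,2$. Let $M\in\mathbb{N}$ with $M\ge2$, and define $T(M)=t_0+c_2^{-1}d_{1,2}M$. Let $\widehat u_1^M,\widehat u_2^M,\widehat u_3^M$ be the $M$-th order multiplicative multiple-scattering sums defined in the context. Then $$u_j(\bm x,t)=\widehat u_j^M(\bm x,t)\quad\text{for all }(\bm x,t)\in\Omega_j\times[0,T(M-1)],\quad j=1,2,3.$$
   Context: Geometry. $\mathbb{R}^2$ is divided into three layers $\Omega_1,\Omega_2,\Omega_3$, numbered from top to bottom, by two disjoint unbounded Lipschitz interfaces $\Gamma_1,\Gamma_2$, each a local perturbation of a flat horizontal line; $\Gamma_j$ separates $\Omega_j$ (above) from $\Omega_{j+1}$ (below). The unit normal $\bm n$ on $\Gamma_j$ points from $\Omega_{j+1}$ into $\Omega_j$. Set $d_{1,2}=\mathrm{dist}(\Gamma_1,\Gamma_2)>0$. Layer $\Omega_j$ has constant wave speed $c_j>0$ and constant density $\rho_j>0$. Write $\mathbb{R}^+=\{t\in\mathbb{R}:t>0\}$, and let $t_0>0$ be the arrival time of the incident field at the interfaces. Three-layered transmission problem: find $u_j$ on $\Omega_j\times\mathbb{R}^+$, $j=1,2,3$, with $$\partial_t^2u_j-c_j^2\Delta u_j=0\ \text{ in }\Omega_j\times\mathbb{R}^+,\qquad u_j|_{t=0}=\partial_tu_j|_{t=0}=0\ \text{ in }\Omega_j,$$ and, for $j=1,2$,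 on $\Gamma_j\times\mathbb{R}^+$, $$u_{j+1}-u_j=f_j,\qquad \rho_{j+1}^{-1}\frac{\partial u_{j+1}}{\partial\bm n}-\rho_j^{-1}\frac{\partial u_j}{\partial\bm n}=g_j.$$ The data come from a smooth incident field: for a plane wave $u^{\mathrm{inc}}$ impinging on $\Gamma_1$, $f_j=\delta_{j,1}u^{\mathrm{inc}}$ and $g_j=\delta_{j,1}\rho_1^{-1}\partial u^{\mathrm{inc}}/\partial\bm n$; for a point source $u^{\mathrm{inc}}$ located in $\Omega_{j_0}$, $f_j=(\delta_{j,j_0}-\delta_{j+1,j_0})u^{\mathrm{inc}}$ and $g_j=(\rho_j^{-1}\delta_{j,j_0}-\rho_{j+1}^{-1}\delta_{j+1,j_0})\partial u^{\mathrm{inc}}/\partial\bm n$ ($\delta$ the Kronecker delta). Two-layered problem for $\Gamma_j$ ($j=1,2$) with data $(\widetilde f,\widetilde g)$: let $\widetilde\Omega_j^{+}$ and $\widetilde\Omega_{j+1}^{-}$ be the unbounded domains lying above and below $\Gamma_j$, respectively. Find $\widetilde u_j^+$ on $\widetilde\Omega_j^+\times\mathbb{R}^+$ and $\widetilde u_{j+1}^-$ on $\widetilde\Omega_{j+1}^-\times\mathbb{R}^+$ with $$\partial_t^2\widetilde u_j^+-c_j^2\Delta\widetilde u_j^+=0\ \text{in }\widetilde\Omega_j^+\times\mathbb{R}^+,\qquad \partial_t^2\widetilde u_{j+1}^--c_{j+1}^2\Delta\widetilde u_{j+1}^-=0\ \text{in }\widetilde\Omega_{j+1}^-\times\mathbb{R}^+,$$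 $$\widetilde u_{j+1}^--\widetilde u_j^+=\widetilde f,\qquad \rho_{j+1}^{-1}\frac{\partial\widetilde u_{j+1}^-}{\partial\bm n}-\rho_j^{-1}\frac{\partial\widetilde u_j^+}{\partial\bm n}=\widetilde g\quad\text{on }\Gamma_j\times\mathbb{R}^+,$$ and zero initial values and zero initial time derivatives for both functions. Solutions of all the transmission problems above are assumed to exist, in a class in which each problem has at most one solution. Multiplicative (ping-pong) multiple scattering. For $m\in\mathbb{N}=\{1,2,\dots\}$ let $j'=j'(m)=2-\mathrm{mod}(m,2)$ (so $j'=1$ for odd $m$ and $j'=2$ for even $m$), and let $(\widetilde u_{j',m}^+,\widetilde u_{j'+1,m}^-)$ be the solution of the two-layered problem for $\Gamma_{j'}$ with data $(\widetilde f_{j',m},\widetilde g_{j',m})$ given inductively by - $m=1$: $(\widetilde f_{1,1},\widetilde g_{1,1})=(f_1,g_1)$; - $m=2$: $(\widetilde f_{2,2},\widetilde g_{2,2})=\left(f_2+\widetilde u_{2,1}^-,\ g_2+\rho_2^{-1}\frac{\partial\widetilde u_{2,1}^-}{\partial\bm n}\right)$ on $\Gamma_2$; - $m\ge3$ odd: $(\widetilde f_{1,m},\widetilde g_{1,m})=\left(-\widetilde u_{2,m-1}^+,\ -\rho_2^{-1}\frac{\partial\widetilde u_{2,m-1}^+}{\partial\bm n}\right)$ on $\Gamma_1$; - $m\ge3$ even: $(\widetilde f_{2,m},\widetilde g_{2,m})=\left(\widetilde u_{2,m-1}^-,\ \rho_2^{-1}\frac{\partial\widetilde u_{2,m-1}^-}{\partial\bm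 n}\right)$ on $\Gamma_2$. The $M$-th order sums are $$\widehat u_1^M=\sum_{n=1}^{\lceil M/2\rceil}\widetilde u_{1,2n-1}^+,\qquad \widehat u_2^M=\sum_{n=1}^{\lceil M/2\rceil}\widetilde u_{2,2n-1}^-+\sum_{n=1}^{\lfloor M/2\rfloor}\widetilde u_{2,2n}^+,\qquad \widehat u_3^M=\sum_{n=1}^{\lfloor M/2\rfloor}\widetilde u_{3,2n}^-,$$ each restricted to the corresponding layer $\Omega_j$. *)

theory Defs
  imports "HOL-Analysis.Analysis"
begin

type_synonym pt = "real ^ 2"
type_synonym field = "pt \<times> real \<Rightarrow> real"  \<comment> \<open>a function of \<open>(x, t)\<close>\<close>

subsection \<open>Derivatives\<close>

definition partial :: "'a \<Rightarrow> ('a::euclidean_space \<Rightarrow> real) \<Rightarrow> 'a \<Rightarrow> real" where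
  "partial b v p = frechet_derivative v (at p) b"

text \<open>\<open>Ck_on k S v\<close>: \<open>v\<close> is of class \<open>C\<^sup>k\<close> on \<open>S\<close>; it is used for open \<open>S\<close> only.\<close>

primrec Ck_on :: "nat \<Rightarrow> 'a set \<Rightarrow> ('a::euclidean_space \<Rightarrow> real) \<Rightarrow> bool" where
  "Ck_on 0 S v \<longleftrightarrow> continuous_on S v"
| "Ck_on (Suc k) S v \<longleftrightarrow>
     (\<forall>p\<in>S. v differentiable (at p)) \<and> (\<forall>b\<in>Basis. Ck_on k S (partial b v))"

definition smooth_on :: "'a set \<Rightarrow> ('a::euclidean_space \<Rightarrow> real) \<Rightarrow> bool" where
  "smooth_on S v \<longleftrightarrow> (\<forall>k. Ck_on k S v)"

definition supp :: "('a::topological_space \<Rightarrow> real) \<Rightarrow> 'a set" where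
  "supp v = closure {p. v p \<noteq> 0}"

abbreviation dt :: "field \<Rightarrow> field" where
  "dt \<equiv> partial (0, 1)"

abbreviation dx :: "2 \<Rightarrow> field \<Rightarrow> field" where
  "dx i \<equiv> partial (axis i 1, 0)"

definition laplacian :: "field \<Rightarrow> field" where
  "laplacian u p = (\<Sum>i\<in>UNIV. dx i (dx i u) p)"

subsection \<open>Geometry\<close>

definition above :: "pt set \<Rightarrow> pt set" where
  "above \<Gamma> = \<Union> {C \<in> components (- \<Gamma>). \<exists>a. {y. y $ 2 > a} \<subseteq> C}"

definition below :: "pt set \<Rightarrow> pt set" where
  "below \<Gamma> = \<Union> {C \<in> components (- \<Gamma>). \<exists>a. {y. y $ 2 < a} \<subseteq> C}"

text \<open>The last condition says that, near each of its points and after a rigid motion, \<open>\<Gamma>\<close> is the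
  graph of a Lipschitz function with the two domains on its two sides. \<open>\<Gamma>\<close> need not be a global
  graph.\<close>

definition lipschitz_interface :: "pt set \<Rightarrow> bool" where
  "lipschitz_interface \<Gamma> \<longleftrightarrow>
     closed \<Gamma> \<and> - \<Gamma> = above \<Gamma> \<union> below \<Gamma> \<and>
     (\<exists>a R. \<forall>x. norm x > R \<longrightarrow> (x \<in> \<Gamma> \<longleftrightarrow> x $ 2 = a)) \<and>
     (\<forall>x\<in>\<Gamma>. \<exists>V Q h L. open V \<and> x \<in> V \<and> orthogonal_transformation (Q :: pt \<Rightarrow> pt) \<and>
        L-lipschitz_on UNIV (h :: real \<Rightarrow> real) \<and>
        (\<forall>y\<in>V. (y \<in> above \<Gamma> \<longleftrightarrow> Q y $ 2 > h (Q y $ 1)) \<and>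
               (y \<in> below \<Gamma> \<longleftrightarrow> Q y $ 2 < h (Q y $ 1))))"

text \<open>The interfaces are \<open>\<Gamma> 1\<close> and \<open>\<Gamma> 2\<close>, the layers are \<open>layer \<Gamma> j\<close> for \<open>j = 1, 2, 3\<close>.\<close>

definition layer :: "(nat \<Rightarrow> pt set) \<Rightarrow> nat \<Rightarrow> pt set" where
  "layer \<Gamma> j = (if j = 1 then above (\<Gamma> 1)
                else if j = 2 then below (\<Gamma> 1) \<inter> above (\<Gamma> 2)
                else below (\<Gamma> 2))"

definition layered_geometry :: "(nat \<Rightarrow> pt set) \<Rightarrow> bool" where
  "layered_geometry \<Gamma> \<longleftrightarrow>
     lipschitz_interface (\<Gamma> 1) \<and> lipschitz_interface (\<Gamma> 2) \<and> \<Gamma> 2 \<subseteq> below (\<Gamma> 1) \<and>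
     setdist (\<Gamma> 1) (\<Gamma> 2) > 0"

subsection \<open>The solution class\<close>

text \<open>A solution is classical inside the domain \<open>D\<close> and has locally finite energy up to the
  boundary: \<open>u\<close> and \<open>\<partial>\<^sub>t u\<close> are continuous up to the boundary (so that \<open>u\<close> has pointwise traces),
  while the gradient is only locally square integrable there, as it is in general unbounded at the
  corners of a Lipschitz interface. No decay at infinity is imposed (plane waves), and none is
  needed for uniqueness because of finite speed of propagation.\<close>

definition solution_class :: "pt set \<Rightarrow> field \<Rightarrow> bool" where
  "solution_class D u \<longleftrightarrow>
     Ck_on 2 (D \<times> {0<..}) u \<and>
     continuous_on (closure D \<times> {0..}) u \<and>
     (\<exists>v. continuous_on (closure D \<times> {0..}) v \<and> (\<forall>p\<in>D \<times> {0<..}. v p = dt u p)) \<and>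
     (\<forall>i. \<exists>v. continuous_on (D \<times> {0..}) v \<and> (\<forall>p\<in>D \<times> {0<..}. v p = dx i u p)) \<and>
     (\<forall>R T. \<exists>C. \<forall>t\<in>{0<..T}.
        \<forall>v \<in> {dt u, dt (dt u)} \<union> range (\<lambda>i. dx i u) \<union> range (\<lambda>i. dx i (dt u)).
          set_integrable lborel (D \<inter> ball 0 R) (\<lambda>x. (v (x, t))\<^sup>2) \<and>
          (LINT x:D \<inter> ball 0 R|lborel. (v (x, t))\<^sup>2) \<le> C)"

definition wave_solution :: "pt set \<Rightarrow> real \<Rightarrow> field \<Rightarrow> bool" where
  "wave_solution D c u \<longleftrightarrow>
     solution_class D u \<and>
     (\<forall>p\<in>D \<times> {0<..}. dt (dt u) p - c\<^sup>2 * laplacian u p = 0) \<and>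
     (\<forall>x\<in>D. u (x, 0) = 0 \<and> ((\<lambda>t. u (x, t)) has_real_derivative 0) (at 0 within {0..}))"

subsection \<open>Normal derivatives and transmission conditions\<close>

text \<open>On a Lipschitz interface the unit normal exists only almost everywhere and \<open>\<nabla>u\<close> has no
  pointwise trace in general. As usual, \<open>\<partial>u/\<partial>n\<close> on \<open>\<Gamma> j\<close>, taken from the side of the adjacent layer
  \<open>k \<in> {j, j + 1}\<close>, is the functional given by Green's first identity,
  \<open>\<integral>\<^sub>\<Gamma> \<partial>u/\<partial>\<nu> \<phi> = \<integral>\<^sub>\<Omega> (\<Delta>u \<phi> + \<nabla>u \<bullet> \<nabla>\<phi>)\<close> with \<open>\<nu>\<close> the outward normal. The normal \<open>n\<close> points into
  layer \<open>j\<close>, hence the sign. The test functions are continuous \<open>H\<^sup>1\<close> functions with compact support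
  in the open set formed by \<open>\<Gamma> j\<close> and its two adjacent layers, so that neither the other interface
  nor the domain beyond it contributes.\<close>

definition test_functions :: "(nat \<Rightarrow> pt set) \<Rightarrow> nat \<Rightarrow> (pt \<Rightarrow> real) set" where
  "test_functions \<Gamma> j = {\<phi>. continuous_on UNIV \<phi> \<and> compact (supp \<phi>) \<and>
     supp \<phi> \<subseteq> layer \<Gamma> j \<union> \<Gamma> j \<union> layer \<Gamma> (j + 1) \<and>
     Ck_on 1 (layer \<Gamma> j \<union> layer \<Gamma> (j + 1)) \<phi> \<and>
     (\<forall>i. set_integrable lborel (layer \<Gamma> j \<union> layer \<Gamma> (j + 1)) (\<lambda>x. (partial (axis i 1) \<phi> x)\<^sup>2))}"

definition normal_deriv ::
    "(nat \<Rightarrow> pt set) \<Rightarrow> nat \<Rightarrow> nat \<Rightarrow> field \<Rightarrow> real \<Rightarrow> (pt \<Rightarrow> real) \<Rightarrow> real" where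
  "normal_deriv \<Gamma> j k u t \<phi> = (if k = j then - 1 else 1) *
     (LINT x:layer \<Gamma> k|lborel.
        laplacian u (x, t) * \<phi> x + (\<Sum>i\<in>UNIV. dx i u (x, t) * partial (axis i 1) \<phi> x))"

text \<open>Accordingly, Neumann data are functionals depending on time.\<close>

type_synonym neumann = "real \<Rightarrow> (pt \<Rightarrow> real) \<Rightarrow> real"

definition transmission ::
    "(nat \<Rightarrow> pt set) \<Rightarrow> (nat \<Rightarrow> real) \<Rightarrow> nat \<Rightarrow> field \<Rightarrow> neumann \<Rightarrow> field \<Rightarrow> field \<Rightarrow> bool" where
  "transmission \<Gamma> \<rho> j f g u_up u_low \<longleftrightarrow> (\<forall>t>0.
     (\<forall>x\<in>\<Gamma> j. u_low (x, t) - u_up (x, t) = f (x, t)) \<and>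
     (\<forall>\<phi>\<in>test_functions \<Gamma> j.
        normal_deriv \<Gamma> j (j + 1) u_low t \<phi> / \<rho> (j + 1) - normal_deriv \<Gamma> j j u_up t \<phi> / \<rho> j
        = g t \<phi>))"

definition three_layer_solution ::
    "(nat \<Rightarrow> pt set) \<Rightarrow> (nat \<Rightarrow> real) \<Rightarrow> (nat \<Rightarrow> real) \<Rightarrow> (nat \<Rightarrow> field) \<Rightarrow> (nat \<Rightarrow> neumann) \<Rightarrow>
     (nat \<Rightarrow> field) \<Rightarrow> bool" where
  "three_layer_solution \<Gamma> c \<rho> f g u \<longleftrightarrow>
     (\<forall>j\<in>{1, 2, 3}. wave_solution (layer \<Gamma> j) (c j) (u j)) \<and>
     (\<forall>j\<in>{1, 2}. transmission \<Gamma> \<rho> j (f j) (g j) (u j) (u (j + 1)))"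

definition two_layer_solution ::
    "(nat \<Rightarrow> pt set) \<Rightarrow> (nat \<Rightarrow> real) \<Rightarrow> (nat \<Rightarrow> real) \<Rightarrow> nat \<Rightarrow> field \<Rightarrow> neumann \<Rightarrow>
     field \<Rightarrow> field \<Rightarrow> bool" where
  "two_layer_solution \<Gamma> c \<rho> j f g v_up v_low \<longleftrightarrow>
     wave_solution (above (\<Gamma> j)) (c j) v_up \<and>
     wave_solution (below (\<Gamma> j)) (c (j + 1)) v_low \<and>
     transmission \<Gamma> \<rho> j f g v_up v_low"

subsection \<open>Incident fields\<close>

definition plane_wave :: "real \<Rightarrow> field \<Rightarrow> bool" where
  "plane_wave c u \<longleftrightarrow> (\<exists>F p. smooth_on UNIV F \<and> norm p = 1 \<and> p $ 2 < 0 \<and>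
     (\<forall>x t. u (x, t) = F (t - (p \<bullet> x) / c)))"

text \<open>A point source at \<open>z\<close> with signal \<open>\<lambda>\<close>: \<open>\<partial>\<^sub>t\<^sup>2 u - c\<^sup>2 \<Delta>u = \<lambda>(t) \<delta>\<^sub>z\<close> in the sense of
  distributions, and \<open>u\<close> is smooth away from \<open>z\<close>.\<close>

definition point_source :: "real \<Rightarrow> pt \<Rightarrow> field \<Rightarrow> bool" where
  "point_source c z u \<longleftrightarrow> smooth_on ((- {z}) \<times> {0<..}) u \<and>
     (\<exists>sig. smooth_on {0<..} sig \<and>
        (\<forall>\<psi>. smooth_on UNIV \<psi> \<and> compact (supp \<psi>) \<and> supp \<psi> \<subseteq> UNIV \<times> {0<..} \<longrightarrow>
           integrable lborel (\<lambda>p. u p * (dt (dt \<psi>) p - c\<^sup>2 * laplacian \<psi> p)) \<and>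
           (LINT p|lborel. u p * (dt (dt \<psi>) p - c\<^sup>2 * laplacian \<psi> p))
             = (LINT t|lborel. sig t * \<psi> (z, t))))"

definition kron :: "nat \<Rightarrow> nat \<Rightarrow> real" where
  "kron i j = (if i = j then 1 else 0)"

text \<open>The incident field is smooth near the interfaces, so its normal derivative is the same from
  both sides. For a point source it is evaluated on the side not containing the source.\<close>

definition plane_wave_data ::
    "(nat \<Rightarrow> pt set) \<Rightarrow> (nat \<Rightarrow> real) \<Rightarrow> (nat \<Rightarrow> real) \<Rightarrow> field \<Rightarrow>
     (nat \<Rightarrow> field) \<Rightarrow> (nat \<Rightarrow> neumann) \<Rightarrow> bool" where
  "plane_wave_data \<Gamma> c \<rho> uinc f g \<longleftrightarrow> plane_wave (c 1) uinc \<and>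
     f = (\<lambda>j p. kron j 1 * uinc p) \<and>
     g = (\<lambda>j t \<phi>. kron j 1 / \<rho> 1 * normal_deriv \<Gamma> j j uinc t \<phi>)"

definition point_source_data ::
    "(nat \<Rightarrow> pt set) \<Rightarrow> (nat \<Rightarrow> real) \<Rightarrow> (nat \<Rightarrow> real) \<Rightarrow> field \<Rightarrow>
     (nat \<Rightarrow> field) \<Rightarrow> (nat \<Rightarrow> neumann) \<Rightarrow> bool" where
  "point_source_data \<Gamma> c \<rho> uinc f g \<longleftrightarrow> (\<exists>j0\<in>{1, 2, 3}. \<exists>z\<in>layer \<Gamma> j0.
     point_source (c j0) z uinc \<and>
     f = (\<lambda>j p. (kron j j0 - kron (j + 1) j0) * uinc p) \<and>
     g = (\<lambda>j t \<phi>. (kron j j0 / \<rho> j - kron (j + 1) j0 / \<rho> (j + 1)) *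
                   normal_deriv \<Gamma> j (if j = j0 then j + 1 else j) uinc t \<phi>))"

subsection \<open>Multiplicative multiple scattering\<close>

definition jp :: "nat \<Rightarrow> nat" where
  "jp m = 2 - m mod 2"

text \<open>\<open>v_up m\<close> and \<open>v_low m\<close> are the fields above and below \<open>\<Gamma> (jp m)\<close> in step \<open>m\<close>. The data
  transferred from one interface to the other always come from the middle layer.\<close>

definition scattering_f :: "(nat \<Rightarrow> field) \<Rightarrow> (nat \<Rightarrow> field) \<Rightarrow> (nat \<Rightarrow> field) \<Rightarrow> nat \<Rightarrow> field" where
  "scattering_f f v_up v_low m p =
     (if m = 1 then f 1 p
      else if m = 2 then f 2 p + v_low 1 p
      else if odd m then - v_up (m - 1) p
      else v_low (m - 1) p)"

definition scattering_g ::
    "(nat \<Rightarrow> pt set) \<Rightarrow> (nat \<Rightarrow> real) \<Rightarrow> (nat \<Rightarrow> neumann) \<Rightarrow> (nat \<Rightarrow> field) \<Rightarrow> (nat \<Rightarrow> field) \<Rightarrow>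
     nat \<Rightarrow> neumann" where
  "scattering_g \<Gamma> \<rho> g v_up v_low m t \<phi> =
     (if m = 1 then g 1 t \<phi>
      else if m = 2 then g 2 t \<phi> + normal_deriv \<Gamma> 2 2 (v_low 1) t \<phi> / \<rho> 2
      else if odd m then - normal_deriv \<Gamma> 1 2 (v_up (m - 1)) t \<phi> / \<rho> 2
      else normal_deriv \<Gamma> 2 2 (v_low (m - 1)) t \<phi> / \<rho> 2)"

definition multiplicative_scattering ::
    "(nat \<Rightarrow> pt set) \<Rightarrow> (nat \<Rightarrow> real) \<Rightarrow> (nat \<Rightarrow> real) \<Rightarrow> (nat \<Rightarrow> field) \<Rightarrow> (nat \<Rightarrow> neumann) \<Rightarrow>
     (nat \<Rightarrow> field) \<Rightarrow> (nat \<Rightarrow> field) \<Rightarrow> bool" where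
  "multiplicative_scattering \<Gamma> c \<rho> f g v_up v_low \<longleftrightarrow> (\<forall>m\<ge>1.
     two_layer_solution \<Gamma> c \<rho> (jp m)
       (scattering_f f v_up v_low m) (scattering_g \<Gamma> \<rho> g v_up v_low m) (v_up m) (v_low m))"

definition scattering_sum :: "(nat \<Rightarrow> field) \<Rightarrow> (nat \<Rightarrow> field) \<Rightarrow> nat \<Rightarrow> nat \<Rightarrow> field" where
  "scattering_sum v_up v_low M j p =
     (if j = 1 then \<Sum>n = 1..nat \<lceil>real M / 2\<rceil>. v_up (2 * n - 1) p
      else if j = 2 then (\<Sum>n = 1..nat \<lceil>real M / 2\<rceil>. v_low (2 * n - 1) p) +
                         (\<Sum>n = 1..nat \<lfloor>real M / 2\<rfloor>. v_up (2 * n) p)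
      else \<Sum>n = 1..nat \<lfloor>real M / 2\<rfloor>. v_low (2 * n) p)"

definition arrival_bound :: "(nat \<Rightarrow> pt set) \<Rightarrow> (nat \<Rightarrow> real) \<Rightarrow> real \<Rightarrow> nat \<Rightarrow> real" where
  "arrival_bound \<Gamma> c t0 M = t0 + setdist (\<Gamma> 1) (\<Gamma> 2) / c 2 * real M"

end

theory Submission
  imports Defs
begin

text \<open>
  Let \<open>w\<close> be the difference of the solution of the three-layered problem and the scattering sum of
  order \<open>M\<close>. Each step of the scheme cancels on one interface the field that the step before sent
  there through the middle layer. The transmission conditions for the sums therefore telescope
  (\<open>sum_jumps\<close>, \<open>sum_fluxes\<close>): \<open>w\<close> solves the three-layered problem, and its only data are the trace and
  the flux that the field of step \<open>M\<close> leaves on the interface it has not been matched to. It remains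
  to show that this datum vanishes before the time \<open>T(M - 1)\<close> and that the problem has at most one
  solution.

  Both follow from one energy estimate (\<open>energy_uniqueness\<close>). Let \<open>\<eta>\<close> be a cut-off for a backward cone
  that shrinks at least as fast as waves travel. For a wave \<open>u\<close> with speed \<open>c\<close> in a domain \<open>D\<close>, the
  time derivative of
  \<open>\<integral>\<^sub>D \<eta> ((\<partial>\<^sub>tu)\<^sup>2 / c\<^sup>2 + \<bar>\<nabla>u\<bar>\<^sup>2) / 2\<close>
  is at most Green's functional \<open>\<integral>\<^sub>D (\<Delta>u \<phi> + \<nabla>u \<bullet> \<nabla>\<phi>)\<close> for \<open>\<phi> = \<eta> \<partial>\<^sub>tu\<close>, that is, the flux through the
  boundary tested with \<open>\<eta> \<partial>\<^sub>tu\<close> (\<open>local_power_le_green_density\<close>). No trace of the gradient is needed: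
  the flux is the functional that defines the weak normal derivative.
  \<^item> If the cone stays inside \<open>D\<close>, there is no flux; this is the domain of dependence
    (\<open>cone_vanishing\<close>). Since both fields that cross the middle layer have speed \<open>c\<^sub>2\<close>, a field that
    starts on one interface at time \<open>S\<close> needs until \<open>S + d / c\<^sub>2\<close> to reach the other
    (\<open>arrival_at_other_interface\<close>).
  \<^item> If two waves have equal traces on an interface, so have their velocities, and \<open>\<eta> \<partial>\<^sub>tu\<close>, glued
    across the interface, is an admissible test function. The flux condition then makes the sum of
    the boundary terms, weighted with \<open>1 / \<rho>\<close>, vanish (\<open>glued_flux\<close>). A partition of unity that
    separates the two interfaces turns this into uniqueness for the two-layered and the three-layered
    problems (\<open>two_layer_uniqueness\<close>, \<open>three_layer_uniqueness\<close>).

  Uniqueness for the two-layered problems and the travel time show by induction that step \<open>m\<close> vanishes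
  up to time \<open>T(m - 2)\<close> (\<open>step_quiet\<close>), so its field reaches the other interface at time \<open>T(m - 1)\<close> at
  the earliest. Uniqueness for the three-layered problem then gives \<open>w = 0\<close> up to time \<open>T(M - 1)\<close>.
\<close>

section \<open>Functions of class \<open>C\<^sup>1\<close>\<close>

lemma partial_eqI: "(v has_derivative v') (at p) \<Longrightarrow> partial b v p = v' b"
  unfolding partial_def using frechet_derivative_at by metis

lemma has_derivative_frechet:
  "v differentiable (at p) \<Longrightarrow> (v has_derivative frechet_derivative v (at p)) (at p)"
  by (simp add: frechet_derivative_works)

lemma partial_cong_open:
  assumes "open S" "p \<in> S" "\<And>q. q \<in> S \<Longrightarrow> u q = v q"
  shows "partial b u p = partial b v p"
proof -
  have "(u has_derivative d) (at p) \<longleftrightarrow> (v has_derivative d) (at p)" for d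
    using assms has_derivative_transform_within_open[of u d p UNIV S v]
      has_derivative_transform_within_open[of v d p UNIV S u] by auto
  then show ?thesis unfolding partial_def frechet_derivative_def by simp
qed

lemma differentiable_cong_open:
  assumes "open S" "p \<in> S" "\<And>q. q \<in> S \<Longrightarrow> u q = v q" "u differentiable (at p)"
  shows "v differentiable (at p)"
  using assms has_derivative_transform_within_open[of u _ p UNIV S v]
  unfolding differentiable_def by blast

text \<open>A constant of its own, because the simplifier rewrites the index \<open>1\<close> of \<open>Ck_on\<close> to \<open>Suc 0\<close>
  and then unfolds it.\<close>

definition C1_on :: "'a set \<Rightarrow> ('a::euclidean_space \<Rightarrow> real) \<Rightarrow> bool" where
  "C1_on S v \<longleftrightarrow> Ck_on 1 S v"

lemma C1_on_iff:
  "C1_on S v \<longleftrightarrow> (\<forall>p\<in>S. v differentiable (at p)) \<and> (\<forall>b\<in>Basis. continuous_on S (partial b v))"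
  by (simp add: C1_on_def)

lemma C1_onI:
  assumes "\<And>p. p \<in> S \<Longrightarrow> (v has_derivative v' p) (at p)"
    and "\<And>b. b \<in> Basis \<Longrightarrow> continuous_on S (\<lambda>p. v' p b)"
  shows "C1_on S v"
  unfolding C1_on_iff
proof (intro conjI ballI)
  show "v differentiable (at p)" if "p \<in> S" for p
    using assms(1)[OF that] by (auto simp: differentiable_def)
  show "continuous_on S (partial b v)" if "b \<in> Basis" for b
    using assms(2)[OF that] partial_eqI[OF assms(1)] by (simp cong: continuous_on_cong)
qed

lemma C1_on_continuous: "C1_on S v \<Longrightarrow> continuous_on S v"
  by (auto simp: C1_on_iff intro!: continuous_at_imp_continuous_on differentiable_imp_continuous_within)

lemma Ck_on_subset: "Ck_on k S v \<Longrightarrow> T \<subseteq> S \<Longrightarrow> Ck_on k T v"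
  by (induction k arbitrary: v) (auto intro: continuous_on_subset)

lemma Ck_on_cong_open:
  assumes "open S" "\<And>q. q \<in> S \<Longrightarrow> u q = v q"
  shows "Ck_on k S u \<longleftrightarrow> Ck_on k S v"
  using assms(2)
proof (induction k arbitrary: u v)
  case 0
  then show ?case by (simp cong: continuous_on_cong)
next
  case (Suc k)
  have "Ck_on k S (partial b u) \<longleftrightarrow> Ck_on k S (partial b v)" for b
    by (intro Suc.IH partial_cong_open[OF \<open>open S\<close>]) (use Suc.prems in auto)
  moreover have "u differentiable (at p) \<longleftrightarrow> v differentiable (at p)" if "p \<in> S" for p
    using differentiable_cong_open[OF \<open>open S\<close> that] Suc.prems by metis
  ultimately show ?case by simp
qed

lemma Ck_on_Un: "Ck_on k S u \<Longrightarrow> Ck_on k T u \<Longrightarrow> open S \<Longrightarrow> open T \<Longrightarrow> Ck_on k (S \<union> T) u"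
  by (induction k arbitrary: u) (auto intro: continuous_on_open_Un)

lemmas C1_on_subset = Ck_on_subset[of 1, folded C1_on_def]
lemmas C1_on_cong_open = Ck_on_cong_open[of _ _ _ 1, folded C1_on_def]
lemmas C1_on_Un = Ck_on_Un[of 1, folded C1_on_def]

lemma C1_on_const: "C1_on S (\<lambda>x. a)"
  by (rule C1_onI[where v'="\<lambda>_ _. 0"]) auto

lemma partial_linear:
  assumes "u differentiable (at p)" "v differentiable (at p)"
  shows "partial b (\<lambda>x. u x + a * v x) p = partial b u p + a * partial b v p"
proof (rule partial_eqI[THEN trans])
  show "((\<lambda>x. u x + a * v x) has_derivative
     (\<lambda>h. frechet_derivative u (at p) h + a * frechet_derivative v (at p) h)) (at p)"
    by (intro derivative_intros has_derivative_frechet assms)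
qed (simp add: partial_def)

lemma partial_mult:
  assumes "u differentiable (at p)" "v differentiable (at p)"
  shows "partial b (\<lambda>x. u x * v x) p = u p * partial b v p + partial b u p * v p"
proof (rule partial_eqI[THEN trans])
  show "((\<lambda>x. u x * v x) has_derivative
     (\<lambda>h. u p * frechet_derivative v (at p) h + frechet_derivative u (at p) h * v p)) (at p)"
    by (intro has_derivative_mult has_derivative_frechet assms)
qed (simp add: partial_def)

lemma Ck_on_linear:
  assumes "open S" "Ck_on k S u" "Ck_on k S v"
  shows "Ck_on k S (\<lambda>x. u x + a * v x)"
  using assms(2,3)
proof (induction k arbitrary: u v)
  case 0
  then show ?case by (auto intro!: continuous_intros)
next
  case (Suc k)
  have "Ck_on k S (partial b (\<lambda>x. u x + a * v x))" if "b \<in> Basis" for b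
  proof -
    have "Ck_on k S (\<lambda>x. partial b u x + a * partial b v x)"
      using Suc that by simp
    then show ?thesis
      using Suc.prems by (subst Ck_on_cong_open[OF \<open>open S\<close>]) (auto simp: partial_linear)
  qed
  then show ?case using Suc.prems by (auto intro!: derivative_intros)
qed

lemmas C1_on_linear = Ck_on_linear[of _ 1, folded C1_on_def]

lemma C1_on_mult:
  assumes "C1_on S u" "C1_on S v"
  shows "C1_on S (\<lambda>x. u x * v x)"
proof (rule C1_onI)
  show "((\<lambda>x. u x * v x) has_derivative
     (\<lambda>h. u p * frechet_derivative v (at p) h + frechet_derivative u (at p) h * v p)) (at p)"
    if "p \<in> S" for p
    using assms that unfolding C1_on_iff by (intro has_derivative_mult has_derivative_frechet) auto
  show "continuous_on S (\<lambda>p. u p * frechet_derivative v (at p) b + frechet_derivative u (at p) b * v p)"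
    if "b \<in> Basis" for b
    using assms that C1_on_continuous[OF assms(1)] C1_on_continuous[OF assms(2)]
    unfolding C1_on_iff partial_def[symmetric] by (intro continuous_intros) auto
qed

lemma C1_on_compose:
  assumes "C1_on S u" "\<And>y. (h has_real_derivative h' y) (at y)" "continuous_on UNIV h'"
  shows "C1_on S (\<lambda>x. h (u x))"
proof (rule C1_onI)
  show "((\<lambda>x. h (u x)) has_derivative (\<lambda>k. frechet_derivative u (at p) k * h' (u p))) (at p)"
    if "p \<in> S" for p
    using has_derivative_compose[OF has_derivative_frechet[of u p] assms(2)[unfolded has_field_derivative_def]]
      assms(1) that by (simp add: C1_on_iff mult.commute)
  show "continuous_on S (\<lambda>p. frechet_derivative u (at p) b * h' (u p))" if "b \<in> Basis" for b
    using assms(1) that C1_on_continuous[OF assms(1)]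
    unfolding C1_on_iff partial_def[symmetric]
    by (intro continuous_intros continuous_on_compose2[OF assms(3)]) auto
qed

lemma line_derivative:
  fixes v :: "'a::euclidean_space \<Rightarrow> real"
  assumes "v differentiable (at (c + s *\<^sub>R e))"
  shows "((\<lambda>s. v (c + s *\<^sub>R e)) has_real_derivative partial e v (c + s *\<^sub>R e)) (at s)"
proof -
  have "((\<lambda>s. v (c + s *\<^sub>R e)) has_derivative
      (\<lambda>k. frechet_derivative v (at (c + s *\<^sub>R e)) (k *\<^sub>R e))) (at s)"
    by (rule has_derivative_compose[of "\<lambda>s. c + s *\<^sub>R e" "\<lambda>k. k *\<^sub>R e" s UNIV v,
          OF _ has_derivative_frechet[OF assms]])
      (auto intro!: derivative_eq_intros)
  moreover have "linear (frechet_derivative v (at (c + s *\<^sub>R e)))"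
    using assms by (rule linear_frechet_derivative)
  ultimately show ?thesis
    by (simp add: has_field_derivative_def partial_def linear_cmul
        mult.commute[of "frechet_derivative _ _ _"] mult_commute_abs)
qed

text \<open>The second difference over a small parallelogram, evaluated by the mean value theorem first in
  direction \<open>a\<close> and then in direction \<open>b\<close>. It is symmetric in \<open>a\<close> and \<open>b\<close>, which forces the two mixed
  derivatives to have the same limit in the next lemma.\<close>

lemma second_difference_mean_value:
  fixes u :: "'a::euclidean_space \<Rightarrow> real"
  assumes u: "\<And>q. q \<in> ball p r \<Longrightarrow> u differentiable (at q)"
    and ua: "\<And>q. q \<in> ball p r \<Longrightarrow> partial a u differentiable (at q)"
    and h: "0 < h" "h * (norm a + norm b) < r"
  obtains q where "norm (q - p) \<le> h * (norm a + norm b)"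
    "u (p + h *\<^sub>R a + h *\<^sub>R b) - u (p + h *\<^sub>R a) - u (p + h *\<^sub>R b) + u p
       = h\<^sup>2 * partial b (partial a u) q"
proof -
  have near: "norm (s *\<^sub>R a + k *\<^sub>R b) \<le> h * (norm a + norm b)"
    if "0 \<le> s" "s \<le> h" "0 \<le> k" "k \<le> h" for s k
  proof -
    have "norm (s *\<^sub>R a + k *\<^sub>R b) \<le> s * norm a + k * norm b"
      using norm_triangle_ineq[of "s *\<^sub>R a" "k *\<^sub>R b"] that by simp
    also have "\<dots> \<le> h * norm a + h * norm b"
      using that by (intro add_mono mult_right_mono) auto
    finally show ?thesis by (simp add: algebra_simps)
  qed
  have inb: "p + s *\<^sub>R a + k *\<^sub>R b \<in> ball p r"
    if "0 \<le> s" "s \<le> h" "0 \<le> k" "k \<le> h" for s k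
    using near[OF that] h(2) by (simp add: dist_norm norm_minus_commute algebra_simps)

  define G where "G s = u (p + h *\<^sub>R b + s *\<^sub>R a) - u (p + s *\<^sub>R a)" for s
  have "(G has_real_derivative partial a u (p + h *\<^sub>R b + s *\<^sub>R a) - partial a u (p + s *\<^sub>R a)) (at s)"
    if "0 \<le> s" "s \<le> h" for s
    unfolding G_def
    using that inb[of s h] inb[of s 0] h(1)
    by (intro DERIV_diff line_derivative u) (auto simp: algebra_simps)
  from MVT2[OF h(1) this] obtain s where s: "0 < s" "s < h"
    and Gs: "G h - G 0 = h * (partial a u (p + h *\<^sub>R b + s *\<^sub>R a) - partial a u (p + s *\<^sub>R a))"
    by (auto simp: algebra_simps)
  have "((\<lambda>k. partial a u (p + s *\<^sub>R a + k *\<^sub>R b)) has_real_derivative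
      partial b (partial a u) (p + s *\<^sub>R a + k *\<^sub>R b)) (at k)" if "0 \<le> k" "k \<le> h" for k
    using that s inb[of s k] by (intro line_derivative ua) auto
  from MVT2[OF h(1) this] obtain k where k: "0 < k" "k < h"
    and Hk: "partial a u (p + s *\<^sub>R a + h *\<^sub>R b) - partial a u (p + s *\<^sub>R a)
       = h * partial b (partial a u) (p + s *\<^sub>R a + k *\<^sub>R b)"
    by auto
  show thesis
  proof (rule that[of "p + s *\<^sub>R a + k *\<^sub>R b"])
    show "norm (p + s *\<^sub>R a + k *\<^sub>R b - p) \<le> h * (norm a + norm b)"
      using near[of s k] s k by (simp add: algebra_simps)
    have "u (p + h *\<^sub>R a + h *\<^sub>R b) - u (p + h *\<^sub>R a) - u (p + h *\<^sub>R b) + u p = G h - G 0"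
      by (simp add: G_def algebra_simps)
    also have "\<dots> = h * (h * partial b (partial a u) (p + s *\<^sub>R a + k *\<^sub>R b))"
      unfolding Gs Hk[symmetric] by (simp add: algebra_simps)
    finally show "u (p + h *\<^sub>R a + h *\<^sub>R b) - u (p + h *\<^sub>R a) - u (p + h *\<^sub>R b) + u p
       = h\<^sup>2 * partial b (partial a u) (p + s *\<^sub>R a + k *\<^sub>R b)"
      by (simp add: power2_eq_square)
  qed
qed

lemma mixed_partials_commute:
  fixes u :: "'a::euclidean_space \<Rightarrow> real"
  assumes "open S" "Ck_on 2 S u" "p \<in> S" and ab: "a \<in> Basis" "b \<in> Basis"
  shows "partial a (partial b u) p = partial b (partial a u) p"
proof (rule ccontr)
  assume ne: "\<not> ?thesis"
  define e where "e = \<bar>partial a (partial b u) p - partial b (partial a u) p\<bar> / 2"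
  have "e > 0" using ne by (simp add: e_def)
  have C2: "\<forall>p\<in>S. u differentiable (at p)"
    "\<And>b. b \<in> Basis \<Longrightarrow> \<forall>p\<in>S. partial b u differentiable (at p)"
    "\<And>a b. a \<in> Basis \<Longrightarrow> b \<in> Basis \<Longrightarrow> continuous_on S (partial a (partial b u))"
    using assms(2) by (auto simp: numeral_2_eq_2)
  have cont: "isCont (partial a (partial b u)) p" "isCont (partial b (partial a u)) p"
    using C2(3) ab \<open>open S\<close> \<open>p \<in> S\<close> by (auto simp: continuous_on_eq_continuous_at)
  from cont(1) \<open>e > 0\<close> obtain d1 where d1: "d1 > 0"
    "\<And>q. dist q p < d1 \<Longrightarrow> dist (partial a (partial b u) q) (partial a (partial b u) p) < e"
    unfolding continuous_at_eps_delta by blast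
  from cont(2) \<open>e > 0\<close> obtain d2 where d2: "d2 > 0"
    "\<And>q. dist q p < d2 \<Longrightarrow> dist (partial b (partial a u) q) (partial b (partial a u) p) < e"
    unfolding continuous_at_eps_delta by blast
  obtain r0 where r0: "r0 > 0" "ball p r0 \<subseteq> S"
    using \<open>open S\<close> \<open>p \<in> S\<close> openE by blast
  define r where "r = min r0 (min d1 d2)"
  have r: "r > 0" "ball p r \<subseteq> S" "r \<le> d1" "r \<le> d2" using d1 d2 r0 by (auto simp: r_def)
  define h where "h = r / 4"
  have n1: "norm a = 1" "norm b = 1" using ab by auto
  have h: "0 < h" "h * (norm a + norm b) < r" "h * (norm b + norm a) < r"
    using r n1 by (auto simp: h_def)
  obtain q1 where q1: "norm (q1 - p) \<le> h * (norm a + norm b)"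
    "u (p + h *\<^sub>R a + h *\<^sub>R b) - u (p + h *\<^sub>R a) - u (p + h *\<^sub>R b) + u p
       = h\<^sup>2 * partial b (partial a u) q1"
    using second_difference_mean_value[of p r u a h b] C2 ab h r(2) by blast
  obtain q2 where q2: "norm (q2 - p) \<le> h * (norm b + norm a)"
    "u (p + h *\<^sub>R b + h *\<^sub>R a) - u (p + h *\<^sub>R b) - u (p + h *\<^sub>R a) + u p
       = h\<^sup>2 * partial a (partial b u) q2"
    using second_difference_mean_value[of p r u b h a] C2 ab h r(2) by blast
  have "p + h *\<^sub>R a + h *\<^sub>R b = p + h *\<^sub>R b + h *\<^sub>R a" by (simp add: add_ac)
  then have "h\<^sup>2 * partial b (partial a u) q1 = h\<^sup>2 * partial a (partial b u) q2"
    using q1(2) q2(2) by (simp only:)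
  then have eq: "partial b (partial a u) q1 = partial a (partial b u) q2"
    using h(1) by (simp only: mult_cancel_left) simp
  have "dist (partial b (partial a u) q1) (partial b (partial a u) p) < e"
    using q1(1) h r by (intro d2) (simp add: dist_norm)
  moreover have "dist (partial a (partial b u) q2) (partial a (partial b u) p) < e"
    using q2(1) h r by (intro d1) (simp add: dist_norm)
  ultimately have "\<bar>partial a (partial b u) p - partial b (partial a u) p\<bar> < 2 * e"
    unfolding eq dist_real_def by linarith
  then show False by (simp add: e_def)
qed

lemma real_polynomial_function_C1:
  fixes p :: "'a::euclidean_space \<Rightarrow> real"
  assumes "real_polynomial_function p"
  shows "C1_on UNIV p"
  using assms
proof induction
  case (linear f)
  then show ?case
    by (intro C1_onI[where v'="\<lambda>_. f"]) (auto intro: bounded_linear_imp_has_derivative)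
next
  case (add f g)
  then show ?case using C1_on_linear[of UNIV f g 1] by simp
next
  case (const c)
  show ?case by (rule C1_on_const)
next
  case (mult f g)
  then show ?case by (intro C1_on_mult)
qed

text \<open>A \<open>C\<^sup>1\<close> function that vanishes exactly on a half-line; all cut-offs are built from it.\<close>

definition sqpos :: "real \<Rightarrow> real" where
  "sqpos y = (max 0 y)\<^sup>2"

lemma sqpos_deriv: "(sqpos has_real_derivative 2 * max 0 y) (at y)"
proof -
  consider "y < 0" | "y = 0" | "y > 0" by linarith
  then show ?thesis
  proof cases
    case 1
    have "((\<lambda>_. 0) has_real_derivative 0) (at y)" by simp
    then have "(sqpos has_real_derivative 0) (at y)"
      by (rule has_field_derivative_transform_within_open[of _ _ _ "{..<0}"])
        (use 1 in \<open>auto simp: sqpos_def\<close>)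
    then show ?thesis using 1 by simp
  next
    case 2
    have "(\<lambda>h. (sqpos (0 + h) - sqpos 0) / h) \<midarrow>0\<rightarrow> 0"
    proof (rule tendsto_0_le[where K=1])
      show "(\<lambda>h::real. h) \<midarrow>0\<rightarrow> 0" by (rule tendsto_ident_at)
      show "\<forall>\<^sub>F h in at 0. norm ((sqpos (0 + h) - sqpos 0) / h) \<le> norm h * 1"
        by (intro always_eventually allI) (auto simp: sqpos_def max_def power2_eq_square)
    qed
    then show ?thesis using 2 by (simp add: DERIV_def)
  next
    case 3
    have "((\<lambda>y. y\<^sup>2) has_real_derivative 2 * y) (at y)"
      by (auto intro!: derivative_eq_intros)
    then have "(sqpos has_real_derivative 2 * y) (at y)"
      by (rule has_field_derivative_transform_within_open[of _ _ _ "{0<..}"])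
        (use 3 in \<open>auto simp: sqpos_def\<close>)
    then show ?thesis using 3 by simp
  qed
qed

section \<open>Green's identity for compact support\<close>

lemma integrable_continuous_compact_support:
  fixes F :: "'a::euclidean_space \<Rightarrow> real"
  assumes "continuous_on UNIV F" "compact K" "\<And>x. x \<notin> K \<Longrightarrow> F x = 0"
  shows "integrable lborel F"
proof -
  have "integrable lborel (\<lambda>x. indicator K x *\<^sub>R F x)"
    using assms by (intro borel_integrable_compact continuous_on_subset[OF assms(1)]) auto
  moreover have "(\<lambda>x. indicator K x *\<^sub>R F x) = F"
    using assms(3) by (auto simp: fun_eq_iff indicator_def)
  ultimately show ?thesis by simp
qed

lemma lborel_integral_translation:
  fixes F :: "'a::euclidean_space \<Rightarrow> real"
  assumes "F \<in> borel_measurable borel"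
  shows "(LINT x|lborel. F (c + x)) = (LINT x|lborel. F x)"
proof -
  have "(LINT x|lborel. F x) = (LINT x|distr lborel borel ((+) c). F x)"
    by (simp add: lborel_distr_plus)
  also have "\<dots> = (LINT x|lborel. F (c + x))"
    using assms by (intro integral_distr) auto
  finally show ?thesis by simp
qed

text \<open>The divergence theorem for compactly supported fields is the derivative at \<open>h = 0\<close> of the
  translation invariance \<open>\<integral> F(x + h b) dx = \<integral> F(x) dx\<close>. The difference quotients are dominated
  because, by the mean value theorem, they are values of \<open>\<partial>\<^sub>b F\<close>.\<close>

lemma integral_partial_compact_support:
  fixes F :: "'a::euclidean_space \<Rightarrow> real"
  assumes F: "C1_on UNIV F" and K: "compact K" "\<And>x. x \<notin> K \<Longrightarrow> F x = 0" and b: "b \<in> Basis"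
  shows "integrable lborel (partial b F)" "(LINT x|lborel. partial b F x) = 0"
proof -
  have diff: "F differentiable (at x)" and contp: "continuous_on UNIV (partial b F)" for x
    using F b by (auto simp: C1_on_iff)
  have contF: "continuous_on UNIV F" by (rule C1_on_continuous[OF F])
  have zero: "partial b F x = 0" if "x \<notin> K" for x
  proof -
    have "partial b F x = partial b (\<lambda>_. 0) x"
      by (rule partial_cong_open[of "- K"]) (use K that in \<open>auto simp: compact_imp_closed open_Compl\<close>)
    also have "\<dots> = 0" by (rule partial_eqI[THEN trans]) (auto intro: has_derivative_const)
    finally show ?thesis .
  qed
  show intp: "integrable lborel (partial b F)"
    by (rule integrable_continuous_compact_support[OF contp K(1) zero])
  have intF: "integrable lborel F"
    by (rule integrable_continuous_compact_support[OF contF K])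
  have "bounded (partial b F ` K)"
    using compact_continuous_image[OF continuous_on_subset[OF contp] K(1)] compact_imp_bounded by blast
  then obtain B0 where B0: "\<And>x. x \<in> K \<Longrightarrow> \<bar>partial b F x\<bar> \<le> B0"
    by (auto simp: bounded_iff)
  define B where "B = max B0 0"
  have B: "\<bar>partial b F x\<bar> \<le> B" "B \<ge> 0" for x
    using B0[of x] zero[of x] by (cases "x \<in> K") (auto simp: B_def)
  obtain R where R: "\<And>x. x \<in> K \<Longrightarrow> norm x \<le> R"
    using compact_imp_bounded[OF K(1)] by (auto simp: bounded_iff)
  define h where "h n = 1 / real (Suc n)" for n
  have h: "0 < h n" "h n \<le> 1" for n by (auto simp: h_def)
  have h0: "h \<longlonglongrightarrow> 0" unfolding h_def using LIMSEQ_Suc[OF lim_1_over_n] by simp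
  define q where "q n x = (F (h n *\<^sub>R b + x) - F x) / h n" for n x
  have lim: "(\<lambda>n. LINT x|lborel. q n x) \<longlonglongrightarrow> (LINT x|lborel. partial b F x)"
  proof (rule integral_dominated_convergence[where w="\<lambda>x. indicator (cball 0 (R + 1)) x *\<^sub>R B"])
    have [measurable]: "F \<in> borel_measurable borel"
      using contF by (rule borel_measurable_continuous_onI)
    show "q n \<in> borel_measurable lborel" for n unfolding q_def by measurable
    show "partial b F \<in> borel_measurable lborel"
      using borel_measurable_continuous_onI[OF contp] by simp
    show "integrable lborel (\<lambda>x. indicator (cball 0 (R + 1)) x *\<^sub>R B)"
      by (rule borel_integrable_compact) auto
    show "AE x in lborel. (\<lambda>n. q n x) \<longlonglongrightarrow> partial b F x"
    proof (rule AE_I2)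
      fix x
      have "((\<lambda>s. F (x + s *\<^sub>R b)) has_real_derivative partial b F (x + 0 *\<^sub>R b)) (at 0)"
        using diff by (intro line_derivative) auto
      then have "(\<lambda>k. (F (x + k *\<^sub>R b) - F x) / k) \<midarrow>0\<rightarrow> partial b F x"
        by (simp add: DERIV_def)
      moreover have "filterlim h (at 0) sequentially"
        using h(1) h0 by (intro filterlim_atI always_eventually) (auto simp: less_le)
      ultimately have "(\<lambda>n. (F (x + h n *\<^sub>R b) - F x) / h n) \<longlonglongrightarrow> partial b F x"
        by (rule filterlim_compose)
      then show "(\<lambda>n. q n x) \<longlonglongrightarrow> partial b F x" by (simp add: q_def add.commute)
    qed
    show "AE x in lborel. norm (q n x) \<le> indicator (cball 0 (R + 1)) x *\<^sub>R B" for n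
    proof (rule AE_I2)
      fix x
      show "norm (q n x) \<le> indicator (cball 0 (R + 1)) x *\<^sub>R B"
      proof (cases "x \<in> cball 0 (R + 1)")
        case True
        have "((\<lambda>s. F (x + s *\<^sub>R b)) has_real_derivative partial b F (x + s *\<^sub>R b)) (at s)" for s
          using diff by (intro line_derivative) auto
        from MVT2[OF h(1)[of n] this] obtain s
          where "F (x + h n *\<^sub>R b) - F (x + 0 *\<^sub>R b) = (h n - 0) * partial b F (x + s *\<^sub>R b)" by blast
        then have "q n x = partial b F (x + s *\<^sub>R b)"
          using h(1)[of n] by (simp add: q_def add.commute)
        then show ?thesis using True B by simp
      next
        case False
        have "norm x \<le> norm (h n *\<^sub>R b + x) + norm (h n *\<^sub>R b)"
          using norm_triangle_ineq4[of "h n *\<^sub>R b + x" "h n *\<^sub>R b"] by simp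
        moreover have "norm (h n *\<^sub>R b) \<le> 1" using h[of n] b by simp
        ultimately have "h n *\<^sub>R b + x \<notin> K" "x \<notin> K"
          using False R[of x] R[of "h n *\<^sub>R b + x"] by auto
        then show ?thesis using False K(2) by (simp add: q_def)
      qed
    qed
  qed
  have "(LINT x|lborel. q n x) = 0" for n
  proof -
    have [measurable]: "F \<in> borel_measurable borel"
      using contF by (rule borel_measurable_continuous_onI)
    have "integrable lborel (\<lambda>x. F (h n *\<^sub>R b + x))"
    proof (rule integrable_continuous_compact_support)
      show "continuous_on UNIV (\<lambda>x. F (h n *\<^sub>R b + x))"
        by (intro continuous_on_compose2[OF contF] continuous_intros) auto
      show "compact ((\<lambda>y. - (h n *\<^sub>R b) + y) ` K)" by (rule compact_translation[OF K(1)])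
      show "F (h n *\<^sub>R b + x) = 0" if "x \<notin> (\<lambda>y. - (h n *\<^sub>R b) + y) ` K" for x
      proof (rule K(2))
        show "h n *\<^sub>R b + x \<notin> K"
        proof
          assume "h n *\<^sub>R b + x \<in> K"
          then have "- (h n *\<^sub>R b) + (h n *\<^sub>R b + x) \<in> (\<lambda>y. - (h n *\<^sub>R b) + y) ` K" by (rule imageI)
          then show False using that by simp
        qed
      qed
    qed
    then show ?thesis
      using lborel_integral_translation[of F "h n *\<^sub>R b"] intF by (simp add: q_def)
  qed
  with lim have "(\<lambda>n. 0) \<longlonglongrightarrow> (LINT x|lborel. partial b F x)" by simp
  then show "(LINT x|lborel. partial b F x) = 0" using LIMSEQ_unique tendsto_const by metis
qed

lemma set_integral_partial_interior_support:
  fixes F :: "'a::euclidean_space \<Rightarrow> real"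
  assumes D: "open D" and F: "C1_on D F" and K: "compact K" "K \<subseteq> D" "\<And>x. x \<in> D - K \<Longrightarrow> F x = 0"
    and b: "b \<in> Basis"
  shows "set_integrable lborel D (partial b F)" "(LINT x:D|lborel. partial b F x) = 0"
proof -
  define G where "G x = (if x \<in> D then F x else 0)" for x
  have cl: "open (- K)" using K by (simp add: compact_imp_closed open_Compl)
  have "C1_on (D \<union> - K) G"
  proof (rule C1_on_Un[OF _ _ D cl])
    show "C1_on D G" using F by (subst C1_on_cong_open[OF D, of _ F]) (auto simp: G_def)
    show "C1_on (- K) G"
      by (subst C1_on_cong_open[OF cl, of _ "\<lambda>_. 0"]) (auto simp: G_def K C1_on_const)
  qed
  moreover have "D \<union> - K = UNIV" using K(2) by auto
  ultimately have G: "C1_on UNIV G" by simp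
  have G0: "G x = 0" if "x \<notin> K" for x using that K by (auto simp: G_def)
  note I = integral_partial_compact_support[OF G K(1) G0 b]
  have pG: "partial b G x = indicator D x *\<^sub>R partial b F x" for x
  proof (cases "x \<in> D")
    case True
    then show ?thesis using partial_cong_open[OF D True, of G F] by (simp add: G_def)
  next
    case False
    then have "partial b G x = partial b (\<lambda>_. 0) x"
      using K by (intro partial_cong_open[OF cl] G0) auto
    also have "\<dots> = 0" by (rule partial_eqI[THEN trans]) (auto intro: has_derivative_const)
    finally show ?thesis using False by simp
  qed
  show "set_integrable lborel D (partial b F)" "(LINT x:D|lborel. partial b F x) = 0"
    using I unfolding pG[abs_def] by (auto simp: set_integrable_def set_lebesgue_integral_def)
qed

text \<open>Stone--Weierstrass provides a polynomial \<open>p\<close> close to the Urysohn function of the two sets;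
  composing it with a \<open>C\<^sup>1\<close> step function makes it constant near each of them.\<close>

lemma C1_separation:
  fixes A B :: "'a::euclidean_space set"
  assumes "closed A" "closed B" "A \<inter> B = {}" "A \<noteq> {}" "B \<noteq> {}" "compact K"
  obtains \<theta> U V where "C1_on UNIV \<theta>" "open U" "open V" "A \<inter> K \<subseteq> U" "B \<inter> K \<subseteq> V"
    "\<And>x. x \<in> U \<Longrightarrow> \<theta> x = 1" "\<And>x. x \<in> V \<Longrightarrow> \<theta> x = (0::real)"
proof -
  define f where "f x = infdist x B / (infdist x A + infdist x B)" for x
  have pos: "infdist x A + infdist x B > 0" for x
  proof -
    have "infdist x A \<noteq> 0 \<or> infdist x B \<noteq> 0"
      using assms in_closed_iff_infdist_zero by blast
    then show ?thesis using infdist_nonneg[of x A] infdist_nonneg[of x B] by linarith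
  qed
  have "continuous_on K f"
    unfolding f_def using pos by (intro continuous_intros) (metis less_irrefl)
  then obtain p where p: "real_polynomial_function p" "\<And>x. x \<in> K \<Longrightarrow> \<bar>f x - p x\<bar> < 1/4"
    using Stone_Weierstrass_real_polynomial_function[OF assms(6), of f "1/4"] by auto
  have p1: "C1_on UNIV p" by (rule real_polynomial_function_C1[OF p(1)])
  then have pc: "continuous_on UNIV p" by (rule C1_on_continuous)
  \<comment> \<open>The step from \<open>0\<close> (below \<open>1/4\<close>) to \<open>1\<close> (above \<open>3/4\<close>); the bounds leave room for the
    approximation error \<open>1/4\<close>.\<close>
  define s where "s y = sqpos (y - 1/4) / (sqpos (y - 1/4) + sqpos (3/4 - y))" for y :: real
  have spos: "sqpos (y - 1/4) + sqpos (3/4 - y) > 0" for y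
    by (cases "y > 1/4") (auto simp: sqpos_def intro: add_pos_nonneg add_nonneg_pos)
  define N where "N y = 2 * max 0 (y - 1/4) * (sqpos (y - 1/4) + sqpos (3/4 - y))
     - sqpos (y - 1/4) * (2 * max 0 (y - 1/4) - 2 * max 0 (3/4 - y))" for y :: real
  define s' where "s' y = N y / (sqpos (y - 1/4) + sqpos (3/4 - y))\<^sup>2" for y
  have s': "(s has_real_derivative s' y) (at y)" for y
  proof -
    have 1: "((\<lambda>y. sqpos (y - 1/4)) has_real_derivative 2 * max 0 (y - 1/4)) (at y)"
      by (rule DERIV_cong[OF DERIV_chain2[where g="\<lambda>y. y - 1/4", OF sqpos_deriv DERIV_diff[OF DERIV_ident DERIV_const]]]) simp
    have 2: "((\<lambda>y. sqpos (3/4 - y)) has_real_derivative - 2 * max 0 (3/4 - y)) (at y)"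
      by (rule DERIV_cong[OF DERIV_chain2[where g="\<lambda>y. 3/4 - y", OF sqpos_deriv DERIV_diff[OF DERIV_const DERIV_ident]]]) simp
    show ?thesis unfolding s_def
      using spos[of y]
      by (intro DERIV_cong[OF DERIV_divide[OF 1 DERIV_add[OF 1 2]]])
        (simp_all add: s'_def N_def power2_eq_square)
  qed
  have "continuous_on UNIV sqpos" unfolding sqpos_def by (intro continuous_intros)
  then have sc: "continuous_on UNIV (\<lambda>y. sqpos (y - 1/4))" "continuous_on UNIV (\<lambda>y. sqpos (3/4 - y))"
    by (auto intro!: continuous_on_compose2[of UNIV sqpos] continuous_intros)
  have "continuous_on UNIV s'"
  proof -
    have "(sqpos (y - 1/4) + sqpos (3/4 - y))\<^sup>2 \<noteq> 0" for y using spos[of y] by simp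
    then show ?thesis unfolding s'_def N_def by (intro continuous_intros sc ballI)
  qed
  from C1_on_compose[OF p1 s' this] have th: "C1_on UNIV (\<lambda>x. s (p x))" .
  show thesis
  proof (rule that[OF th, of "{x. p x > 3/4}" "{x. p x < 1/4}"])
    show "open {x. p x > 3/4}" "open {x. p x < 1/4}"
      by (intro open_Collect_less pc continuous_on_const)+
    show "A \<inter> K \<subseteq> {x. p x > 3/4}"
    proof
      fix x assume "x \<in> A \<inter> K"
      then have "f x = 1" using pos[of x] by (simp add: f_def)
      with p(2)[of x] \<open>x \<in> A \<inter> K\<close> have "\<bar>1 - p x\<bar> < 1/4" by (metis IntD2)
      then have "1 - p x < 1/4" by (rule abs_less_iff[THEN iffD1, THEN conjunct1])
      then show "x \<in> {x. p x > 3/4}" by simp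
    qed
    show "B \<inter> K \<subseteq> {x. p x < 1/4}"
    proof
      fix x assume "x \<in> B \<inter> K"
      then have "f x = 0" by (simp add: f_def)
      with p(2)[of x] \<open>x \<in> B \<inter> K\<close> have "\<bar>0 - p x\<bar> < 1/4" by (metis IntD2)
      then have "- (0 - p x) < 1/4" by (rule abs_less_iff[THEN iffD1, THEN conjunct2])
      then show "x \<in> {x. p x < 1/4}" by simp
    qed
    show "s (p x) = 1" if "x \<in> {x. p x > 3/4}" for x
      using that spos[of "p x"] by (auto simp: s_def sqpos_def)
    show "s (p x) = 0" if "x \<in> {x. p x < 1/4}" for x
      using that by (auto simp: s_def sqpos_def)
  qed
qed

lemma space_basis: "((axis i 1 :: pt), 0::real) \<in> Basis" "(axis i (1::real) :: pt) \<in> Basis"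
  by (auto simp: Basis_prod_def axis_in_Basis_iff)

lemma time_basis: "(0::pt, 1::real) \<in> Basis"
  by (auto simp: Basis_prod_def)

lemma space_slice:
  fixes u :: field
  assumes "u differentiable (at (x, t))"
  shows "((\<lambda>y. u (y, t)) has_derivative (\<lambda>h. frechet_derivative u (at (x, t)) (h, 0))) (at x)"
    "partial b (\<lambda>y. u (y, t)) x = partial (b, 0) u (x, t)"
proof -
  show *: "((\<lambda>y. u (y, t)) has_derivative (\<lambda>h. frechet_derivative u (at (x, t)) (h, 0))) (at x)"
    by (rule has_derivative_compose[of "\<lambda>y. (y, t)" "\<lambda>h. (h, 0)" x UNIV u,
          OF _ has_derivative_frechet[OF assms]]) (auto intro!: derivative_eq_intros)
  show "partial b (\<lambda>y. u (y, t)) x = partial (b, 0) u (x, t)"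
    using partial_eqI[OF *] by (simp add: partial_def)
qed

lemma time_slice:
  fixes u :: field
  assumes "u differentiable (at (x, t))"
  shows "((\<lambda>s. u (x, s)) has_real_derivative dt u (x, t)) (at t)"
  using line_derivative[of u "(x, 0)" t "(0, 1)"] assms by simp

lemma space_slice_C1:
  fixes u :: field
  assumes u: "C1_on (D \<times> {0<..}) u" and t: "t > 0"
  shows "C1_on D (\<lambda>x. u (x, t))"
proof (rule C1_onI)
  have d: "u differentiable (at (x, t))" if "x \<in> D" for x using u t that by (auto simp: C1_on_iff)
  show "((\<lambda>y. u (y, t)) has_derivative (\<lambda>h. frechet_derivative u (at (x, t)) (h, 0))) (at x)"
    if "x \<in> D" for x using space_slice(1)[OF d[OF that]] .
  fix b :: pt assume "b \<in> Basis"
  then have "(b, 0::real) \<in> Basis" by (auto simp: Basis_prod_def)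
  then have "continuous_on (D \<times> {0<..}) (partial (b, 0) u)" using u by (auto simp: C1_on_iff)
  then show "continuous_on D (\<lambda>x. frechet_derivative u (at (x, t)) (b, 0))"
    unfolding partial_def[symmetric]
    by (rule continuous_on_compose2) (use t in \<open>auto intro!: continuous_intros\<close>)
qed

lemma Ck2_unfold:
  assumes "Ck_on 2 S u"
  shows "C1_on S u" "\<And>b. b \<in> Basis \<Longrightarrow> C1_on S (partial b u)"
    "\<And>p. p \<in> S \<Longrightarrow> u differentiable (at p)"
proof -
  show "C1_on S (partial b u)" if "b \<in> Basis" for b
    using assms that by (auto simp: numeral_2_eq_2 C1_on_def)
  then have "continuous_on S (partial b u)" if "b \<in> Basis" for b
    using that by (intro C1_on_continuous)
  then show "C1_on S u" using assms unfolding C1_on_iff by (simp add: numeral_2_eq_2)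
  show "\<And>p. p \<in> S \<Longrightarrow> u differentiable (at p)" using assms by (auto simp: numeral_2_eq_2)
qed

text \<open>Up to the sign of the normal and the choice of the domain, this is the weak normal derivative
  of \<open>u\<close> on the boundary of \<open>D\<close>, tested with \<open>\<phi>\<close>.\<close>

definition green :: "pt set \<Rightarrow> field \<Rightarrow> real \<Rightarrow> (pt \<Rightarrow> real) \<Rightarrow> real" where
  "green D u t \<phi> = (LINT x:D|lborel.
     laplacian u (x, t) * \<phi> x + (\<Sum>i\<in>UNIV. dx i u (x, t) * partial (axis i 1) \<phi> x))"

lemma normal_deriv_green:
  "normal_deriv \<Gamma> j k u t \<phi> = (if k = j then - 1 else 1) * green (layer \<Gamma> k) u t \<phi>"
  by (simp add: normal_deriv_def green_def)

lemma green_cong: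
  assumes "open D" "\<And>x. x \<in> D \<Longrightarrow> \<phi> x = \<psi> x"
  shows "green D u t \<phi> = green D u t \<psi>"
  unfolding green_def using assms partial_cong_open[OF assms(1) _ assms(2)]
  by (intro set_lebesgue_integral_cong) auto

lemma green_zero_test:
  assumes "open D" "\<And>x. x \<in> D \<Longrightarrow> \<phi> x = 0"
  shows "green D u t \<phi> = 0"
proof -
  have "green D u t \<phi> = green D u t (\<lambda>_. 0)" by (rule green_cong[OF assms])
  also have "\<dots> = 0"
  proof -
    have "partial b (\<lambda>_. 0) x = 0" for b x :: pt
      by (rule partial_eqI[THEN trans]) (auto intro: has_derivative_const)
    then show ?thesis by (simp add: green_def set_lebesgue_integral_def)
  qed
  finally show ?thesis .
qed

text \<open>\<open>\<Delta>u \<phi> + \<nabla>u \<bullet> \<nabla>\<phi>\<close> is the divergence of \<open>\<phi> \<nabla>u\<close>, so there is no boundary term. Only the product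
  \<open>\<phi> \<nabla>u\<close> must have compact support in \<open>D\<close>: either \<open>\<phi>\<close> or \<open>u\<close> may be the factor that vanishes near the
  boundary, and both cases occur below.\<close>

lemma green_interior_support:
  assumes D: "open D" and u: "Ck_on 2 (D \<times> {0<..}) u" and t: "t > 0" and \<phi>: "C1_on D \<phi>"
    and K: "compact K" "K \<subseteq> D" "\<And>x i. x \<in> D - K \<Longrightarrow> \<phi> x * dx i u (x, t) = 0"
  shows "green D u t \<phi> = 0"
proof -
  have ui: "C1_on (D \<times> {0<..}) (dx i u)" for i using Ck2_unfold(2)[OF u space_basis(1)] .
  have us: "C1_on D (\<lambda>x. dx i u (x, t))" for i by (rule space_slice_C1[OF ui t])
  define F where "F i x = \<phi> x * dx i u (x, t)" for i x
  have F: "C1_on D (F i)" for i unfolding F_def by (rule C1_on_mult[OF \<phi> us])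
  note I = set_integral_partial_interior_support[OF D F K(1,2) _ space_basis(2)]
  have F0: "x \<in> D - K \<Longrightarrow> F i x = 0" for i x using K(3) by (simp add: F_def)
  have pF: "partial (axis i 1) (F i) x
      = \<phi> x * dx i (dx i u) (x, t) + partial (axis i 1) \<phi> x * dx i u (x, t)" if "x \<in> D" for i x
  proof -
    have "dx i u differentiable (at (x, t))" using ui that t by (auto simp: C1_on_iff)
    then show ?thesis
      unfolding F_def using that \<phi> us space_slice(2)[of "dx i u" x t "axis i 1"]
      by (subst partial_mult) (auto simp: C1_on_iff)
  qed
  have "green D u t \<phi> = (LINT x:D|lborel. \<Sum>i\<in>UNIV. partial (axis i 1) (F i) x)"
    unfolding green_def using D
    by (intro set_lebesgue_integral_cong)
      (auto simp: pF laplacian_def sum.distrib sum_distrib_right mult.commute[of "\<phi> _"]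
         mult.commute[of "partial _ \<phi> _"])
  also have "\<dots> = (\<Sum>i\<in>UNIV. LINT x:D|lborel. partial (axis i 1) (F i) x)"
    using I(1)[OF F0] unfolding set_integrable_def set_lebesgue_integral_def scaleR_sum_right
    by (intro Bochner_Integration.integral_sum) auto
  also have "\<dots> = 0" using I(2)[OF F0] by simp
  finally show ?thesis .
qed

section \<open>Regularity of wave solutions\<close>

lemma wave_solutionD:
  assumes "wave_solution D c u"
  shows "Ck_on 2 (D \<times> {0<..}) u"
    "continuous_on (closure D \<times> {0..}) u"
    "\<exists>v. continuous_on (closure D \<times> {0..}) v \<and> (\<forall>p\<in>D \<times> {0<..}. v p = dt u p)"
    "\<exists>v. continuous_on (D \<times> {0..}) v \<and> (\<forall>p\<in>D \<times> {0<..}. v p = dx i u p)"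
    "\<And>x t. x \<in> D \<Longrightarrow> t > 0 \<Longrightarrow> dt (dt u) (x, t) = c\<^sup>2 * laplacian u (x, t)"
    "\<And>x. x \<in> D \<Longrightarrow> u (x, 0) = 0"
    "\<And>x. x \<in> D \<Longrightarrow> ((\<lambda>t. u (x, t)) has_real_derivative 0) (at 0 within {0..})"
  using assms unfolding wave_solution_def solution_class_def by (blast, blast, blast, blast, force, blast, blast)

lemma wave_solution_C1:
  assumes "wave_solution D c u"
  shows "C1_on (D \<times> {0<..}) u" "C1_on (D \<times> {0<..}) (dt u)" "C1_on (D \<times> {0<..}) (dx i u)"
  using Ck2_unfold[OF wave_solutionD(1)[OF assms]] time_basis space_basis by auto

lemma wave_solution_diff:
  assumes "wave_solution D c u" "x \<in> D" "t > 0"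
  shows "u differentiable (at (x, t))" "dt u differentiable (at (x, t))"
    "dx i u differentiable (at (x, t))"
  using wave_solution_C1[OF assms(1)] assms(2,3) by (auto simp: C1_on_iff)

lemma wave_solution_mixed:
  assumes "open D" "wave_solution D c u" "x \<in> D" "t > 0"
  shows "dt (dx i u) (x, t) = dx i (dt u) (x, t)"
  using mixed_partials_commute[of "D \<times> {0<..}" u "(x, t)" "(0, 1)" "(axis i 1, 0)"]
    wave_solutionD(1)[OF assms(2)] time_basis space_basis assms by (auto simp: open_Times)

lemma continuous_on_cross:
  assumes "continuous_on (A \<times> B) v"
  shows "x \<in> A \<Longrightarrow> continuous_on B (\<lambda>s. v (x, s))" "s \<in> B \<Longrightarrow> continuous_on A (\<lambda>x. v (x, s))"
  by (rule continuous_on_compose2[OF assms]; force intro!: continuous_intros)+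

text \<open>The velocity has a limit at \<open>t = 0\<close> by the definition of the solution class. By the mean value
  theorem this limit is also a limit of difference quotients, hence equal to the initial velocity.\<close>

lemma initial_velocity_limit:
  assumes u: "wave_solution D c u" and x: "x \<in> D"
  shows "((\<lambda>s. dt u (x, s)) \<longlongrightarrow> 0) (at_right 0)"
proof -
  obtain v where v: "continuous_on (closure D \<times> {0..}) v" "\<forall>p\<in>D \<times> {0<..}. v p = dt u p"
    using wave_solutionD(3)[OF u] by blast
  have "x \<in> closure D" using x closure_subset by blast
  then have "continuous_on {0..} (\<lambda>s. v (x, s))" by (rule continuous_on_cross(1)[OF v(1)])
  then have "((\<lambda>s. v (x, s)) \<longlongrightarrow> v (x, 0)) (at 0 within {0..})"
    by (simp add: continuous_on_def)
  then have "((\<lambda>s. v (x, s)) \<longlongrightarrow> v (x, 0)) (at_right 0)"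
    by (rule tendsto_within_subset) auto
  then have lim: "((\<lambda>s. dt u (x, s)) \<longlongrightarrow> v (x, 0)) (at_right 0)"
    using v(2) x by (subst tendsto_cong[of _ "\<lambda>s. v (x, s)"])
      (auto simp: eventually_at_right_less intro!: eventually_mono[OF eventually_at_right_less])
  have "((\<lambda>h. (u (x, h) - u (x, 0)) / (h - 0)) \<longlongrightarrow> 0) (at 0 within {0..})"
    using wave_solutionD(7)[OF u x] by (simp add: has_field_derivative_iff)
  then have q: "((\<lambda>h. (u (x, h) - u (x, 0)) / (h - 0)) \<longlongrightarrow> 0) (at_right 0)"
    by (rule tendsto_within_subset) auto
  have ux: "continuous_on {0..} (\<lambda>s. u (x, s))"
    by (rule continuous_on_cross(1)[OF wave_solutionD(2)[OF u] \<open>x \<in> closure D\<close>])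
  have "v (x, 0) = 0"
  proof (rule ccontr)
    define e where "e = \<bar>v (x, 0)\<bar> / 2"
    assume "v (x, 0) \<noteq> 0"
    then have "e > 0" by (simp add: e_def)
    have "\<forall>\<^sub>F s in at_right 0. dist (dt u (x, s)) (v (x, 0)) < e"
      using lim \<open>e > 0\<close> by (simp add: tendstoD)
    then obtain d1 where d1: "d1 > 0" "\<And>s. 0 < s \<Longrightarrow> s < d1 \<Longrightarrow> dist (dt u (x, s)) (v (x, 0)) < e"
      unfolding eventually_at_right_field by auto
    have "\<forall>\<^sub>F h in at_right 0. dist ((u (x, h) - u (x, 0)) / (h - 0)) 0 < e"
      by (rule tendstoD[OF q \<open>e > 0\<close>])
    then obtain d2 where d2: "d2 > 0" "\<And>h. 0 < h \<Longrightarrow> h < d2 \<Longrightarrow> dist ((u (x, h) - u (x, 0)) / (h - 0)) 0 < e"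
      unfolding eventually_at_right_field by auto
    define h where "h = min d1 d2 / 2"
    have h: "0 < h" "h < d1" "h < d2" using d1 d2 by (auto simp: h_def)
    obtain s where s: "0 < s" "s < h" "u (x, h) - u (x, 0) = (h - 0) * dt u (x, s)"
    proof -
      have "\<exists>l z. 0 < z \<and> z < h \<and> ((\<lambda>s. u (x, s)) has_real_derivative l) (at z) \<and>
         u (x, h) - u (x, 0) = (h - 0) * l"
      proof (rule MVT[OF h(1)])
        show "continuous_on {0..h} (\<lambda>s. u (x, s))" by (rule continuous_on_subset[OF ux]) auto
        show "(\<lambda>s. u (x, s)) differentiable (at s)" if "0 < s" "s < h" for s
          using time_slice[OF wave_solution_diff(1)[OF u x that(1)]]
          by (auto simp: real_differentiable_def)
      qed
      then show thesis
        using that time_slice[OF wave_solution_diff(1)[OF u x]] DERIV_unique by blast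
    qed
    have "dist (dt u (x, s)) 0 < e" using d2(2)[OF h(1,3)] s(3) h(1) by simp
    moreover have "dist (dt u (x, s)) (v (x, 0)) < e" using d1(2)[of s] s h by simp
    ultimately show False unfolding dist_real_def e_def by linarith
  qed
  with lim show ?thesis by simp
qed

text \<open>If the gradient had a limit \<open>\<noteq> 0\<close> at \<open>(x, 0)\<close>, then \<open>u(\<cdot>, s)\<close> would increase by a fixed amount
  over a short segment for all small \<open>s > 0\<close>, contradicting \<open>u(\<cdot>, 0) = 0\<close>.\<close>

lemma initial_gradient_limit:
  assumes D: "open D" and u: "wave_solution D c u" and x: "x \<in> D"
  shows "((\<lambda>s. dx i u (x, s)) \<longlongrightarrow> 0) (at_right 0)"
proof -
  obtain v where v: "continuous_on (D \<times> {0..}) v" "\<forall>p\<in>D \<times> {0<..}. v p = dx i u p"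
    using wave_solutionD(4)[OF u] by blast
  have cd: "D \<subseteq> closure D" by (rule closure_subset)
  have "continuous_on {0..} (\<lambda>s. v (x, s))" by (rule continuous_on_cross(1)[OF v(1) x])
  then have "((\<lambda>s. v (x, s)) \<longlongrightarrow> v (x, 0)) (at 0 within {0..})"
    by (simp add: continuous_on_def)
  then have "((\<lambda>s. v (x, s)) \<longlongrightarrow> v (x, 0)) (at_right 0)"
    by (rule tendsto_within_subset) auto
  then have lim: "((\<lambda>s. dx i u (x, s)) \<longlongrightarrow> v (x, 0)) (at_right 0)"
    using v(2) x by (subst tendsto_cong[of _ "\<lambda>s. v (x, s)"])
      (auto simp: eventually_at_right_less intro!: eventually_mono[OF eventually_at_right_less])
  have ulim: "((\<lambda>s. u (y, s)) \<longlongrightarrow> 0) (at_right 0)" if "y \<in> D" for y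
  proof -
    have "continuous_on {0..} (\<lambda>s. u (y, s))"
      using that cd by (intro continuous_on_cross(1)[OF wave_solutionD(2)[OF u]]) auto
    then have "((\<lambda>s. u (y, s)) \<longlongrightarrow> u (y, 0)) (at 0 within {0..})"
      by (simp add: continuous_on_def)
    then show ?thesis
      using wave_solutionD(6)[OF u that] by (auto elim: tendsto_within_subset)
  qed
  have "v (x, 0) = 0"
  proof (rule ccontr)
    define e where "e = \<bar>v (x, 0)\<bar> / 2"
    assume "v (x, 0) \<noteq> 0"
    then have "e > 0" by (simp add: e_def)
    then obtain d1 where d1: "d1 > 0"
      "\<And>p. p \<in> D \<times> {0..} \<Longrightarrow> dist p (x, 0) < d1 \<Longrightarrow> dist (v p) (v (x, 0)) < e"
      using v(1) x unfolding continuous_on_iff by (metis SigmaI atLeast_iff order_refl)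
    obtain d2 where d2: "d2 > 0" "ball x d2 \<subseteq> D" using D x openE by blast
    define h where "h = min d1 d2 / 2"
    have h: "0 < h" "2 * h \<le> d1" "h < d2" using d1 d2 by (auto simp: h_def)
    define a where "a = (axis i 1 :: pt)"
    have na: "norm a = 1" by (simp add: a_def)
    have inD: "x + k *\<^sub>R a \<in> D" if "0 \<le> k" "k \<le> h" for k
      using d2(2) that h na by (intro subsetD[OF d2(2)]) (simp add: dist_norm)
    have "\<bar>u (x + h *\<^sub>R a, s) - u (x, s)\<bar> \<ge> h * e" if s: "0 < s" "s < h" for s
    proof -
      have der: "((\<lambda>k. u (x + k *\<^sub>R a, s)) has_real_derivative dx i u (x + k *\<^sub>R a, s)) (at k)"
        if "0 \<le> k" "k \<le> h" for k
        using line_derivative[of u "(x, s)" k "(a, 0)"]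
          wave_solution_diff(1)[OF u inD[OF that] s(1)] by (simp add: a_def)
      obtain k where k: "0 < k" "k < h"
        "u (x + h *\<^sub>R a, s) - u (x + 0 *\<^sub>R a, s) = (h - 0) * dx i u (x + k *\<^sub>R a, s)"
        using MVT2[OF h(1) der] by blast
      have "dist (x + k *\<^sub>R a, s) (x, 0) \<le> k + s"
        using sqrt_sum_squares_le_sum[of k s] k(1) s(1) na by (simp add: dist_Pair_Pair dist_norm norm_Pair)
      also have "\<dots> < d1" using k s h by linarith
      finally have "dist (v (x + k *\<^sub>R a, s)) (v (x, 0)) < e"
        using d1(2)[of "(x + k *\<^sub>R a, s)"] inD[of k] k s by simp
      moreover have "v (x + k *\<^sub>R a, s) = dx i u (x + k *\<^sub>R a, s)"
        using v(2) inD[of k] k s by auto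
      ultimately have "\<bar>dx i u (x + k *\<^sub>R a, s)\<bar> \<ge> e"
        unfolding dist_real_def e_def by linarith
      then show ?thesis using k(3) h(1) by (simp add: abs_mult)
    qed
    then have "\<forall>\<^sub>F s in at_right 0. h * e \<le> \<bar>u (x + h *\<^sub>R a, s) - u (x, s)\<bar>"
      unfolding eventually_at_right_field using h(1) by blast
    moreover have "((\<lambda>s. \<bar>u (x + h *\<^sub>R a, s) - u (x, s)\<bar>) \<longlongrightarrow> \<bar>0 - 0\<bar>) (at_right 0)"
      using h(1) by (intro tendsto_intros ulim inD x) auto
    ultimately have "h * e \<le> \<bar>0 - 0\<bar>"
      by (intro tendsto_lowerbound) auto
    then show False using h(1) \<open>e > 0\<close> by (simp add: mult_le_0_iff)
  qed
  with lim show ?thesis by simp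
qed

lemma set_integrable_dominated:
  fixes f g :: "'a::euclidean_space \<Rightarrow> real"
  assumes "open A" "continuous_on A f" "set_integrable lborel A g" "\<And>x. x \<in> A \<Longrightarrow> \<bar>f x\<bar> \<le> g x"
  shows "set_integrable lborel A f"
proof (rule set_integrable_bound[OF assms(3)])
  show "set_borel_measurable lborel A f"
    using borel_measurable_continuous_on_indicator[of A f] assms(1,2)
    by (simp add: set_borel_measurable_def)
  show "AE x in lborel. x \<in> A \<longrightarrow> norm (f x) \<le> norm (g x)"
    by (intro AE_I2 impI) (use assms(4) in \<open>fastforce intro: order_trans[OF _ abs_ge_self]\<close>)
qed

text \<open>The sum of all squares that the solution class bounds in \<open>L\<^sup>1\<close>; it serves as a common
  majorant.\<close>

definition jet_square :: "field \<Rightarrow> field" where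
  "jet_square u p = (dt u p)\<^sup>2 + (dt (dt u) p)\<^sup>2 + (\<Sum>i\<in>UNIV. (dx i u p)\<^sup>2 + (dx i (dt u) p)\<^sup>2)"

lemma jet_square_ge:
  "(dt u p)\<^sup>2 \<le> jet_square u p" "(dt (dt u) p)\<^sup>2 \<le> jet_square u p"
  "(dx i u p)\<^sup>2 \<le> jet_square u p" "(dx i (dt u) p)\<^sup>2 \<le> jet_square u p" "0 \<le> jet_square u p"
proof -
  have "(dx i u p)\<^sup>2 + (dx i (dt u) p)\<^sup>2 \<le> (\<Sum>i\<in>UNIV. (dx i u p)\<^sup>2 + (dx i (dt u) p)\<^sup>2)"
    by (rule member_le_sum) auto
  then show "(dx i u p)\<^sup>2 \<le> jet_square u p" "(dx i (dt u) p)\<^sup>2 \<le> jet_square u p"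
    unfolding jet_square_def
    using zero_le_power2[of "dx i u p"] zero_le_power2[of "dx i (dt u) p"]
      zero_le_power2[of "dt u p"] zero_le_power2[of "dt (dt u) p"] by linarith+
next
  have "0 \<le> (\<Sum>i\<in>UNIV. (dx i u p)\<^sup>2 + (dx i (dt u) p)\<^sup>2)" by (intro sum_nonneg) simp
  then show "(dt u p)\<^sup>2 \<le> jet_square u p" "(dt (dt u) p)\<^sup>2 \<le> jet_square u p" "0 \<le> jet_square u p"
    unfolding jet_square_def using zero_le_power2[of "dt u p"] zero_le_power2[of "dt (dt u) p"] by linarith+
qed

definition energy_fields :: "field \<Rightarrow> field set" where
  "energy_fields u = {dt u, dt (dt u)} \<union> range (\<lambda>i. dx i u) \<union> range (\<lambda>i. dx i (dt u))"

lemma wave_solution_energy_bound: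
  assumes "wave_solution D c u"
  obtains C where
    "\<And>t q. 0 < t \<Longrightarrow> t \<le> T \<Longrightarrow> q \<in> energy_fields u \<Longrightarrow>
      set_integrable lborel (D \<inter> ball 0 R) (\<lambda>x. (q (x, t))\<^sup>2)"
    "\<And>t q. 0 < t \<Longrightarrow> t \<le> T \<Longrightarrow> q \<in> energy_fields u \<Longrightarrow>
      (LINT x:D \<inter> ball 0 R|lborel. (q (x, t))\<^sup>2) \<le> C"
proof -
  obtain C where "\<forall>t\<in>{0<..T}. \<forall>q\<in>energy_fields u.
      set_integrable lborel (D \<inter> ball 0 R) (\<lambda>x. (q (x, t))\<^sup>2) \<and>
      (LINT x:D \<inter> ball 0 R|lborel. (q (x, t))\<^sup>2) \<le> C"
    using assms unfolding wave_solution_def solution_class_def energy_fields_def by meson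
  then show thesis by (intro that[of C]) auto
qed

lemma jet_square_bound:
  assumes "wave_solution D c u"
  obtains B where "\<And>t. 0 < t \<Longrightarrow> t \<le> T \<Longrightarrow> set_integrable lborel (D \<inter> ball 0 R) (\<lambda>x. jet_square u (x, t))"
    "\<And>t. 0 < t \<Longrightarrow> t \<le> T \<Longrightarrow> (LINT x:D \<inter> ball 0 R|lborel. jet_square u (x, t)) \<le> B"
proof -
  let ?A = "D \<inter> ball 0 R"
  note I = set_integral_add
  obtain C where i: "\<And>t v. 0 < t \<Longrightarrow> t \<le> T \<Longrightarrow> v \<in> energy_fields u \<Longrightarrow> set_integrable lborel ?A (\<lambda>x. (v (x, t))\<^sup>2)"
    and b: "\<And>t v. 0 < t \<Longrightarrow> t \<le> T \<Longrightarrow> v \<in> energy_fields u \<Longrightarrow> (LINT x:?A|lborel. (v (x, t))\<^sup>2) \<le> C"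
    by (rule wave_solution_energy_bound[OF assms]) (rule that)
  have F: "dt u \<in> energy_fields u" "dt (dt u) \<in> energy_fields u" "dx i u \<in> energy_fields u"
    "dx i (dt u) \<in> energy_fields u" for i by (auto simp: energy_fields_def)
  note i = i[OF _ _ F(1)] i[OF _ _ F(2)] i[OF _ _ F(3)] i[OF _ _ F(4)]
    and b = b[OF _ _ F(1)] b[OF _ _ F(2)] b[OF _ _ F(3)] b[OF _ _ F(4)]
  have s: "set_integrable lborel ?A (\<lambda>x. \<Sum>i\<in>UNIV. (dx i u (x, t))\<^sup>2 + (dx i (dt u) (x, t))\<^sup>2)"
    "(LINT x:?A|lborel. (\<Sum>i\<in>UNIV. (dx i u (x, t))\<^sup>2 + (dx i (dt u) (x, t))\<^sup>2)) \<le> 4 * C"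
    if t: "0 < t" "t \<le> T" for t
  proof -
    have a: "set_integrable lborel ?A (\<lambda>x. (dx i u (x, t))\<^sup>2 + (dx i (dt u) (x, t))\<^sup>2)" for i
      by (rule I(1)[OF i(3)[OF t] i(4)[OF t]])
    have "(LINT x:?A|lborel. (dx i u (x, t))\<^sup>2 + (dx i (dt u) (x, t))\<^sup>2) \<le> 2 * C" for i
      using b(3)[OF t, of i] b(4)[OF t, of i] by (subst I(2)[OF i(3)[OF t] i(4)[OF t]]) linarith
    note bb = this[of 1] this[of 2]
    show "set_integrable lborel ?A (\<lambda>x. \<Sum>i\<in>UNIV. (dx i u (x, t))\<^sup>2 + (dx i (dt u) (x, t))\<^sup>2)"
      using a[of 1] a[of 2] by (simp add: sum_2 I)
    show "(LINT x:?A|lborel. (\<Sum>i\<in>UNIV. (dx i u (x, t))\<^sup>2 + (dx i (dt u) (x, t))\<^sup>2)) \<le> 4 * C"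
      unfolding sum_2 using bb by (subst I(2)[OF a a]) linarith
  qed
  show thesis
  proof (rule that[of "6 * C"])
    fix t assume t: "0 < t" "t \<le> T"
    have a: "set_integrable lborel ?A (\<lambda>x. (dt u (x, t))\<^sup>2 + (dt (dt u) (x, t))\<^sup>2)"
      by (rule I(1)[OF i(1)[OF t] i(2)[OF t]])
    show "set_integrable lborel ?A (\<lambda>x. jet_square u (x, t))"
      unfolding jet_square_def by (rule I(1)[OF a s(1)[OF t]])
    have "(LINT x:?A|lborel. (dt u (x, t))\<^sup>2 + (dt (dt u) (x, t))\<^sup>2) \<le> 2 * C"
      using b(1)[OF t] b(2)[OF t] by (subst I(2)[OF i(1)[OF t] i(2)[OF t]]) linarith
    then show "(LINT x:?A|lborel. jet_square u (x, t)) \<le> 6 * C"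
      unfolding jet_square_def using s(2)[OF t] by (subst I(2)[OF a s(1)[OF t]]) linarith
  qed
qed

lemma jet_continuous:
  assumes "wave_solution D c u"
  shows "continuous_on (D \<times> {0<..}) (dt u)" "continuous_on (D \<times> {0<..}) (dx i u)"
    "continuous_on (D \<times> {0<..}) (dt (dt u))" "continuous_on (D \<times> {0<..}) (dx i (dt u))"
    "continuous_on (D \<times> {0<..}) (laplacian u)"
  unfolding laplacian_def
proof -
  note C = wave_solution_C1[OF assms]
  show "continuous_on (D \<times> {0<..}) (dt u)" "continuous_on (D \<times> {0<..}) (dx i u)"
    by (rule C1_on_continuous[OF C(2)] C1_on_continuous[OF C(3)])+
  have p: "continuous_on (D \<times> {0<..}) (partial b v)"
    if "C1_on (D \<times> {0<..}) v" "b \<in> Basis" for b and v :: field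
    using that by (simp only: C1_on_iff)
  show "continuous_on (D \<times> {0<..}) (dt (dt u))" "continuous_on (D \<times> {0<..}) (dx i (dt u))"
    by (rule p[OF C(2)] time_basis space_basis)+
  show "continuous_on (D \<times> {0<..}) (\<lambda>p. \<Sum>i\<in>UNIV. dx i (dx i u) p)"
    by (intro continuous_on_sum p[OF C(3)] space_basis)
qed

lemma set_integrable_zero_off:
  assumes "set_integrable lborel (A \<inter> B) f" "\<And>x. x \<in> A - B \<Longrightarrow> f x = 0"
  shows "set_integrable lborel A f" "(LINT x:A|lborel. f x) = (LINT x:A \<inter> B|lborel. f x)"
proof -
  have "(\<lambda>x. indicator A x *\<^sub>R f x) = (\<lambda>x. indicator (A \<inter> B) x *\<^sub>R f x)"
    using assms(2) by (auto simp: fun_eq_iff indicator_def)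
  then show "set_integrable lborel A f" "(LINT x:A|lborel. f x) = (LINT x:A \<inter> B|lborel. f x)"
    using assms(1) by (simp_all add: set_integrable_def set_lebesgue_integral_def)
qed

lemma partial_zero_outside:
  fixes \<phi> :: "'a::euclidean_space \<Rightarrow> real"
  assumes "open D" "closed K" "\<And>x. x \<in> D - K \<Longrightarrow> \<phi> x = 0" "x \<in> D - K"
  shows "partial b \<phi> x = 0"
proof -
  have "open (D - K)" using assms(1,2) by (rule open_Diff)
  then have "partial b \<phi> x = partial b (\<lambda>_. 0) x" using assms(4) by (rule partial_cong_open) (rule assms(3))
  also have "\<dots> = 0" by (rule partial_eqI[THEN trans]) (auto intro: has_derivative_const)
  finally show ?thesis .
qed

text \<open>The properties of a test function that make \<open>green D u t \<phi>\<close> an absolutely convergent integral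
  for every wave \<open>u\<close> in \<open>D\<close>; no condition on the boundary of \<open>D\<close> is included.\<close>

definition admissible :: "pt set \<Rightarrow> (pt \<Rightarrow> real) \<Rightarrow> bool" where
  "admissible D \<phi> \<longleftrightarrow> C1_on D \<phi> \<and> (\<exists>R. \<forall>x\<in>D - cball 0 R. \<phi> x = 0) \<and>
     set_integrable lborel D (\<lambda>x. (\<phi> x)\<^sup>2) \<and>
     (\<forall>i. set_integrable lborel D (\<lambda>x. (partial (axis i 1) \<phi> x)\<^sup>2))"

lemma admissible_cong:
  assumes "open D" "\<And>x. x \<in> D \<Longrightarrow> \<phi> x = \<psi> x" "admissible D \<phi>"
  shows "admissible D \<psi>"
proof -
  have p: "partial b \<psi> x = partial b \<phi> x" if "x \<in> D" for x b
    using partial_cong_open[OF assms(1) that assms(2)] by simp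
  have c: "set_integrable lborel D g \<longleftrightarrow> set_integrable lborel D f"
    if "\<And>x. x \<in> D \<Longrightarrow> g x = f x" for f g :: "pt \<Rightarrow> real"
    using that assms(1) by (intro set_integrable_cong) auto
  have "C1_on D \<psi>" using assms(2,3) C1_on_cong_open[OF assms(1), of \<phi> \<psi>] by (simp add: admissible_def)
  moreover obtain R where "\<forall>x\<in>D - cball 0 R. \<phi> x = 0" using assms(3) unfolding admissible_def by blast
  then have "\<forall>x\<in>D - cball 0 R. \<psi> x = 0" using assms(2) by simp
  moreover have "set_integrable lborel D (\<lambda>x. (\<psi> x)\<^sup>2)"
    using assms(3) c[of "\<lambda>x. (\<psi> x)\<^sup>2" "\<lambda>x. (\<phi> x)\<^sup>2"] assms(2) unfolding admissible_def by simp
  moreover have "set_integrable lborel D (\<lambda>x. (partial (axis i 1) \<psi> x)\<^sup>2)" for i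
    using assms(3) c[of "\<lambda>x. (partial (axis i 1) \<psi> x)\<^sup>2" "\<lambda>x. (partial (axis i 1) \<phi> x)\<^sup>2"] p
    unfolding admissible_def by simp
  ultimately show ?thesis unfolding admissible_def by blast
qed

lemma green_integrable:
  assumes D: "open D" and u: "wave_solution D c u" and c: "c > 0" and t: "t > 0" and \<phi>: "admissible D \<phi>"
  shows "set_integrable lborel D
    (\<lambda>x. laplacian u (x, t) * \<phi> x + (\<Sum>i\<in>UNIV. dx i u (x, t) * partial (axis i 1) \<phi> x))"
proof -
  obtain R where R: "\<And>x. x \<in> D - cball 0 R \<Longrightarrow> \<phi> x = 0" using \<phi> unfolding admissible_def by meson
  have R': "partial b \<phi> x = 0" if "x \<in> D - cball 0 R" for x b
    using partial_zero_outside[OF D closed_cball R that] .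
  define B where "B = ball (0::pt) (R + 1)"
  have B: "cball 0 R \<subseteq> B" "open B" by (auto simp: B_def)
  obtain C where "set_integrable lborel (D \<inter> B) (\<lambda>x. jet_square u (x, t))"
    unfolding B_def using jet_square_bound[OF u, of t "R + 1"] t by blast
  note J = this
  have sub: "set_integrable lborel D f \<Longrightarrow> set_integrable lborel (D \<inter> B) f" for f :: "pt \<Rightarrow> real"
    using D B(2) by (elim set_integrable_subset) auto
  have P: "set_integrable lborel (D \<inter> B) (\<lambda>x. (\<phi> x)\<^sup>2)"
      "set_integrable lborel (D \<inter> B) (\<lambda>x. (partial (axis i 1) \<phi> x)\<^sup>2)" for i
    using \<phi> by (auto simp: admissible_def intro: sub)
  let ?g = "\<lambda>x. (1 / c\<^sup>2 + 2) * jet_square u (x, t) + (1 / c\<^sup>2) * (\<phi> x)\<^sup>2 +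
     ((partial (axis 1 1) \<phi> x)\<^sup>2 + (partial (axis 2 1) \<phi> x)\<^sup>2)"
  have am: "\<bar>a * b\<bar> \<le> a\<^sup>2 + b\<^sup>2" for a b :: real
  proof -
    have "0 \<le> (\<bar>a\<bar> - \<bar>b\<bar>)\<^sup>2" by simp
    then have "2 * (\<bar>a\<bar> * \<bar>b\<bar>) \<le> a\<^sup>2 + b\<^sup>2" by (simp add: power2_diff)
    moreover have "0 \<le> \<bar>a\<bar> * \<bar>b\<bar>" by simp
    ultimately show ?thesis unfolding abs_mult by linarith
  qed
  have "set_integrable lborel (D \<inter> B)
    (\<lambda>x. laplacian u (x, t) * \<phi> x + (\<Sum>i\<in>UNIV. dx i u (x, t) * partial (axis i 1) \<phi> x))"
  proof (rule set_integrable_dominated[where g="?g"])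
    show "open (D \<inter> B)" using D B by auto
    show "continuous_on (D \<inter> B) (\<lambda>x. laplacian u (x, t) * \<phi> x + (\<Sum>i\<in>UNIV. dx i u (x, t) * partial (axis i 1) \<phi> x))"
    proof (rule continuous_on_subset[of D])
      show "continuous_on D (\<lambda>x. laplacian u (x, t) * \<phi> x + (\<Sum>i\<in>UNIV. dx i u (x, t) * partial (axis i 1) \<phi> x))"
      proof -
        have C: "C1_on D \<phi>" using \<phi> by (simp add: admissible_def)
        then have "continuous_on D \<phi>" "continuous_on D (partial (axis i 1) \<phi>)" for i
          using C1_on_continuous[OF C] space_basis(2)[of i] by (auto simp: C1_on_iff)
        then show ?thesis
          using t by (intro continuous_on_add continuous_on_mult continuous_on_sum
            continuous_on_cross(2)[OF jet_continuous(2)[OF u]]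
            continuous_on_cross(2)[OF jet_continuous(5)[OF u]]) auto
      qed
    qed auto
    show "set_integrable lborel (D \<inter> B) ?g"
      using J P by (intro set_integral_add set_integrable_mult_right) auto
    fix x assume x: "x \<in> D \<inter> B"
    have "laplacian u (x, t) = (1 / c\<^sup>2) * dt (dt u) (x, t)"
      using wave_solutionD(5)[OF u, of x t] x t c by simp
    then have "\<bar>laplacian u (x, t) * \<phi> x\<bar> = (1 / c\<^sup>2) * \<bar>dt (dt u) (x, t) * \<phi> x\<bar>"
      using c by (simp add: abs_mult)
    also have "\<dots> \<le> (1 / c\<^sup>2) * ((dt (dt u) (x, t))\<^sup>2 + (\<phi> x)\<^sup>2)"
      using c by (intro mult_left_mono am) auto
    also have "\<dots> \<le> (1 / c\<^sup>2) * (jet_square u (x, t) + (\<phi> x)\<^sup>2)"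
      using c jet_square_ge(2)[of u "(x, t)"] by (intro mult_left_mono add_right_mono) auto
    finally have 1: "\<bar>laplacian u (x, t) * \<phi> x\<bar> \<le> (1 / c\<^sup>2) * jet_square u (x, t) + (1 / c\<^sup>2) * (\<phi> x)\<^sup>2"
      by (simp add: distrib_left)
    have 2: "\<bar>dx i u (x, t) * partial (axis i 1) \<phi> x\<bar> \<le> jet_square u (x, t) + (partial (axis i 1) \<phi> x)\<^sup>2" for i
      using am[of "dx i u (x, t)" "partial (axis i 1) \<phi> x"] jet_square_ge(3)[where u=u and p="(x, t)" and i=i] by linarith
    show "\<bar>laplacian u (x, t) * \<phi> x + (\<Sum>i\<in>UNIV. dx i u (x, t) * partial (axis i 1) \<phi> x)\<bar> \<le> ?g x"
      using 1 2[of 1] 2[of 2] unfolding sum_2 distrib_right by linarith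
  qed
  then show ?thesis
    by (rule set_integrable_zero_off(1)) (use R R' B(1) in \<open>auto simp: subset_eq\<close>)
qed

section \<open>Localized energy in a shrinking cone\<close>

text \<open>A cut-off \<open>\<eta>\<close> for the backward cone \<open>\<bar>x - z\<bar> < r - C t\<close>, of class \<open>C\<^sup>1\<close> and positive exactly there
  as long as \<open>C t \<le> r\<close>.\<close>

definition cone_cutoff :: "pt \<Rightarrow> real \<Rightarrow> real \<Rightarrow> field" where
  "cone_cutoff z r C p = sqpos ((r - C * snd p)\<^sup>2 - (norm (fst p - z))\<^sup>2)"

text \<open>The common factor of the derivatives of \<open>\<eta>\<close>: \<open>\<partial>\<^sub>t\<eta> = - m C (r - C t)\<close> and
  \<open>\<nabla>\<eta> = - m (x - z)\<close> with \<open>m = cone_slope z r C\<close>.\<close>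

definition cone_slope :: "pt \<Rightarrow> real \<Rightarrow> real \<Rightarrow> field" where
  "cone_slope z r C p = 4 * max 0 ((r - C * snd p)\<^sup>2 - (norm (fst p - z))\<^sup>2)"

lemma cone_cutoff_nonneg: "0 \<le> cone_cutoff z r C p" "0 \<le> cone_slope z r C p"
  by (auto simp: cone_cutoff_def cone_slope_def sqpos_def)

lemma cone_cutoff_time_deriv:
  "((\<lambda>s. cone_cutoff z r C (x, s)) has_real_derivative
     - cone_slope z r C (x, t) * (C * (r - C * t))) (at t)"
proof -
  have "((\<lambda>s. (r - C * s)\<^sup>2 - (norm (x - z))\<^sup>2) has_real_derivative - 2 * C * (r - C * t)) (at t)"
    by (auto intro!: derivative_eq_intros)
  from DERIV_chain2[OF sqpos_deriv this] show ?thesis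
    unfolding cone_cutoff_def cone_slope_def fst_conv snd_conv
    by (rule DERIV_cong) simp
qed

lemma cone_cutoff_space_deriv:
  "((\<lambda>y. cone_cutoff z r C (y, t)) has_derivative
     (\<lambda>h. - cone_slope z r C (x, t) * ((x - z) \<bullet> h))) (at x)"
proof -
  have "((\<lambda>y. (r - C * t)\<^sup>2 - (norm (y - z))\<^sup>2) has_derivative (\<lambda>h. - 2 * ((x - z) \<bullet> h))) (at x)"
    unfolding power2_norm_eq_inner
    by (auto intro!: derivative_eq_intros simp: inner_commute)
  from has_derivative_compose[OF this sqpos_deriv[unfolded has_field_derivative_def]]
  show ?thesis unfolding cone_cutoff_def cone_slope_def fst_conv snd_conv
    by (rule has_derivative_eq_rhs) (auto simp: fun_eq_iff)
qed

lemma cone_cutoff_partial: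
  "partial (axis i 1) (\<lambda>y. cone_cutoff z r C (y, t)) x = - cone_slope z r C (x, t) * (x - z) $ i"
  using partial_eqI[OF cone_cutoff_space_deriv] by (simp add: inner_axis)

lemma cone_continuous: "continuous_on S (cone_slope z r C)" "continuous_on S (cone_cutoff z r C)"
  unfolding cone_cutoff_def cone_slope_def sqpos_def by (intro continuous_intros)+

lemma cone_cutoff_C1: "C1_on S (\<lambda>y. cone_cutoff z r C (y, t))"
proof (rule C1_onI[OF cone_cutoff_space_deriv])
  show "continuous_on S (\<lambda>x. - cone_slope z r C (x, t) * ((x - z) \<bullet> b))" for b
    by (intro continuous_intros continuous_on_compose2[OF cone_continuous(1)[of UNIV]]) auto
qed

lemma cone_cutoff_zero:
  assumes "0 \<le> C" "0 \<le> t" "C * t \<le> r" "r - C * t \<le> norm (x - z)"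
  shows "cone_cutoff z r C (x, t) = 0" "cone_slope z r C (x, t) = 0"
proof -
  have "(r - C * t)\<^sup>2 \<le> (norm (x - z))\<^sup>2" using assms by (intro power_mono) auto
  then show "cone_cutoff z r C (x, t) = 0" "cone_slope z r C (x, t) = 0"
    by (auto simp: cone_cutoff_def cone_slope_def sqpos_def)
qed

lemma cone_cutoff_pos:
  assumes "norm (x - z) < r - C * t"
  shows "0 < cone_cutoff z r C (x, t)"
proof -
  have "(norm (x - z))\<^sup>2 < (r - C * t)\<^sup>2" using assms by (intro power_strict_mono) auto
  then show ?thesis by (auto simp: cone_cutoff_def sqpos_def)
qed

lemma cone_cutoff_bounds:
  assumes "0 \<le> C" "0 \<le> t" "C * t \<le> r"
  shows "cone_cutoff z r C (x, t) \<le> r^4" "cone_slope z r C (x, t) \<le> 4 * r\<^sup>2"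
proof -
  have "(r - C * t)\<^sup>2 \<le> r\<^sup>2" using assms by (intro power_mono) auto
  then have m: "max 0 ((r - C * t)\<^sup>2 - (norm (x - z))\<^sup>2) \<le> r\<^sup>2" by (smt (verit) zero_le_power2)
  then show "cone_slope z r C (x, t) \<le> 4 * r\<^sup>2" by (simp add: cone_slope_def)
  have "(max 0 ((r - C * t)\<^sup>2 - (norm (x - z))\<^sup>2))\<^sup>2 \<le> (r\<^sup>2)\<^sup>2"
    using m by (intro power_mono) auto
  then show "cone_cutoff z r C (x, t) \<le> r^4"
    by (simp add: cone_cutoff_def sqpos_def power_mult[symmetric])
qed

definition energy_density :: "real \<Rightarrow> field \<Rightarrow> field" where
  "energy_density c u p = ((dt u p)\<^sup>2 / c\<^sup>2 + (\<Sum>i\<in>UNIV. (dx i u p)\<^sup>2)) / 2"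

lemma energy_density_nonneg: "0 \<le> energy_density c u p"
  by (auto simp: energy_density_def intro!: add_nonneg_nonneg sum_nonneg)

text \<open>The time derivative of \<open>energy_density\<close>.\<close>

definition power_density :: "real \<Rightarrow> field \<Rightarrow> field" where
  "power_density c u p = dt u p * dt (dt u) p / c\<^sup>2 + (\<Sum>i\<in>UNIV. dx i u p * dx i (dt u) p)"

lemma energy_density_time_deriv:
  assumes "open D" "wave_solution D c u" "x \<in> D" "t > 0"
  shows "((\<lambda>s. energy_density c u (x, s)) has_real_derivative power_density c u (x, t)) (at t)"
proof -
  note d = time_slice[OF wave_solution_diff(2)[OF assms(2-4)]]
    time_slice[OF wave_solution_diff(3)[OF assms(2-4)]]
  have "((\<lambda>s. energy_density c u (x, s)) has_real_derivative
     ((2 * dt u (x, t) * dt (dt u) (x, t)) / c\<^sup>2 + (\<Sum>i\<in>UNIV. 2 * dx i u (x, t) * dt (dx i u) (x, t))) / 2) (at t)"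
    unfolding energy_density_def
    by (intro DERIV_cdivide DERIV_add DERIV_sum DERIV_cong[OF DERIV_power[OF d(1)]] DERIV_cong[OF DERIV_power[OF d(2)]])
      (auto simp: mult_ac)
  then show ?thesis
    by (rule DERIV_cong) (simp add: power_density_def wave_solution_mixed[OF assms] sum_2 add_divide_distrib)
qed

text \<open>The time derivative of \<open>\<eta>\<close> times \<open>energy_density\<close>.\<close>

definition local_power :: "pt \<Rightarrow> real \<Rightarrow> real \<Rightarrow> real \<Rightarrow> field \<Rightarrow> field" where
  "local_power z r C c u p = cone_cutoff z r C p * power_density c u p
     - cone_slope z r C p * (C * (r - C * snd p)) * energy_density c u p"

lemma local_energy_time_deriv:
  assumes "open D" "wave_solution D c u" "x \<in> D" "t > 0"
  shows "((\<lambda>s. cone_cutoff z r C (x, s) * energy_density c u (x, s)) has_real_derivative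
    local_power z r C c u (x, t)) (at t)"
  by (rule DERIV_cong[OF DERIV_mult[OF cone_cutoff_time_deriv energy_density_time_deriv[OF assms]]])
    (simp add: local_power_def)

lemma local_power_continuous:
  assumes "wave_solution D c u" and c: "c > 0"
  shows "continuous_on (D \<times> {0<..}) (local_power z r C c u)"
    "continuous_on (D \<times> {0<..}) (energy_density c u)"
  unfolding local_power_def power_density_def energy_density_def
  using c by (intro continuous_intros cone_continuous jet_continuous[OF assms(1)]; simp)+

lemma prod_abs_le_squares: "\<bar>a * b\<bar> \<le> (a\<^sup>2 + b\<^sup>2) / 2" for a b :: real
proof -
  have "0 \<le> (\<bar>a\<bar> - \<bar>b\<bar>)\<^sup>2" by simp
  then have "2 * (\<bar>a\<bar> * \<bar>b\<bar>) \<le> a\<^sup>2 + b\<^sup>2" by (simp add: power2_diff)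
  then show ?thesis unfolding abs_mult by simp
qed

lemma energy_density_le: "c > 0 \<Longrightarrow> energy_density c u p \<le> (1 / c\<^sup>2 + 1) * jet_square u p"
proof -
  assume c: "c > 0"
  have "(dt u p)\<^sup>2 / c\<^sup>2 = (1 / c\<^sup>2) * (dt u p)\<^sup>2" by simp
  also have "\<dots> \<le> (1 / c\<^sup>2) * jet_square u p"
    using c jet_square_ge(1) by (intro mult_left_mono) auto
  finally have "(dt u p)\<^sup>2 / c\<^sup>2 \<le> (1 / c\<^sup>2) * jet_square u p" .
  moreover have "(\<Sum>i\<in>UNIV. (dx i u p)\<^sup>2) \<le> 2 * jet_square u p"
    unfolding sum_2 using jet_square_ge(3)[of 1 u p] jet_square_ge(3)[of 2 u p] by linarith
  moreover have "0 \<le> (1 / c\<^sup>2) * jet_square u p"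
    using jet_square_ge(5)[of u p] c by (intro mult_nonneg_nonneg) auto
  ultimately show ?thesis unfolding energy_density_def distrib_right by (simp add: field_simps)
qed

lemma power_density_le: "c > 0 \<Longrightarrow> \<bar>power_density c u p\<bar> \<le> (1 / c\<^sup>2 + 2) * jet_square u p"
proof -
  assume c: "c > 0"
  have "\<bar>dt u p * dt (dt u) p / c\<^sup>2\<bar> = (1 / c\<^sup>2) * \<bar>dt u p * dt (dt u) p\<bar>" by simp
  also have "\<dots> \<le> (1 / c\<^sup>2) * jet_square u p"
  proof (intro mult_left_mono)
    show "\<bar>dt u p * dt (dt u) p\<bar> \<le> jet_square u p"
      using prod_abs_le_squares[of "dt u p" "dt (dt u) p", unfolded add_divide_distrib]
        jet_square_ge(1,2)[of u p] by linarith
  qed (use c in auto)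
  finally have 1: "\<bar>dt u p * dt (dt u) p / c\<^sup>2\<bar> \<le> (1 / c\<^sup>2) * jet_square u p" .
  have 2: "\<bar>dx i u p * dx i (dt u) p\<bar> \<le> jet_square u p" for i
    using prod_abs_le_squares[of "dx i u p" "dx i (dt u) p", unfolded add_divide_distrib] jet_square_ge(3,4)[where u=u and p=p and i=i] by linarith
  show ?thesis
    unfolding power_density_def sum_2 distrib_right using 1 2[of 1] 2[of 2] by linarith
qed

lemma local_power_bound:
  assumes "0 \<le> C" "c > 0" "0 \<le> r"
  obtains B where "B \<ge> 0" "\<And>u x t. 0 \<le> t \<Longrightarrow> C * t \<le> r \<Longrightarrow> \<bar>local_power z r C c u (x, t)\<bar> \<le> B * jet_square u (x, t)"
proof (rule that[of "r^4 * (1 / c\<^sup>2 + 2) + 4 * r\<^sup>2 * (C * r) * (1 / c\<^sup>2 + 1)"])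
  show "0 \<le> r^4 * (1 / c\<^sup>2 + 2) + 4 * r\<^sup>2 * (C * r) * (1 / c\<^sup>2 + 1)"
    using assms by (intro add_nonneg_nonneg mult_nonneg_nonneg) auto
  fix u x t assume t: "0 \<le> (t::real)" "C * t \<le> r"
  let ?J = "jet_square u (x, t)"
  note b = cone_cutoff_bounds[OF assms(1) t, of z x]
  have "\<bar>cone_cutoff z r C (x, t) * power_density c u (x, t)\<bar> \<le> r^4 * ((1 / c\<^sup>2 + 2) * ?J)"
    unfolding abs_mult using b cone_cutoff_nonneg(1)[of z r C "(x, t)"] power_density_le[OF assms(2), of u "(x, t)"]
    by (intro mult_mono) auto
  moreover have "\<bar>cone_slope z r C (x, t) * (C * (r - C * t)) * energy_density c u (x, t)\<bar>
      \<le> 4 * r\<^sup>2 * (C * r) * ((1 / c\<^sup>2 + 1) * ?J)"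
    unfolding abs_mult
    using b cone_cutoff_nonneg(2)[of z r C "(x, t)"] energy_density_le[OF assms(2), of u "(x, t)"]
      energy_density_nonneg[of c u "(x, t)"] assms t
    by (intro mult_mono) (auto intro!: mult_nonneg_nonneg)
  ultimately have "\<bar>local_power z r C c u (x, t)\<bar> \<le> r^4 * ((1 / c\<^sup>2 + 2) * ?J) + 4 * r\<^sup>2 * (C * r) * ((1 / c\<^sup>2 + 1) * ?J)"
    unfolding local_power_def snd_conv by linarith
  then show "\<bar>local_power z r C c u (x, t)\<bar> \<le> (r^4 * (1 / c\<^sup>2 + 2) + 4 * r\<^sup>2 * (C * r) * (1 / c\<^sup>2 + 1)) * ?J"
    by (simp only: distrib_right mult.assoc)
qed

text \<open>The heart of finite propagation speed. The right-hand side is the integrand of Green's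
  functional tested with \<open>\<eta> \<partial>\<^sub>tu\<close>; it differs from the left-hand side by the flux \<open>\<partial>\<^sub>tu \<nabla>u \<bullet> \<nabla>\<eta>\<close>
  through the slope of the cut-off and by the loss \<open>\<partial>\<^sub>t\<eta> e\<close>, where \<open>e\<close> is the energy density.
  On the cone \<open>\<bar>\<nabla>\<eta>\<bar> \<le> - \<partial>\<^sub>t\<eta> / C\<close> and \<open>\<bar>\<partial>\<^sub>tu \<nabla>u\<bar> \<le> c e \<le> C e\<close>, so the loss dominates.\<close>

lemma local_power_le_green_density:
  assumes "wave_solution D c u" "x \<in> D" "t > 0" and c: "0 < c" "c \<le> C" and t: "C * t \<le> r"
  shows "local_power z r C c u (x, t)
    \<le> laplacian u (x, t) * (cone_cutoff z r C (x, t) * dt u (x, t)) +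
      (\<Sum>i\<in>UNIV. dx i u (x, t) * partial (axis i 1) (\<lambda>y. cone_cutoff z r C (y, t) * dt u (y, t)) x)"
proof -
  let ?\<eta> = "cone_cutoff z r C (x, t)" and ?m = "cone_slope z r C (x, t)"
  define P where "P = (\<chi> i. dx i u (x, t))"
  define v where "v = dt u (x, t)"
  have "(\<lambda>y. cone_cutoff z r C (y, t)) differentiable (at x)"
    using cone_cutoff_space_deriv unfolding differentiable_def by blast
  moreover have du: "dt u differentiable (at (x, t))" by (rule wave_solution_diff(2)[OF assms(1-3)])
  then have "(\<lambda>y. dt u (y, t)) differentiable (at x)"
    using space_slice(1) unfolding differentiable_def by blast
  ultimately have part: "partial (axis i 1) (\<lambda>y. cone_cutoff z r C (y, t) * dt u (y, t)) x
      = ?\<eta> * dx i (dt u) (x, t) - ?m * (x - z) $ i * v" for i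
    using space_slice(2)[OF du, of "axis i 1"] cone_cutoff_partial[of i z r C t x]
    by (simp add: partial_mult v_def)
  have lap: "laplacian u (x, t) = dt (dt u) (x, t) / c\<^sup>2"
    using wave_solutionD(5)[OF assms(1-3)] c by simp
  have inn: "P \<bullet> (x - z) = (\<Sum>i\<in>UNIV. dx i u (x, t) * (x - z) $ i)"
    by (simp add: P_def inner_vec_def)
  have nP: "(norm P)\<^sup>2 = (\<Sum>i\<in>UNIV. (dx i u (x, t))\<^sup>2)"
    unfolding power2_norm_eq_inner by (simp add: P_def inner_vec_def power2_eq_square)
  have eq: "laplacian u (x, t) * (?\<eta> * v) +
      (\<Sum>i\<in>UNIV. dx i u (x, t) * (?\<eta> * dx i (dt u) (x, t) - ?m * (x - z) $ i * v))
      = ?\<eta> * power_density c u (x, t) - ?m * (v * (P \<bullet> (x - z)))"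
  proof -
    have "X * (e * v) + (p1 * (e * q1 - m * y1 * v) + p2 * (e * q2 - m * y2 * v))
        = e * (v * X + (p1 * q1 + p2 * q2)) - m * (v * (p1 * y1 + p2 * y2))"
      for X e p1 p2 q1 q2 m y1 y2 :: real by algebra
    from this[of "dt (dt u) (x, t) / c\<^sup>2"] show ?thesis
      unfolding lap inn power_density_def sum_2 v_def times_divide_eq_right .
  qed
  have "?m * (v * (P \<bullet> (x - z))) \<le> ?m * (C * (r - C * t) * energy_density c u (x, t))"
  proof (cases "norm (x - z) < r - C * t")
    case True
    have "v * (P \<bullet> (x - z)) \<le> \<bar>v\<bar> * (norm P * norm (x - z))"
    proof -
      have "v * (P \<bullet> (x - z)) \<le> \<bar>v\<bar> * \<bar>P \<bullet> (x - z)\<bar>" by (simp add: abs_mult[symmetric])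
      also have "\<dots> \<le> \<bar>v\<bar> * (norm P * norm (x - z))"
        by (intro mult_left_mono Cauchy_Schwarz_ineq2) auto
      finally show ?thesis .
    qed
    also have "\<dots> \<le> \<bar>v\<bar> * (norm P * (r - C * t))"
      using True by (intro mult_left_mono) auto
    also have "\<dots> = c * \<bar>v / c * norm P\<bar> * (r - C * t)"
      using c by (simp add: abs_mult)
    \<comment> \<open>Splitting off \<open>c\<close> balances the two terms so that the product is bounded by the energy.\<close>
    also have "\<dots> \<le> c * (((v / c)\<^sup>2 + (norm P)\<^sup>2) / 2) * (r - C * t)"
      using c t by (intro mult_right_mono mult_left_mono prod_abs_le_squares) auto
    also have "\<dots> = c * energy_density c u (x, t) * (r - C * t)"
      by (simp add: energy_density_def nP v_def power_divide)
    also have "\<dots> \<le> C * energy_density c u (x, t) * (r - C * t)"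
      using c t energy_density_nonneg[of c u "(x, t)"] by (intro mult_right_mono) auto
    finally show ?thesis
      using cone_cutoff_nonneg(2)[of z r C "(x, t)"] by (intro mult_left_mono) (auto simp: mult_ac)
  next
    case False
    then show ?thesis using cone_cutoff_zero(2)[of C t r x z] c t assms(3) by simp
  qed
  then show ?thesis
    unfolding part v_def[symmetric] eq by (simp add: local_power_def mult_ac)
qed

section \<open>The energy method\<close>

text \<open>The energy method tests with the velocity, which is in \<open>H\<^sup>1\<close> near the boundary because the
  solution class controls \<open>\<nabla>\<partial>\<^sub>tu\<close> in \<open>L\<^sup>2\<close>.\<close>

lemma admissible_cutoff_velocity:
  assumes D: "open D" and u: "wave_solution D c u" and t: "t > 0"
    and \<zeta>: "C1_on UNIV \<zeta>" "\<And>x. x \<notin> cball 0 R \<Longrightarrow> \<zeta> x = 0"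
  shows "admissible D (\<lambda>x. \<zeta> x * dt u (x, t))"
proof -
  define N where "N = ball (0::pt) (R + 1)"
  have N: "open N" "cball 0 R \<subseteq> N" by (auto simp: N_def)
  have pc: "continuous_on UNIV (partial (axis i 1) \<zeta>)" for i
    using \<zeta>(1) space_basis(2) by (simp add: C1_on_iff)
  have "\<exists>M. \<forall>x\<in>cball 0 R. \<bar>f x\<bar> \<le> M" if "continuous_on UNIV f" for f :: "pt \<Rightarrow> real"
    using compact_imp_bounded[OF compact_continuous_image[OF continuous_on_subset[OF that] compact_cball]]
    by (simp add: bounded_iff)
  from this[OF C1_on_continuous[OF \<zeta>(1)]] this[OF pc]
  obtain M0 M' where M: "\<forall>x\<in>cball 0 R. \<bar>\<zeta> x\<bar> \<le> M0" "\<And>i. \<forall>x\<in>cball 0 R. \<bar>partial (axis i 1) \<zeta> x\<bar> \<le> M' i"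
    by metis
  have \<zeta>0: "partial (axis i 1) \<zeta> x = 0" if "x \<notin> cball 0 R" for x i
    using partial_zero_outside[OF open_UNIV closed_cball[of 0 R], of \<zeta> x] \<zeta>(2) that by simp
  have du: "C1_on D (\<lambda>x. dt u (x, t))" by (rule space_slice_C1[OF wave_solution_C1(2)[OF u] t])
  have C: "C1_on D (\<lambda>x. \<zeta> x * dt u (x, t))"
    by (rule C1_on_mult[OF C1_on_subset[OF \<zeta>(1)] du]) simp
  have part: "partial (axis i 1) (\<lambda>x. \<zeta> x * dt u (x, t)) x
      = \<zeta> x * dx i (dt u) (x, t) + partial (axis i 1) \<zeta> x * dt u (x, t)" if "x \<in> D" for i x
    using \<zeta>(1) du that space_slice(2)[OF wave_solution_diff(2)[OF u that t], of "axis i 1"]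
    by (simp add: partial_mult C1_on_iff)
  obtain J where J: "set_integrable lborel (D \<inter> N) (\<lambda>x. jet_square u (x, t))"
    unfolding N_def using jet_square_bound[OF u, of t "R + 1"] t by blast
  have sq: "set_integrable lborel D (\<lambda>x. (f x)\<^sup>2)"
    if f: "continuous_on D f" "\<And>x. x \<in> D \<Longrightarrow> x \<notin> cball 0 R \<Longrightarrow> f x = 0"
      "\<And>x. x \<in> D \<Longrightarrow> (f x)\<^sup>2 \<le> K * jet_square u (x, t)" for f K
  proof (rule set_integrable_zero_off(1)[of D N])
    show "set_integrable lborel (D \<inter> N) (\<lambda>x. (f x)\<^sup>2)"
      by (rule set_integrable_dominated[where g="\<lambda>x. K * jet_square u (x, t)"])
        (use D N f J in \<open>auto intro!: set_integrable_mult_right continuous_intros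
           intro: continuous_on_subset\<close>)
    show "(f x)\<^sup>2 = 0" if "x \<in> D - N" for x
    proof -
      have "x \<notin> cball 0 R" using that N(2) by blast
      then show ?thesis using f(2)[of x] that by simp
    qed
  qed
  have bd: "(a * b)\<^sup>2 \<le> M\<^sup>2 * K" if "\<bar>a\<bar> \<le> M" "b\<^sup>2 \<le> K" for a b M K :: real
  proof -
    have "a\<^sup>2 \<le> M\<^sup>2" using that(1) by (rule abs_le_square_iff[THEN iffD1, OF order_trans[OF _ abs_ge_self]])
    then show ?thesis unfolding power_mult_distrib using that(2) by (intro mult_mono) auto
  qed
  have "set_integrable lborel D (\<lambda>x. (\<zeta> x * dt u (x, t))\<^sup>2)"
  proof (rule sq[of _ "M0\<^sup>2"])
    show "continuous_on D (\<lambda>x. \<zeta> x * dt u (x, t))" by (rule C1_on_continuous[OF C])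
    show "(\<zeta> x * dt u (x, t))\<^sup>2 \<le> M0\<^sup>2 * jet_square u (x, t)" for x
    proof (cases "x \<in> cball 0 R")
      case True
      then show ?thesis using M(1) jet_square_ge(1) by (intro bd) auto
    next
      case False
      then show ?thesis using \<zeta>(2) jet_square_ge(5)[of u "(x, t)"] by simp
    qed
  qed (use \<zeta>(2) in auto)
  moreover have "set_integrable lborel D (\<lambda>x. (partial (axis i 1) (\<lambda>x. \<zeta> x * dt u (x, t)) x)\<^sup>2)" for i
  proof (rule sq[of _ "2 * M0\<^sup>2 + 2 * (M' i)\<^sup>2"])
    show "continuous_on D (partial (axis i 1) (\<lambda>x. \<zeta> x * dt u (x, t)))"
      using C space_basis(2) by (simp add: C1_on_iff)
    show "partial (axis i 1) (\<lambda>x. \<zeta> x * dt u (x, t)) x = 0" if "x \<in> D" "x \<notin> cball 0 R" for x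
      using that \<zeta>(2) \<zeta>0 by (simp add: part)
    show "(partial (axis i 1) (\<lambda>x. \<zeta> x * dt u (x, t)) x)\<^sup>2
        \<le> (2 * M0\<^sup>2 + 2 * (M' i)\<^sup>2) * jet_square u (x, t)" if x: "x \<in> D" for x
    proof (cases "x \<in> cball 0 R")
      case True
      have s: "(a + b)\<^sup>2 \<le> 2 * a\<^sup>2 + 2 * b\<^sup>2" for a b :: real
        using zero_le_power2[of "a - b"] by (simp add: power2_sum power2_diff)
      have "(\<zeta> x * dx i (dt u) (x, t))\<^sup>2 \<le> M0\<^sup>2 * jet_square u (x, t)"
        "(partial (axis i 1) \<zeta> x * dt u (x, t))\<^sup>2 \<le> (M' i)\<^sup>2 * jet_square u (x, t)"
        using True M jet_square_ge by (intro bd; auto)+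
      then show ?thesis
        unfolding part[OF x] distrib_right
        using s[of "\<zeta> x * dx i (dt u) (x, t)" "partial (axis i 1) \<zeta> x * dt u (x, t)"] by linarith
    next
      case False
      then show ?thesis using part[OF x] \<zeta>(2) \<zeta>0 jet_square_ge(5)[of u "(x, t)"] by simp
    qed
  qed
  moreover have "\<forall>x\<in>D - cball 0 R. \<zeta> x * dt u (x, t) = 0" using \<zeta>(2) by simp
  ultimately show ?thesis using C unfolding admissible_def by blast
qed

lemma cone_cutoff_support:
  assumes "0 \<le> C" "0 \<le> t" "C * t \<le> r" "x \<notin> cball 0 (norm z + r)"
  shows "cone_cutoff z r C (x, t) = 0" "cone_slope z r C (x, t) = 0"
proof -
  have "norm x \<le> norm z + norm (x - z)" using norm_triangle_ineq[of z "x - z"] by simp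
  moreover have "0 \<le> C * t" using assms by simp
  ultimately have "r - C * t \<le> norm (x - z)" using assms(4) by simp
  then show "cone_cutoff z r C (x, t) = 0" "cone_slope z r C (x, t) = 0"
    using cone_cutoff_zero[OF assms(1-3)] by auto
qed

lemma local_power_integrable:
  assumes D: "open D" and u: "wave_solution D c u" and c: "0 < c" and C: "0 \<le> C" "C * T \<le> r"
  obtains K where
    "\<And>t. 0 < t \<Longrightarrow> t \<le> T \<Longrightarrow> set_integrable lborel D (\<lambda>x. local_power z r C c u (x, t))"
    "\<And>t. 0 < t \<Longrightarrow> t \<le> T \<Longrightarrow> (LINT x:D|lborel. \<bar>local_power z r C c u (x, t)\<bar>) \<le> K"
proof (cases "r \<ge> 0")
  case False
  have "\<not> (0 < t \<and> t \<le> T)" for t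
    using False C by (smt (verit) mult_nonneg_nonneg)
  then show ?thesis using that by blast
next
  case True
  let ?lp = "local_power z r C c u"
  define N where "N = ball (0::pt) (norm z + r + 1)"
  obtain B where B: "B \<ge> 0" "\<And>x t. 0 \<le> t \<Longrightarrow> C * t \<le> r \<Longrightarrow> \<bar>?lp (x, t)\<bar> \<le> B * jet_square u (x, t)"
    using local_power_bound[OF C(1) c True, where z=z] by metis
  obtain J where J: "\<And>t. 0 < t \<Longrightarrow> t \<le> T \<Longrightarrow> set_integrable lborel (D \<inter> N) (\<lambda>x. jet_square u (x, t))"
    "\<And>t. 0 < t \<Longrightarrow> t \<le> T \<Longrightarrow> (LINT x:D \<inter> N|lborel. jet_square u (x, t)) \<le> J"
    unfolding N_def using jet_square_bound[OF u, of T "norm z + r + 1"] by metis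
  show ?thesis
  proof (rule that[of "B * J"])
    fix t assume t: "0 < t" "t \<le> T"
    have Ct: "C * t \<le> r" using C t mult_left_mono[of t T C] by simp
    have z: "?lp (x, t) = 0" if "x \<in> D - N" for x
    proof -
      have "x \<notin> cball 0 (norm z + r)" using that by (auto simp: N_def)
      then show ?thesis using cone_cutoff_support[of C t r x z] C t Ct by (simp add: local_power_def)
    qed
    have i: "set_integrable lborel (D \<inter> N) (\<lambda>x. ?lp (x, t))"
    proof (rule set_integrable_dominated[where g="\<lambda>x. B * jet_square u (x, t)"])
      show "continuous_on (D \<inter> N) (\<lambda>x. ?lp (x, t))"
        using t by (intro continuous_on_subset[OF continuous_on_cross(2)[OF local_power_continuous(1)[OF u c]]]) auto
    qed (use D J(1)[OF t] B(2) t Ct in \<open>auto simp: N_def intro!: set_integrable_mult_right\<close>)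
    show ii: "set_integrable lborel D (\<lambda>x. ?lp (x, t))"
      by (rule set_integrable_zero_off(1)[OF i z])
    have "(LINT x:D|lborel. \<bar>?lp (x, t)\<bar>) = (LINT x:D \<inter> N|lborel. \<bar>?lp (x, t)\<bar>)"
      by (rule set_integrable_zero_off(2)[OF set_integrable_abs[OF i]]) (use z in auto)
    also have "\<dots> \<le> (LINT x:D \<inter> N|lborel. B * jet_square u (x, t))"
      using J(1)[OF t] B(2) t Ct
      by (intro set_integral_mono set_integrable_abs[OF i] set_integrable_mult_right) auto
    also have "\<dots> = B * (LINT x:D \<inter> N|lborel. jet_square u (x, t))" by (rule set_integral_mult_right)
    also have "\<dots> \<le> B * J" by (rule mult_left_mono[OF J(2)[OF t] B(1)])
    finally show "(LINT x:D|lborel. \<bar>?lp (x, t)\<bar>) \<le> B * J" .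
  qed
qed

text \<open>The time derivative of the localized energy density is integrated first in time for fixed \<open>x\<close>
  and then in space. The density tends to zero pointwise as \<open>t \<rightarrow> 0\<close>, so there is no initial term, and
  the \<open>L\<^sup>2\<close> bounds of the solution class, uniform down to \<open>t = 0\<close>, justify the exchange of the
  integrals. Differentiating the energy under the integral sign would need a majorant for all times
  at once, which the solution class does not provide.\<close>

lemma energy_balance:
  assumes D: "open D" and u: "wave_solution D c u" and c: "0 < c" "c \<le> C" and t: "0 < t" "C * t \<le> r"
  obtains P where "set_integrable lborel {0<..<t} P"
    "set_integrable lborel D (\<lambda>x. cone_cutoff z r C (x, t) * energy_density c u (x, t))"
    "(LINT x:D|lborel. cone_cutoff z r C (x, t) * energy_density c u (x, t)) = (LINT s:{0<..<t}|lborel. P s)"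
    "\<And>s. s \<in> {0<..<t} \<Longrightarrow> P s \<le> green D u s (\<lambda>x. cone_cutoff z r C (x, s) * dt u (x, s))"
proof -
  have C0: "0 \<le> C" using c by simp
  let ?lp = "local_power z r C c u"
  let ?q = "\<lambda>x s. cone_cutoff z r C (x, s) * energy_density c u (x, s)"
  obtain K where K: "\<And>s. 0 < s \<Longrightarrow> s \<le> t \<Longrightarrow> set_integrable lborel D (\<lambda>x. ?lp (x, s))"
    "\<And>s. 0 < s \<Longrightarrow> s \<le> t \<Longrightarrow> (LINT x:D|lborel. \<bar>?lp (x, s)\<bar>) \<le> K"
    using local_power_integrable[OF D u c(1) C0 t(2), where z=z] by metis
  define P where "P s = (LINT x:D|lborel. ?lp (x, s))" for s
  define G where "G s x = indicator {0<..<t} s * (indicator D x * ?lp (x, s))" for s x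
  have oD: "open (D \<times> {0<..<t})" using D by (intro open_Times) auto
  have "(\<lambda>p. indicator (D \<times> {0<..<t}) p *\<^sub>R ?lp p) \<in> borel_measurable borel"
    using oD by (intro borel_measurable_continuous_on_indicator
       continuous_on_subset[OF local_power_continuous(1)[OF u c(1)]]) auto
  then have "(\<lambda>p. indicator (D \<times> {0<..<t}) p *\<^sub>R ?lp p) \<in> borel_measurable (lborel \<Otimes>\<^sub>M lborel)"
    by (simp add: lborel_prod)
  then have "(\<lambda>(s, x). indicator (D \<times> {0<..<t}) (x, s) *\<^sub>R ?lp (x, s)) \<in> borel_measurable (lborel \<Otimes>\<^sub>M lborel)"
    by (rule measurable_pair_swap)
  moreover have "(\<lambda>(s, x). indicator (D \<times> {0<..<t}) (x, s) *\<^sub>R ?lp (x, s)) = case_prod G"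
    by (auto simp: fun_eq_iff G_def indicator_def)
  ultimately have Gm[measurable]: "case_prod G \<in> borel_measurable (lborel \<Otimes>\<^sub>M lborel)" by simp
  have Gx: "integrable lborel (G s)" "(LINT x|lborel. norm (G s x)) = indicator {0<..<t} s * (LINT x:D|lborel. \<bar>?lp (x, s)\<bar>)"
     "(LINT x|lborel. G s x) = indicator {0<..<t} s * P s" for s
  proof -
    show "integrable lborel (G s)"
    proof (cases "s \<in> {0<..<t}")
      case True
      then show ?thesis using K(1)[of s] unfolding G_def[abs_def] set_integrable_def by simp
    qed (simp add: G_def[abs_def])
    show "(LINT x|lborel. norm (G s x)) = indicator {0<..<t} s * (LINT x:D|lborel. \<bar>?lp (x, s)\<bar>)"
      "(LINT x|lborel. G s x) = indicator {0<..<t} s * P s"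
      by (auto simp: G_def P_def set_lebesgue_integral_def abs_mult indicator_def[of "{0<..<t}"])
  qed
  have "integrable lborel (\<lambda>s. LINT x|lborel. norm (G s x))"
  proof (rule Bochner_Integration.integrable_bound)
    show "integrable lborel (\<lambda>s. indicator {0<..<t} s * K)"
      using t by (intro integrable_mult_left) simp
    show "(\<lambda>s. LINT x|lborel. norm (G s x)) \<in> borel_measurable lborel" by measurable
    show "AE s in lborel. norm (LINT x|lborel. norm (G s x)) \<le> norm (indicator {0<..<t} s * K)"
    proof (intro AE_I2)
      fix s
      have "0 \<le> (LINT x:D|lborel. \<bar>?lp (x, s)\<bar>)"
        unfolding set_lebesgue_integral_def by (intro Bochner_Integration.integral_nonneg) auto
      then show "norm (LINT x|lborel. norm (G s x)) \<le> norm (indicator {0<..<t} s * K)"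
        unfolding Gx(2) using K(2)[of s] by (auto simp: indicator_def)
    qed
  qed
  then have GI: "integrable (lborel \<Otimes>\<^sub>M lborel) (case_prod G)"
    by (intro lborel_pair.Fubini_integrable Gm) (use Gx(1) in auto)
  have swap: "(LINT x|lborel. LINT s|lborel. G s x) = (LINT s|lborel. LINT x|lborel. G s x)"
    by (rule lborel_pair.Fubini_integral[OF GI])
  have ftc: "(LINT s|lborel. G s x) = indicator D x * ?q x t" if int: "integrable lborel (\<lambda>s. G s x)" for x
  proof (cases "x \<in> D")
    case False
    then show ?thesis by (simp add: G_def)
  next
    case x: True
    have G': "(\<lambda>s. G s x) = (\<lambda>s. indicator {0<..<t} s *\<^sub>R ?lp (x, s))" using x by (simp add: G_def)
    have der: "(?q x has_real_derivative ?lp (x, s)) (at s)" if "s > 0" for s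
      by (rule local_energy_time_deriv[OF D u x that])
    have e0: "((\<lambda>s. energy_density c u (x, s)) \<longlongrightarrow> (0\<^sup>2 / c\<^sup>2 + (\<Sum>i\<in>(UNIV::2 set). 0\<^sup>2)) / 2) (at_right 0)"
      unfolding energy_density_def using c(1)
      by (intro tendsto_intros initial_velocity_limit[OF u x] initial_gradient_limit[OF D u x]) auto
    have "((\<lambda>s. cone_cutoff z r C (x, s)) \<longlongrightarrow> cone_cutoff z r C (x, 0)) (at_right 0)"
      using DERIV_isCont[OF cone_cutoff_time_deriv] unfolding isCont_def
      by (rule filterlim_mono[OF _ order_refl at_le]) simp
    from tendsto_mult[OF this e0] have q0: "(?q x \<longlongrightarrow> 0) (at_right 0)" by simp
    have qt: "(?q x \<longlongrightarrow> ?q x t) (at_left t)"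
      using DERIV_isCont[OF der[OF t(1)]] unfolding isCont_def
      by (rule filterlim_mono[OF _ order_refl at_le]) simp
    have "(LBINT s=ereal 0..ereal t. ?lp (x, s)) = ?q x t - 0"
    proof (rule interval_integral_FTC_integrable)
      show "ereal 0 < ereal t" using t by simp
      show "(?q x has_vector_derivative ?lp (x, s)) (at s)" if "ereal 0 < ereal s" for s
        using der[of s] that by (simp add: has_real_derivative_iff_has_vector_derivative)
      show "isCont (\<lambda>s. ?lp (x, s)) s" if "ereal 0 < ereal s" for s
        using continuous_on_cross(1)[OF local_power_continuous(1)[OF u c(1)] x] that
        by (simp add: continuous_on_eq_continuous_at)
      show "set_integrable lborel (einterval (ereal 0) (ereal t)) (\<lambda>s. ?lp (x, s))"
        using int unfolding G' set_integrable_def by simp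
      show "((?q x \<circ> real_of_ereal) \<longlongrightarrow> 0) (at_right (ereal 0))"
        unfolding ereal_tendsto_simps1 by (rule q0)
      show "((?q x \<circ> real_of_ereal) \<longlongrightarrow> ?q x t) (at_left (ereal t))"
        unfolding ereal_tendsto_simps1 by (rule qt)
    qed
    then show ?thesis
      unfolding G' using t x by (simp add: interval_integral_Ioo set_lebesgue_integral_def)
  qed
  have AEG: "AE x in lborel. integrable lborel (\<lambda>s. G s x)"
    using lborel_pair.AE_integrable_fst'[OF lborel_pair.integrable_product_swap[OF GI]] by simp
  then have AEq: "AE x in lborel. (LINT s|lborel. G s x) = indicator D x *\<^sub>R ?q x t"
    by (rule eventually_mono) (simp add: ftc)
  have "integrable lborel (\<lambda>x. LINT s|lborel. G s x)"
    using lborel_pair.integrable_fst'[OF lborel_pair.integrable_product_swap[OF GI]] by simp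
  moreover have qm: "(\<lambda>x. indicator D x *\<^sub>R ?q x t) \<in> borel_measurable lborel"
  proof -
    have "continuous_on D (\<lambda>x. ?q x t)"
      using t by (intro continuous_on_mult continuous_on_cross(2)[OF local_power_continuous(2)[OF u c(1)]]
        C1_on_continuous[OF cone_cutoff_C1]) auto
    then show ?thesis using borel_measurable_continuous_on_indicator[of D "\<lambda>x. ?q x t"] D by simp
  qed
  ultimately have qI: "integrable lborel (\<lambda>x. indicator D x *\<^sub>R ?q x t)"
    by (rule integrable_cong_AE_imp[OF _ _ AEq])
  have "(LINT x:D|lborel. ?q x t) = (LINT x|lborel. LINT s|lborel. G s x)"
    unfolding set_lebesgue_integral_def
    by (rule integral_cong_AE[symmetric]) (use AEq qm in auto)
  also have "\<dots> = (LINT s:{0<..<t}|lborel. P s)"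
    unfolding swap Gx(3) set_lebesgue_integral_def by simp
  finally have E: "(LINT x:D|lborel. ?q x t) = (LINT s:{0<..<t}|lborel. P s)" .
  have "integrable lborel (\<lambda>s. LINT x|lborel. G s x)"
    using lborel_pair.integrable_fst'[OF GI] by simp
  then have PI: "set_integrable lborel {0<..<t} P"
    unfolding Gx(3) set_integrable_def by simp
  show thesis
  proof (rule that[OF PI _ E])
    show "set_integrable lborel D (\<lambda>x. ?q x t)" using qI by (simp add: set_integrable_def)
    fix s assume s: "s \<in> {0<..<t}"
    then have Cs: "C * s \<le> r" using C0 t(2) mult_left_mono[of s t C] by simp
    have adm: "admissible D (\<lambda>x. cone_cutoff z r C (x, s) * dt u (x, s))"
      using s cone_cutoff_support(1)[OF C0 _ Cs]
      by (intro admissible_cutoff_velocity[OF D u] cone_cutoff_C1) auto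
    show "P s \<le> green D u s (\<lambda>x. cone_cutoff z r C (x, s) * dt u (x, s))"
      unfolding P_def green_def
      using s K(1)[of s] green_integrable[OF D u c(1) _ adm]
        local_power_le_green_density[OF u _ _ c Cs]
      by (intro set_integral_mono) auto
  qed
qed

lemma continuous_nonneg_set_integral_zero:
  fixes f :: "'a::euclidean_space \<Rightarrow> real"
  assumes D: "open D" and f: "continuous_on D f" "\<And>x. x \<in> D \<Longrightarrow> 0 \<le> f x"
    and int: "set_integrable lborel D f" "(LINT x:D|lborel. f x) \<le> 0" and x: "x \<in> D"
  shows "f x = 0"
proof (rule ccontr)
  assume ne: "f x \<noteq> 0"
  have "0 \<le> (LINT x:D|lborel. f x)"
    unfolding set_lebesgue_integral_def using f(2)
    by (intro Bochner_Integration.integral_nonneg) (auto simp: indicator_def)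
  with int(2) have "(LINT x|lborel. indicator D x *\<^sub>R f x) = 0"
    by (simp add: set_lebesgue_integral_def)
  then have "AE x in lborel. indicator D x *\<^sub>R f x = 0"
    using f(2) int(1) unfolding set_integrable_def
    by (subst (asm) integral_nonneg_eq_0_iff_AE) (auto simp: indicator_def)
  then have "AE x in lborel. x \<notin> {x \<in> D. f x \<noteq> 0}"
    by (rule eventually_mono) (auto simp: indicator_def)
  moreover have op: "open {x \<in> D. f x \<noteq> 0}"
  proof -
    have "open (D \<inter> f -` (- {0}))" by (rule continuous_open_preimage[OF f(1) D]) auto
    moreover have "D \<inter> f -` (- {0}) = {x \<in> D. f x \<noteq> 0}" by auto
    ultimately show ?thesis by simp
  qed
  ultimately have "{x \<in> D. f x \<noteq> 0} \<in> null_sets lborel"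
    by (simp add: AE_iff_null_sets)
  then have "negligible {x \<in> D. f x \<noteq> 0}"
    by (simp add: negligible_iff_null_sets null_sets_completionI)
  then show False using open_not_negligible[OF op] ne x by blast
qed

text \<open>The weighted sum of the localized energies of several domains cannot increase if their boundary
  fluxes, tested with \<open>\<eta> \<partial>\<^sub>tu\<close>, add up to at most zero; so it stays zero and the velocities vanish in
  the cone. The transmission conditions enter only through the fluxes, with the weights \<open>1 / \<rho> k\<close>. The
  same statement covers the transmission problems and, with a single domain and a cone in its
  interior, the domain of dependence.\<close>

lemma energy_uniqueness:
  assumes fin: "finite K"
    and w: "\<And>k. k \<in> K \<Longrightarrow> open (D k) \<and> wave_solution (D k) (c k) (w k) \<and> 0 < c k \<and> c k \<le> C \<and> 0 < b k"
    and r: "C * T < r" and C: "0 \<le> C"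
    and flux: "\<And>s. 0 < s \<Longrightarrow> s < T \<Longrightarrow>
      (\<Sum>k\<in>K. b k * green (D k) (w k) s (\<lambda>x. cone_cutoff z r C (x, s) * dt (w k) (x, s))) \<le> 0"
    and k: "k \<in> K" and x: "x \<in> D k" "norm (x - z) < r - C * T" and t: "0 \<le> t" "t \<le> T"
  shows "w k (x, t) = 0"
proof -
  have dt0: "dt (w k) (x, s) = 0" if s: "0 < s" "s \<le> T" for s
  proof -
    let ?q = "\<lambda>k x. cone_cutoff z r C (x, s) * energy_density (c k) (w k) (x, s)"
    have Cs: "C * s \<le> C * T" using s C by (intro mult_left_mono) auto
    have Csr: "C * s \<le> r" using Cs r by simp
    let ?green = "\<lambda>k s. green (D k) (w k) s (\<lambda>x. cone_cutoff z r C (x, s) * dt (w k) (x, s))"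
    let ?balance = "\<lambda>k P. set_integrable lborel {0<..<s} P \<and> set_integrable lborel (D k) (?q k) \<and>
      (LINT x:D k|lborel. ?q k x) = (LINT s:{0<..<s}|lborel. P s) \<and> (\<forall>s\<in>{0<..<s}. P s \<le> ?green k s)"
    have "\<forall>k\<in>K. \<exists>P. ?balance k P"
    proof
      fix k assume k: "k \<in> K"
      obtain P where "set_integrable lborel {0<..<s} P" "set_integrable lborel (D k) (?q k)"
        "(LINT x:D k|lborel. ?q k x) = (LINT s:{0<..<s}|lborel. P s)"
        "\<And>s'. s' \<in> {0<..<s} \<Longrightarrow> P s' \<le> ?green k s'"
      proof (rule energy_balance)
        show "open (D k)" "wave_solution (D k) (c k) (w k)" "0 < c k" "c k \<le> C" "0 < s" "C * s \<le> r"
          using w[OF k] s(1) Csr by auto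
      qed (rule that)
      then show "\<exists>P. ?balance k P" by blast
    qed
    from bchoice[OF this] obtain P where P: "\<And>k. k \<in> K \<Longrightarrow> set_integrable lborel {0<..<s} (P k)"
      "\<And>k. k \<in> K \<Longrightarrow> set_integrable lborel (D k) (?q k)"
      "\<And>k. k \<in> K \<Longrightarrow> (LINT x:D k|lborel. ?q k x) = (LINT s:{0<..<s}|lborel. P k s)"
      "\<And>k s'. k \<in> K \<Longrightarrow> s' \<in> {0<..<s} \<Longrightarrow> P k s' \<le> ?green k s'"
      by blast
    define E where "E k = (LINT x:D k|lborel. ?q k x)" for k
    have q0: "0 \<le> ?q k x" for k x using cone_cutoff_nonneg energy_density_nonneg by simp
    have E0: "0 \<le> E k" for k
      unfolding E_def set_lebesgue_integral_def using q0
      by (intro Bochner_Integration.integral_nonneg) (auto simp: indicator_def)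
    have "(\<Sum>k\<in>K. b k * E k) = (\<Sum>k\<in>K. LINT s:{0<..<s}|lborel. b k * P k s)"
      by (simp add: E_def P(3) set_integral_mult_right cong: sum.cong)
    also have "\<dots> = (LINT s:{0<..<s}|lborel. \<Sum>k\<in>K. b k * P k s)"
      using P(1) unfolding set_lebesgue_integral_def set_integrable_def scaleR_sum_right
      by (intro Bochner_Integration.integral_sum[symmetric]) (simp add: mult.left_commute)
    also have "\<dots> \<le> 0"
    proof -
      have "(\<Sum>k\<in>K. b k * P k s') \<le> 0" if s': "s' \<in> {0<..<s}" for s'
      proof -
        have "(\<Sum>k\<in>K. b k * P k s') \<le> (\<Sum>k\<in>K. b k * ?green k s')"
          using w P(4) s' by (intro sum_mono mult_left_mono) (auto intro: less_imp_le)
        also have "\<dots> \<le> 0" using s' s by (intro flux) auto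
        finally show ?thesis .
      qed
      then show ?thesis
        unfolding set_lebesgue_integral_def
        using Bochner_Integration.integral_nonneg[where M=lborel
            and f="\<lambda>s'. - (indicator {0<..<s} s' *\<^sub>R (\<Sum>k\<in>K. b k * P k s'))"]
        by (simp add: indicator_def)
    qed
    finally have "(\<Sum>k\<in>K. b k * E k) \<le> 0" .
    moreover have "b k * E k \<le> (\<Sum>k\<in>K. b k * E k)"
      using fin k w E0 by (intro member_le_sum mult_nonneg_nonneg) (auto intro: less_imp_le)
    ultimately have "E k \<le> 0" using w[OF k] by (smt (verit) mult_pos_pos)
    moreover have "continuous_on (D k) (?q k)"
      using s w[OF k] by (intro continuous_on_mult continuous_on_cross(2)[OF local_power_continuous(2)]
        C1_on_continuous[OF cone_cutoff_C1]) auto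
    ultimately have "?q k x = 0"
      using w[OF k] P(2)[OF k] q0 x(1) unfolding E_def
      by (intro continuous_nonneg_set_integral_zero[of "D k" "?q k"]) auto
    moreover have "0 < cone_cutoff z r C (x, s)" using x(2) Cs by (intro cone_cutoff_pos) simp
    ultimately have "energy_density (c k) (w k) (x, s) = 0" by simp
    moreover have "0 \<le> (\<Sum>i\<in>UNIV. (dx i (w k) (x, s))\<^sup>2)" by (intro sum_nonneg) simp
    moreover have "0 \<le> (dt (w k) (x, s))\<^sup>2 / (c k)\<^sup>2" by simp
    moreover have "a = 0" if "(a + b) / 2 = 0" "0 \<le> b" "0 \<le> a" for a b :: real
      using that by simp
    ultimately have "(dt (w k) (x, s))\<^sup>2 / (c k)\<^sup>2 = 0" unfolding energy_density_def by blast
    then show ?thesis using w[OF k] by simp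
  qed
  have W: "wave_solution (D k) (c k) (w k)" using w[OF k] by simp
  have "x \<in> closure (D k)" using x(1) closure_subset by blast
  from continuous_on_cross(1)[OF wave_solutionD(2)[OF W] this]
  have cont: "continuous_on {0..t} (\<lambda>s. w k (x, s))" by (rule continuous_on_subset) auto
  have "w k (x, t) = w k (x, 0)"
  proof (cases "t = 0")
    case False
    show ?thesis
    proof (rule DERIV_isconst2[of 0 t "\<lambda>s. w k (x, s)" t, OF _ cont])
      show "((\<lambda>s. w k (x, s)) has_real_derivative 0) (at s)" if "0 < s" "s < t" for s
        using time_slice[OF wave_solution_diff(1)[OF W x(1) that(1)]] dt0[of s] that t by simp
    qed (use False t in auto)
  qed simp
  then show ?thesis using wave_solutionD(6)[OF W x(1)] by simp
qed

section \<open>Geometry of the layers\<close>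

lemma half_plane_component:
  assumes "convex H" "H \<noteq> {}" "H \<subseteq> (S :: pt set)"
  obtains C where "C \<in> components S" "H \<subseteq> C"
proof -
  have "connected H" using assms(1) by (rule convex_connected)
  then show thesis
    using that exists_component_superset[OF assms(3)] assms(2,3) by blast
qed

lemma upper_half_plane_convex: "convex {y::pt. y $ 2 > a}" "{y::pt. y $ 2 > a} \<noteq> {}"
  and lower_half_plane_convex: "convex {y::pt. y $ 2 < a}" "{y::pt. y $ 2 < a} \<noteq> {}"
proof -
  have eq: "{y::pt. y $ 2 > a} = {y. axis 2 1 \<bullet> y > a}" "{y::pt. y $ 2 < a} = {y. axis 2 1 \<bullet> y < a}"
    by (simp_all add: inner_commute inner_axis)
  show "convex {y::pt. y $ 2 > a}" "convex {y::pt. y $ 2 < a}"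
    unfolding eq by (rule convex_halfspace_gt convex_halfspace_lt)+
  have "(vec (a + 1) :: pt) \<in> {y::pt. y $ 2 > a}" "(vec (a - 1) :: pt) \<in> {y::pt. y $ 2 < a}" by auto
  then show "{y::pt. y $ 2 > a} \<noteq> {}" "{y::pt. y $ 2 < a} \<noteq> {}" by blast+
qed

lemma above_eq_component:
  assumes C: "C \<in> components (- \<Gamma>)" "{y. y $ 2 > a} \<subseteq> C"
  shows "above \<Gamma> = C"
proof -
  have "C' = C" if "C' \<in> components (- \<Gamma>)" "{y. y $ 2 > a'} \<subseteq> C'" for C' a'
  proof -
    have "{y::pt. y $ 2 > max a a'} \<subseteq> C \<inter> C'" using C(2) that(2) by auto
    then have "C \<inter> C' \<noteq> {}" using upper_half_plane_convex(2)[of "max a a'"] by blast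
    then show ?thesis using components_nonoverlap[OF C(1) that(1)] by simp
  qed
  then show ?thesis using C unfolding above_def by blast
qed

lemma below_eq_component:
  assumes C: "C \<in> components (- \<Gamma>)" "{y. y $ 2 < a} \<subseteq> C"
  shows "below \<Gamma> = C"
proof -
  have "C' = C" if "C' \<in> components (- \<Gamma>)" "{y. y $ 2 < a'} \<subseteq> C'" for C' a'
  proof -
    have "{y::pt. y $ 2 < min a a'} \<subseteq> C \<inter> C'" using C(2) that(2) by auto
    then have "C \<inter> C' \<noteq> {}" using lower_half_plane_convex(2)[of "min a a'"] by blast
    then show ?thesis using components_nonoverlap[OF C(1) that(1)] by simp
  qed
  then show ?thesis using C unfolding below_def by blast
qed

text \<open>Outside a large ball the interface is a horizontal line, so both half-planes beyond it belong
  to the complement.\<close>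

lemma interface_components:
  assumes "lipschitz_interface \<Gamma>"
  shows "above \<Gamma> \<in> components (- \<Gamma>)" "\<exists>a. {y. y $ 2 > a} \<subseteq> above \<Gamma>"
    "below \<Gamma> \<in> components (- \<Gamma>)" "\<Gamma> \<noteq> {}"
proof -
  obtain a R where aR: "\<And>x. norm x > R \<Longrightarrow> x \<in> \<Gamma> \<longleftrightarrow> x $ 2 = a"
    using assms unfolding lipschitz_interface_def by blast
  have n: "\<bar>x $ 2\<bar> \<le> norm x" for x :: pt by (rule component_le_norm_cart)
  have "{y::pt. y $ 2 > max \<bar>a\<bar> R} \<subseteq> - \<Gamma>"
  proof
    fix y :: pt assume y: "y \<in> {y. y $ 2 > max \<bar>a\<bar> R}"
    then have "norm y > R" using n[of y] by auto
    then show "y \<in> - \<Gamma>" using aR y by auto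
  qed
  then obtain C where C: "C \<in> components (- \<Gamma>)" "{y::pt. y $ 2 > max \<bar>a\<bar> R} \<subseteq> C"
    by (rule half_plane_component[OF upper_half_plane_convex])
  show "above \<Gamma> \<in> components (- \<Gamma>)" "\<exists>a. {y. y $ 2 > a} \<subseteq> above \<Gamma>"
    unfolding above_eq_component[OF C] using C by blast+
  have "{y::pt. y $ 2 < - max \<bar>a\<bar> R} \<subseteq> - \<Gamma>"
  proof
    fix y :: pt assume y: "y \<in> {y. y $ 2 < - max \<bar>a\<bar> R}"
    then have "norm y > R" using n[of y] by auto
    then show "y \<in> - \<Gamma>" using aR y by auto
  qed
  then obtain C where C: "C \<in> components (- \<Gamma>)" "{y::pt. y $ 2 < - max \<bar>a\<bar> R} \<subseteq> C"
    by (rule half_plane_component[OF lower_half_plane_convex])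
  show "below \<Gamma> \<in> components (- \<Gamma>)" unfolding below_eq_component[OF C] by (rule C)
  define p :: pt where "p = (\<chi> i. if i = 1 then \<bar>R\<bar> + 1 else a)"
  have "\<bar>p $ 1\<bar> \<le> norm p" by (rule component_le_norm_cart)
  then have "norm p > R" by (simp add: p_def)
  moreover have "p $ 2 = a" by (simp add: p_def)
  ultimately show "\<Gamma> \<noteq> {}" using aR by blast
qed

text \<open>In the local graph coordinates a point of the interface can be moved slightly up or down, so
  it is a limit of points that lie on one side only.\<close>

lemma interface_sides_near:
  assumes "lipschitz_interface \<Gamma>" "x \<in> \<Gamma>" "open W" "x \<in> W"
  shows "\<exists>y\<in>W. y \<in> above \<Gamma> \<and> y \<notin> below \<Gamma>" "\<exists>y\<in>W. y \<in> below \<Gamma> \<and> y \<notin> above \<Gamma>"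
proof -
  obtain V Q h L where V: "open V" "x \<in> V" and Q: "orthogonal_transformation (Q :: pt \<Rightarrow> pt)"
    and side: "\<And>y. y \<in> V \<Longrightarrow> (y \<in> above \<Gamma> \<longleftrightarrow> Q y $ 2 > (h::real\<Rightarrow>real) (Q y $ 1)) \<and>
       (y \<in> below \<Gamma> \<longleftrightarrow> Q y $ 2 < h (Q y $ 1))"
    using assms(1,2) unfolding lipschitz_interface_def by metis
  have "- \<Gamma> = above \<Gamma> \<union> below \<Gamma>" using assms(1) unfolding lipschitz_interface_def by blast
  then have "x \<notin> above \<Gamma>" "x \<notin> below \<Gamma>" using assms(2) by auto
  then have Qx: "Q x $ 2 = h (Q x $ 1)" using side[OF V(2)] by auto
  obtain q where q: "Q q = axis 2 1"
    using orthogonal_transformation_surj[OF Q] by (metis surjD)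
  have Qe: "Q (x + e *\<^sub>R q) = Q x + e *\<^sub>R axis 2 1" for e
    using orthogonal_transformation_linear[OF Q] q by (simp add: linear_add linear_cmul)
  have cont: "((\<lambda>e. x + e *\<^sub>R q) \<longlongrightarrow> x + 0 *\<^sub>R q) (at 0)"
    by (intro tendsto_intros)
  have "open (V \<inter> W)" "x + 0 *\<^sub>R q \<in> V \<inter> W" using V assms(3,4) by auto
  from topological_tendstoD[OF cont this]
  obtain d where d: "d > 0" "\<And>e. e \<noteq> 0 \<Longrightarrow> dist e 0 < d \<Longrightarrow> x + e *\<^sub>R q \<in> V \<inter> W"
    unfolding eventually_at by blast
  have "x + (d / 2) *\<^sub>R q \<in> V \<inter> W" "x + (- d / 2) *\<^sub>R q \<in> V \<inter> W"
    by (rule d(2); use d(1) in simp)+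
  moreover have "(axis 2 1 :: pt) $ 1 = 0" "(axis 2 1 :: pt) $ 2 = 1" by (simp_all add: axis_def)
  ultimately have "x + (d / 2) *\<^sub>R q \<in> W \<and> x + (d / 2) *\<^sub>R q \<in> above \<Gamma> \<and> x + (d / 2) *\<^sub>R q \<notin> below \<Gamma>"
    "x + (- d / 2) *\<^sub>R q \<in> W \<and> x + (- d / 2) *\<^sub>R q \<in> below \<Gamma> \<and> x + (- d / 2) *\<^sub>R q \<notin> above \<Gamma>"
    using side[of "x + (d / 2) *\<^sub>R q"] side[of "x + (- d / 2) *\<^sub>R q"] Qx d(1)
    unfolding Qe by auto
  then show "\<exists>y\<in>W. y \<in> above \<Gamma> \<and> y \<notin> below \<Gamma>" "\<exists>y\<in>W. y \<in> below \<Gamma> \<and> y \<notin> above \<Gamma>" by blast+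
qed

lemma interface_facts:
  assumes G: "lipschitz_interface \<Gamma>"
  shows "open (above \<Gamma>)" "open (below \<Gamma>)" "above \<Gamma> \<inter> below \<Gamma> = {}"
    "- \<Gamma> = above \<Gamma> \<union> below \<Gamma>" "closed \<Gamma>" "\<Gamma> \<subseteq> closure (above \<Gamma>)" "\<Gamma> \<subseteq> closure (below \<Gamma>)"
proof -
  note comp = interface_components[OF G]
  show cl: "closed \<Gamma>" and "- \<Gamma> = above \<Gamma> \<union> below \<Gamma>"
    using G unfolding lipschitz_interface_def by blast+
  then show "open (above \<Gamma>)" "open (below \<Gamma>)"
    using comp open_components by (metis open_Compl)+
  obtain x where "x \<in> \<Gamma>" using comp(4) by blast
  then have "above \<Gamma> \<noteq> below \<Gamma>"
    using interface_sides_near(1)[OF G, of x UNIV] by auto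
  then show "above \<Gamma> \<inter> below \<Gamma> = {}"
    using components_nonoverlap[OF comp(1,3)] by blast
  show "\<Gamma> \<subseteq> closure (above \<Gamma>)" "\<Gamma> \<subseteq> closure (below \<Gamma>)"
    using interface_sides_near[OF G] by (force simp: closure_iff_nhds_not_empty)+
qed

lemma ball_in_side:
  assumes "open A" "open B" "A \<inter> B = {}" "- \<Gamma> = A \<union> B" "x \<in> A" "ball x r \<inter> \<Gamma> = {}" "(r::real) > 0"
  shows "ball (x::pt) r \<subseteq> A"
proof -
  have "connected (ball x r)" by simp
  then have "A \<inter> ball x r = {} \<or> B \<inter> ball x r = {}"
    by (rule connectedD[OF _ assms(1,2)]) (use assms in auto)
  then show ?thesis using assms by auto
qed

locale layers =
  fixes \<Gamma> :: "nat \<Rightarrow> pt set"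
  assumes geometry: "layered_geometry \<Gamma>"
begin

lemma interface: "j \<in> {1, 2} \<Longrightarrow> lipschitz_interface (\<Gamma> j)"
  using geometry unfolding layered_geometry_def by auto

lemmas sides = interface_facts[OF interface]

text \<open>\<open>above (\<Gamma> 1) \<union> \<Gamma> 1\<close> is connected, since it lies between a connected set and its closure. It avoids
  \<open>\<Gamma> 2\<close> and contains an upper half-plane, so it lies in the component above \<open>\<Gamma> 2\<close>.\<close>

lemma nested:
  shows "above (\<Gamma> 1) \<union> \<Gamma> 1 \<subseteq> above (\<Gamma> 2)" "below (\<Gamma> 2) \<union> \<Gamma> 2 \<subseteq> below (\<Gamma> 1)"
proof -
  let ?S = "above (\<Gamma> 1) \<union> \<Gamma> 1"
  have j: "1 \<in> {1, 2::nat}" "2 \<in> {1, 2::nat}" by auto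
  have sub: "\<Gamma> 2 \<subseteq> below (\<Gamma> 1)" using geometry unfolding layered_geometry_def by blast
  have "connected (above (\<Gamma> 1))"
    using interface_components(1)[OF interface[OF j(1)]] by (rule in_components_connected)
  then have con: "connected ?S"
    by (rule connected_intermediate_closure) (use sides(6)[OF j(1)] closure_subset in auto)
  have "?S \<subseteq> - \<Gamma> 2" using sub sides(3,4)[OF j(1)] by blast
  moreover obtain a where a: "{y. y $ 2 > a} \<subseteq> above (\<Gamma> 1)"
    using interface_components(2)[OF interface[OF j(1)]] by blast
  moreover have "?S \<noteq> {}" using a upper_half_plane_convex(2)[of a] by blast
  ultimately obtain C where C: "C \<in> components (- \<Gamma> 2)" "?S \<subseteq> C"
    using exists_component_superset[OF _ _ con, of "- \<Gamma> 2"] by blast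
  then have "above (\<Gamma> 2) = C" using a by (intro above_eq_component[of C "\<Gamma> 2" a]) auto
  then show *: "?S \<subseteq> above (\<Gamma> 2)" using C by simp
  show "below (\<Gamma> 2) \<union> \<Gamma> 2 \<subseteq> below (\<Gamma> 1)"
    using * sides(3,4)[OF j(1)] sides(3,4)[OF j(2)] by blast
qed

lemma layer_simps:
  "layer \<Gamma> (Suc 0) = above (\<Gamma> 1)" "layer \<Gamma> 1 = above (\<Gamma> 1)" "layer \<Gamma> 2 = below (\<Gamma> 1) \<inter> above (\<Gamma> 2)"
  "layer \<Gamma> 3 = below (\<Gamma> 2)"
  by (auto simp: layer_def)

lemma open_layer: "open (layer \<Gamma> k)"
  using sides(1,2)[of 1] sides(1,2)[of 2] by (auto simp: layer_def)

text \<open>The set in which the test functions for \<open>\<Gamma> j\<close> have their support. It is open, being the domain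
  beyond \<open>\<Gamma> 2\<close> or \<open>\<Gamma> 1\<close> that contains \<open>\<Gamma> j\<close>.\<close>

definition around :: "nat \<Rightarrow> pt set" where
  "around j = layer \<Gamma> j \<union> \<Gamma> j \<union> layer \<Gamma> (j + 1)"

lemma around_eq: "around 1 = above (\<Gamma> 2)" "around 2 = below (\<Gamma> 1)"
proof -
  have j: "1 \<in> {1, 2::nat}" "2 \<in> {1, 2::nat}" by auto
  have set: "A1 \<union> G1 \<union> (B1 \<inter> A2) = A2" "(B1 \<inter> A2) \<union> G2 \<union> B2 = B1"
    if "A1 \<inter> B1 = {}" "- G1 = A1 \<union> B1" "A2 \<inter> B2 = {}" "- G2 = A2 \<union> B2"
      "A1 \<union> G1 \<subseteq> A2" "B2 \<union> G2 \<subseteq> B1" for A1 A2 B1 B2 G1 G2 :: "pt set"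
    using that by blast+
  note f = set[OF sides(3,4)[OF j(1)] sides(3,4)[OF j(2)] nested]
  have "around 1 = layer \<Gamma> 1 \<union> \<Gamma> 1 \<union> layer \<Gamma> 2" "around 2 = layer \<Gamma> 2 \<union> \<Gamma> 2 \<union> layer \<Gamma> 3"
    unfolding around_def by (simp_all add: eval_nat_numeral)
  then show "around 1 = above (\<Gamma> 2)" "around 2 = below (\<Gamma> 1)"
    unfolding layer_simps using f by simp_all
qed

lemma open_around: "j \<in> {1, 2} \<Longrightarrow> open (around j)"
  using sides(1)[of 2] sides(2)[of 1] around_eq by auto

lemma layer_side:
  assumes "j \<in> {1, 2}"
  shows "above (\<Gamma> j) \<inter> around j = layer \<Gamma> j" "below (\<Gamma> j) \<inter> around j = layer \<Gamma> (j + 1)"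
    "layer \<Gamma> j \<inter> layer \<Gamma> (j + 1) = {}" "layer \<Gamma> j \<inter> \<Gamma> j = {}" "layer \<Gamma> (j + 1) \<inter> \<Gamma> j = {}"
    "\<Gamma> j \<subseteq> closure (layer \<Gamma> j)" "\<Gamma> j \<subseteq> closure (layer \<Gamma> (j + 1))"
proof -
  have sub: "layer \<Gamma> j \<subseteq> above (\<Gamma> j)" "layer \<Gamma> (j + 1) \<subseteq> below (\<Gamma> j)"
    using assms nested by (auto simp: layer_def)
  note f = sides(3,4)[OF assms]
  show 1: "above (\<Gamma> j) \<inter> around j = layer \<Gamma> j" "below (\<Gamma> j) \<inter> around j = layer \<Gamma> (j + 1)"
    "layer \<Gamma> j \<inter> layer \<Gamma> (j + 1) = {}" "layer \<Gamma> j \<inter> \<Gamma> j = {}" "layer \<Gamma> (j + 1) \<inter> \<Gamma> j = {}"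
  proof -
    have "A \<inter> (L \<union> G \<union> M) = L" "B \<inter> (L \<union> G \<union> M) = M" "L \<inter> M = {}" "L \<inter> G = {}" "M \<inter> G = {}"
      if "L \<subseteq> A" "M \<subseteq> B" "A \<inter> B = {}" "- G = A \<union> B" for A B G L M :: "pt set"
      using that by blast+
    from this[OF sub f] show "above (\<Gamma> j) \<inter> around j = layer \<Gamma> j" "below (\<Gamma> j) \<inter> around j = layer \<Gamma> (j + 1)"
      "layer \<Gamma> j \<inter> layer \<Gamma> (j + 1) = {}" "layer \<Gamma> j \<inter> \<Gamma> j = {}" "layer \<Gamma> (j + 1) \<inter> \<Gamma> j = {}"
      unfolding around_def by simp_all
  qed
  have "\<Gamma> j \<subseteq> around j" unfolding around_def by blast
  then show "\<Gamma> j \<subseteq> closure (layer \<Gamma> j)" "\<Gamma> j \<subseteq> closure (layer \<Gamma> (j + 1))"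
    unfolding 1(1,2)[symmetric] Int_commute[of _ "around j"]
    using sides(6,7)[OF assms] open_Int_closure_subset[OF open_around[OF assms], of "above (\<Gamma> j)"]
      open_Int_closure_subset[OF open_around[OF assms], of "below (\<Gamma> j)"]
    by blast+
qed

end

section \<open>Traces and restrictions of solutions\<close>

text \<open>The velocity extends continuously to the closure by definition, but that the extension is the
  time derivative of the trace has to be shown: for interior points \<open>y\<close> near \<open>x\<close> the mean value theorem
  compares \<open>u(y, s) - u(y, t)\<close> with \<open>v(x, t) (s - t)\<close>, uniformly in \<open>y\<close>, and \<open>y\<close> tends to \<open>x\<close>. Hence equal
  traces have equal velocities.\<close>

lemma wave_solution_velocity_extension:
  assumes "wave_solution D c u"
  obtains v where "continuous_on (closure D \<times> {0..}) v" "\<And>x t. x \<in> D \<Longrightarrow> t > 0 \<Longrightarrow> v (x, t) = dt u (x, t)"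
    "\<And>x t. x \<in> closure D \<Longrightarrow> t > 0 \<Longrightarrow> ((\<lambda>s. u (x, s)) has_real_derivative v (x, t)) (at t)"
proof -
  obtain v where v: "continuous_on (closure D \<times> {0..}) v" "\<forall>p\<in>D \<times> {0<..}. v p = dt u p"
    using wave_solutionD(3)[OF assms] by blast
  have "((\<lambda>s. u (x, s)) has_real_derivative v (x, t)) (at t)" if x: "x \<in> closure D" and t: "t > 0" for x t
    unfolding has_field_derivative_def has_derivative_at_alt
  proof (intro conjI allI impI)
    show "bounded_linear ((*) (v (x, t)))" by (rule bounded_linear_mult_right)
    fix e :: real assume "e > 0"
    have "(x, t) \<in> closure D \<times> {0..}" using x t by simp
    from v(1)[unfolded continuous_on_iff, rule_format, OF this \<open>e > 0\<close>] obtain d where d: "d > 0"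
      "\<And>p. p \<in> closure D \<times> {0..} \<Longrightarrow> dist p (x, t) < d \<Longrightarrow> dist (v p) (v (x, t)) < e"
      by blast
    define d' where "d' = min (d / 2) t"
    have d': "d' > 0" "d' \<le> d / 2" "d' \<le> t" using d(1) t by (auto simp: d'_def)
    show "\<exists>d>0. \<forall>y. norm (y - t) < d \<longrightarrow> norm (u (x, y) - u (x, t) - v (x, t) * (y - t)) \<le> e * norm (y - t)"
    proof (intro exI[of _ d'] conjI allI impI d'(1))
      fix s assume s: "norm (s - t) < d'"
      then have s0: "s > 0" using d' by (auto simp: abs_if split: if_splits)
      have bound: "\<bar>u (y, s) - u (y, t) - v (x, t) * (s - t)\<bar> \<le> e * \<bar>s - t\<bar>"
        if y: "y \<in> D" "dist y x < d / 2" for y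
      proof (cases "s = t")
        case False
        define l m where "l = min s t" and "m = max s t"
        have lm: "l < m" "0 < l" using False s0 t by (auto simp: l_def m_def)
        obtain k where k: "l < k" "k < m" "u (y, m) - u (y, l) = (m - l) * dt u (y, k)"
          using MVT2[OF lm(1), of "\<lambda>s. u (y, s)" "\<lambda>s. dt u (y, s)"]
            time_slice[OF wave_solution_diff(1)[OF assms y(1)]] lm by auto
        have eq: "u (y, s) - u (y, t) = (s - t) * dt u (y, k)"
          using k(3) by (auto simp: l_def m_def min_def max_def algebra_simps split: if_splits)
        have "\<bar>k - t\<bar> < d / 2" using k(1,2) s d' by (auto simp: l_def m_def min_def max_def split: if_splits)
        have "dist (y, k) (x, t) \<le> dist y x + dist k t"
          unfolding dist_Pair_Pair using sqrt_sum_squares_le_sum[of "dist y x" "dist k t"] by simp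
        also have "\<dots> < d" using y(2) \<open>\<bar>k - t\<bar> < d / 2\<close> unfolding dist_real_def by linarith
        finally have "dist (v (y, k)) (v (x, t)) < e"
          using d(2)[of "(y, k)"] y(1) closure_subset k lm by force
        moreover have "v (y, k) = dt u (y, k)" using v(2) y(1) k lm by auto
        ultimately have "\<bar>dt u (y, k) - v (x, t)\<bar> \<le> e" by (simp add: dist_real_def)
        then have "\<bar>s - t\<bar> * \<bar>dt u (y, k) - v (x, t)\<bar> \<le> \<bar>s - t\<bar> * e" by (intro mult_left_mono) auto
        then show ?thesis unfolding eq abs_mult[symmetric] by (simp add: algebra_simps)
      qed simp
      obtain y where y: "\<And>n. y n \<in> D" "y \<longlonglongrightarrow> x" using x unfolding closure_sequential by blast
      have lim: "(\<lambda>n. u (y n, r)) \<longlonglongrightarrow> u (x, r)" if "r > 0" for r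
      proof -
        have "continuous_on (closure D) (\<lambda>x. u (x, r))"
          using that by (intro continuous_on_cross(2)[OF wave_solutionD(2)[OF assms]]) auto
        then show ?thesis
          by (rule continuous_on_tendsto_compose[OF _ y(2) x]) (use y(1) closure_subset in \<open>auto intro!: always_eventually\<close>)
      qed
      have "(\<lambda>n. \<bar>u (y n, s) - u (y n, t) - v (x, t) * (s - t)\<bar>) \<longlonglongrightarrow> \<bar>u (x, s) - u (x, t) - v (x, t) * (s - t)\<bar>"
        by (intro tendsto_intros lim s0 t)
      moreover have "\<forall>\<^sub>F n in sequentially. \<bar>u (y n, s) - u (y n, t) - v (x, t) * (s - t)\<bar> \<le> e * \<bar>s - t\<bar>"
        using tendstoD[OF y(2), of "d / 2"] d(1) by (auto elim!: eventually_mono intro: bound y(1))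
      ultimately have "\<bar>u (x, s) - u (x, t) - v (x, t) * (s - t)\<bar> \<le> e * \<bar>s - t\<bar>"
        by (intro tendsto_upperbound) auto
      then show "norm (u (x, s) - u (x, t) - v (x, t) * (s - t)) \<le> e * norm (s - t)" by simp
    qed
  qed
  with v show thesis by (intro that[of v]) auto
qed

lemma set_integral_subset_le:
  fixes f :: "'a::euclidean_space \<Rightarrow> real"
  assumes "set_integrable lborel B f" "A \<subseteq> B" "A \<in> sets lborel" "\<And>x. 0 \<le> f x"
  shows "set_integrable lborel A f" "(LINT x:A|lborel. f x) \<le> (LINT x:B|lborel. f x)"
proof -
  show i: "set_integrable lborel A f" using set_integrable_subset[OF assms(1,3,2)] .
  show "(LINT x:A|lborel. f x) \<le> (LINT x:B|lborel. f x)"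
    using i assms(1) assms(2,4) unfolding set_lebesgue_integral_def set_integrable_def
    by (intro integral_mono) (auto simp: indicator_def)
qed

lemma wave_solution_subset:
  assumes u: "wave_solution D c u" and D: "open D'" "D' \<subseteq> D"
  shows "wave_solution D' c u"
proof -
  have cl: "closure D' \<times> {0..} \<subseteq> closure D \<times> {0::real..}" using closure_mono[OF D(2)] by auto
  have "\<exists>C. \<forall>t\<in>{0<..T}. \<forall>v\<in>energy_fields u.
          set_integrable lborel (D' \<inter> ball 0 R) (\<lambda>x. (v (x, t))\<^sup>2) \<and>
          (LINT x:D' \<inter> ball 0 R|lborel. (v (x, t))\<^sup>2) \<le> C" for R T
  proof -
    obtain C where C:
      "\<And>t v. 0 < t \<Longrightarrow> t \<le> T \<Longrightarrow> v \<in> energy_fields u \<Longrightarrow> set_integrable lborel (D \<inter> ball 0 R) (\<lambda>x. (v (x, t))\<^sup>2)"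
      "\<And>t v. 0 < t \<Longrightarrow> t \<le> T \<Longrightarrow> v \<in> energy_fields u \<Longrightarrow> (LINT x:D \<inter> ball 0 R|lborel. (v (x, t))\<^sup>2) \<le> C"
      by (rule wave_solution_energy_bound[OF u]) (rule that)
    have "D' \<inter> ball 0 R \<subseteq> D \<inter> ball 0 R" "D' \<inter> ball 0 R \<in> sets lborel" using D by auto
    note S = set_integral_subset_le[OF _ this zero_le_power2]
    show ?thesis
    proof (intro exI[of _ C] ballI conjI)
      fix t v assume "t \<in> {0<..T}" and v: "v \<in> energy_fields u"
      then have t: "0 < t" "t \<le> T" by auto
      show "set_integrable lborel (D' \<inter> ball 0 R) (\<lambda>x. (v (x, t))\<^sup>2)"
        by (rule S(1)[OF C(1)[OF t v]])
      show "(LINT x:D' \<inter> ball 0 R|lborel. (v (x, t))\<^sup>2) \<le> C"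
        by (rule order_trans[OF S(2)[OF C(1)[OF t v]] C(2)[OF t v]])
    qed
  qed
  moreover have "\<exists>v. continuous_on (closure D' \<times> {0..}) v \<and> (\<forall>p\<in>D' \<times> {0<..}. v p = dt u p)"
  proof -
    obtain v where v: "continuous_on (closure D \<times> {0..}) v" "\<forall>p\<in>D \<times> {0<..}. v p = dt u p"
      using wave_solutionD(3)[OF u] by blast
    have "continuous_on (closure D' \<times> {0..}) v" by (rule continuous_on_subset[OF v(1) cl])
    then show ?thesis using v(2) D(2) by blast
  qed
  moreover have "\<exists>v. continuous_on (D' \<times> {0..}) v \<and> (\<forall>p\<in>D' \<times> {0<..}. v p = dx i u p)" for i
  proof -
    obtain v where v: "continuous_on (D \<times> {0..}) v" "\<forall>p\<in>D \<times> {0<..}. v p = dx i u p"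
      using wave_solutionD(4)[OF u] by blast
    have "continuous_on (D' \<times> {0..}) v" by (rule continuous_on_subset[OF v(1)]) (use D in auto)
    then show ?thesis using v(2) D(2) by blast
  qed
  moreover have "Ck_on 2 (D' \<times> {0<..}) u"
    by (rule Ck_on_subset[OF wave_solutionD(1)[OF u]]) (use D in auto)
  moreover have "continuous_on (closure D' \<times> {0..}) u"
    by (rule continuous_on_subset[OF wave_solutionD(2)[OF u] cl])
  ultimately have "solution_class D' u" unfolding solution_class_def energy_fields_def by blast
  then show ?thesis using u D(2) unfolding wave_solution_def by blast
qed

section \<open>Linearity of Green's functional\<close>

lemma compact_in_cball:
  fixes S :: "'a::real_normed_vector set"
  assumes "compact S"
  obtains R where "S \<subseteq> cball 0 R"
  using compact_imp_bounded[OF assms] that by (auto simp: bounded_iff subset_eq)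

lemma green_add:
  assumes "open D" "wave_solution D c u" "c > 0" "t > 0" "admissible D \<phi>" "admissible D \<psi>"
  shows "green D u t (\<lambda>x. \<phi> x + \<psi> x) = green D u t \<phi> + green D u t \<psi>"
proof -
  have d: "\<phi> differentiable (at x)" "\<psi> differentiable (at x)" if "x \<in> D" for x
    using assms(5,6) that by (auto simp: admissible_def C1_on_iff)
  have "green D u t (\<lambda>x. \<phi> x + \<psi> x) = (LINT x:D|lborel.
     (laplacian u (x, t) * \<phi> x + (\<Sum>i\<in>UNIV. dx i u (x, t) * partial (axis i 1) \<phi> x)) +
     (laplacian u (x, t) * \<psi> x + (\<Sum>i\<in>UNIV. dx i u (x, t) * partial (axis i 1) \<psi> x)))"
    unfolding green_def
    using partial_linear[of \<phi> _ \<psi> _ 1] d assms(1)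
    by (intro set_lebesgue_integral_cong) (auto simp: algebra_simps sum_2)
  also have "\<dots> = green D u t \<phi> + green D u t \<psi>"
    unfolding green_def by (rule set_integral_add(2)) (rule green_integrable assms)+
  finally show ?thesis .
qed

lemma field_derivatives_lincomb:
  assumes D: "open D" and u: "wave_solution D c u" "wave_solution D c v" and p: "p \<in> D \<times> {0<..}"
  shows "dt (\<lambda>p. u p + a * v p) p = dt u p + a * dt v p"
    "dx i (\<lambda>p. u p + a * v p) p = dx i u p + a * dx i v p"
    "dt (dt (\<lambda>p. u p + a * v p)) p = dt (dt u) p + a * dt (dt v) p"
    "dx i (dt (\<lambda>p. u p + a * v p)) p = dx i (dt u) p + a * dx i (dt v) p"
    "laplacian (\<lambda>p. u p + a * v p) p = laplacian u p + a * laplacian v p"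
proof -
  let ?S = "D \<times> {0::real<..}"
  have S: "open ?S" using D by (intro open_Times) auto
  have du: "u differentiable (at p)" "dt u differentiable (at p)" "dx i u differentiable (at p)"
    "v differentiable (at p)" "dt v differentiable (at p)" "dx i v differentiable (at p)"
    if "p \<in> ?S" for p i
    using that wave_solution_diff[OF u(1)] wave_solution_diff[OF u(2)] by auto
  have 1: "dt (\<lambda>p. u p + a * v p) p = dt u p + a * dt v p"
    "dx i (\<lambda>p. u p + a * v p) p = dx i u p + a * dx i v p" if "p \<in> ?S" for p i
    by (rule partial_linear[OF du(1,4)[OF that]])+
  show "dt (\<lambda>p. u p + a * v p) p = dt u p + a * dt v p"
    "dx i (\<lambda>p. u p + a * v p) p = dx i u p + a * dx i v p"
    by (rule 1[OF p])+
  have 2: "partial b (dt (\<lambda>p. u p + a * v p)) p = partial b (dt u) p + a * partial b (dt v) p" for b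
    by (rule trans[OF partial_cong_open[OF S p 1(1)] partial_linear[OF du(2,5)[OF p]]])
  show "dt (dt (\<lambda>p. u p + a * v p)) p = dt (dt u) p + a * dt (dt v) p"
    "dx i (dt (\<lambda>p. u p + a * v p)) p = dx i (dt u) p + a * dx i (dt v) p"
    by (rule 2)+
  have 3: "dx i (dx i (\<lambda>p. u p + a * v p)) p = dx i (dx i u) p + a * dx i (dx i v) p" for i
    by (rule trans[OF partial_cong_open[OF S p 1(2)] partial_linear[OF du(3,6)[OF p]]])
  show "laplacian (\<lambda>p. u p + a * v p) p = laplacian u p + a * laplacian v p"
    unfolding laplacian_def 3 by (simp add: sum.distrib sum_distrib_left)
qed

lemma green_lincomb:
  assumes "open D" "wave_solution D c u" "wave_solution D c v" "c > 0" "t > 0" "admissible D \<phi>"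
  shows "green D (\<lambda>p. u p + a * v p) t \<phi> = green D u t \<phi> + a * green D v t \<phi>"
proof -
  let ?g = "\<lambda>u x. laplacian u (x, t) * \<phi> x + (\<Sum>i\<in>UNIV. dx i u (x, t) * partial (axis i 1) \<phi> x)"
  have "green D (\<lambda>p. u p + a * v p) t \<phi> = (LINT x:D|lborel. ?g u x + a * ?g v x)"
    unfolding green_def
  proof (intro set_lebesgue_integral_cong ballI allI impI)
    show "D \<in> sets lborel" using assms(1) by simp
    fix x assume "x \<in> D"
    then have p: "(x, t) \<in> D \<times> {0<..}" using assms(5) by simp
    show "?g (\<lambda>p. u p + a * v p) x = ?g u x + a * ?g v x"
      unfolding field_derivatives_lincomb[OF assms(1-3) p] by (simp add: sum_2 algebra_simps)
  qed
  also have "\<dots> = green D u t \<phi> + (LINT x:D|lborel. a * ?g v x)"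
    unfolding green_def
    by (rule set_integral_add(2)) (rule set_integrable_mult_right green_integrable assms | intro impI)+
  also have "\<dots> = green D u t \<phi> + a * green D v t \<phi>"
    unfolding green_def set_integral_mult_right ..
  finally show ?thesis .
qed

section \<open>Domain of dependence\<close>

lemma partial_zero_fun: "partial b (\<lambda>_. 0) p = 0"
  by (rule partial_eqI[THEN trans]) (auto intro: has_derivative_const)

lemma velocity_zero:
  assumes "open D" "x \<in> D" "0 < s" "s < S" "\<And>y s. y \<in> D \<Longrightarrow> 0 < s \<Longrightarrow> s < S \<Longrightarrow> u (y, s) = 0"
  shows "dt u (x, s) = 0"
proof -
  have "open (D \<times> {0<..<S})" using assms(1) by (intro open_Times) auto
  then have "dt u (x, s) = dt (\<lambda>_. 0) (x, s)"
    by (rule partial_cong_open) (use assms in auto)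
  then show ?thesis by (simp add: partial_zero_fun)
qed

text \<open>After time \<open>S\<close> the backward light cone with tip \<open>(x, t)\<close> stays inside the ball, so the cut-off has
  compact support in \<open>E\<close> and no boundary flux arises; up to time \<open>S\<close> the flux vanishes with the wave.\<close>

lemma cone_vanishing:
  assumes E: "open E" and u: "wave_solution E c u" and c: "0 < c"
    and van: "\<And>y s. y \<in> E \<Longrightarrow> 0 < s \<Longrightarrow> s < S \<Longrightarrow> u (y, s) = 0" and S: "0 \<le> S"
    and x: "x \<in> E" "ball x \<rho> \<subseteq> E" and t: "0 \<le> t" "c * (t - S) < \<rho>" "0 < \<rho>"
  shows "u (x, t) = 0"
proof -
  obtain \<rho>' where \<rho>': "max 0 (c * (t - S)) < \<rho>'" "\<rho>' < \<rho>"
    using t dense[of "max 0 (c * (t - S))" \<rho>] by auto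
  \<comment> \<open>The cone has radius \<open>\<rho>'\<close> at time \<open>S\<close>, which is enough to contain the tip at time \<open>t\<close>.\<close>
  define r where "r = \<rho>' + c * S"
  have r: "c * t < r" using \<rho>' by (simp add: r_def algebra_simps)
  show ?thesis
  proof (rule energy_uniqueness[of "{()}" "\<lambda>_. E" "\<lambda>_. c" "\<lambda>_. u" c "\<lambda>_. 1" t r x "()" x t])
    show "norm (x - x) < r - c * t" using r by simp
    fix s assume s: "0 < s" "s < t"
    let ?\<phi> = "\<lambda>y. cone_cutoff x r c (y, s) * dt u (y, s)"
    have "green E u s ?\<phi> = 0"
    proof (cases "s < S")
      case True
      have "dt u (y, s) = 0" if "y \<in> E" for y
        by (rule velocity_zero[OF E that s(1) True]) (rule van)
      then show ?thesis by (intro green_zero_test[OF E]) simp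
    next
      case False
      have cs: "c * s < r" using s c r mult_strict_left_mono[of s t c] by linarith
      have rs: "r - c * s \<le> \<rho>'" using False c by (simp add: r_def)
      show ?thesis
      proof (rule green_interior_support[OF E wave_solutionD(1)[OF u] s(1), of _ "cball x \<rho>'"])
        show "C1_on E ?\<phi>"
          by (rule C1_on_mult[OF cone_cutoff_C1 space_slice_C1[OF wave_solution_C1(2)[OF u] s(1)]])
        show "cball x \<rho>' \<subseteq> E" using x(2) \<rho>'(2) by (intro order_trans[OF _ x(2)]) auto
        fix y i assume "y \<in> E - cball x \<rho>'"
        then have "r - c * s \<le> norm (y - x)" using rs by (simp add: dist_norm norm_minus_commute)
        then show "?\<phi> y * dx i u (y, s) = 0"
          using cone_cutoff_zero(1)[of c s r y x] c s cs by simp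
      qed simp
    qed
    then show "(\<Sum>k\<in>{()}. 1 * green E u s ?\<phi>) \<le> 0" by simp
  qed (use E u c r x t in auto)
qed

section \<open>Gluing across an interface\<close>

context layers begin

lemma test_function_intro:
  assumes j: "j \<in> {1, 2}" and \<phi>: "continuous_on UNIV \<phi>" "compact F" "F \<subseteq> around j" "\<And>x. x \<notin> F \<Longrightarrow> \<phi> x = 0"
    and adm: "admissible (layer \<Gamma> j) \<phi>" "admissible (layer \<Gamma> (j + 1)) \<phi>"
  shows "\<phi> \<in> test_functions \<Gamma> j"
proof -
  have sF: "supp \<phi> \<subseteq> F"
    unfolding supp_def using \<phi>(2,4) by (intro closure_minimal compact_imp_closed) auto
  have cs: "compact (supp \<phi>)"
    using compact_Int_closed[OF \<phi>(2), of "supp \<phi>"] sF by (simp add: supp_def Int_absorb1)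
  have C: "Ck_on 1 (layer \<Gamma> j \<union> layer \<Gamma> (j + 1)) \<phi>"
    using adm unfolding admissible_def C1_on_def[symmetric]
    by (intro C1_on_Un open_layer) auto
  have I: "set_integrable lborel (layer \<Gamma> j \<union> layer \<Gamma> (j + 1)) (\<lambda>x. (partial (axis i 1) \<phi> x)\<^sup>2)" for i
    using adm open_layer unfolding admissible_def by (intro set_integrable_Un) auto
  show ?thesis
    unfolding test_functions_def mem_Collect_eq
    using \<phi>(1,3) sF cs C I unfolding around_def by blast
qed

lemma test_function_admissible:
  assumes "\<phi> \<in> test_functions \<Gamma> j" "k = j \<or> k = j + 1"
  shows "admissible (layer \<Gamma> k) \<phi>"
proof -
  let ?U = "layer \<Gamma> j \<union> layer \<Gamma> (j + 1)"
  have \<phi>: "continuous_on UNIV \<phi>" "compact (supp \<phi>)" "C1_on ?U \<phi>"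
    "\<And>i. set_integrable lborel ?U (\<lambda>x. (partial (axis i 1) \<phi> x)\<^sup>2)"
    using assms(1) unfolding test_functions_def C1_on_def by blast+
  have sub: "layer \<Gamma> k \<subseteq> ?U" using assms(2) by auto
  have z: "\<phi> x = 0" if "x \<notin> supp \<phi>" for x using that closure_subset[of "{p. \<phi> p \<noteq> 0}"] unfolding supp_def by blast
  obtain R where R: "supp \<phi> \<subseteq> cball 0 R"
    using compact_in_cball[OF \<phi>(2)] .
  have "integrable lborel (\<lambda>x. (\<phi> x)\<^sup>2)"
    by (rule integrable_continuous_compact_support[OF _ \<phi>(2)])
      (use \<phi>(1) z in \<open>auto intro!: continuous_intros\<close>)
  then have "set_integrable lborel (layer \<Gamma> k) (\<lambda>x. (\<phi> x)\<^sup>2)"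
    using open_layer[of k] unfolding set_integrable_def
    by (intro integrable_mult_indicator) auto
  moreover have "set_integrable lborel (layer \<Gamma> k) (\<lambda>x. (partial (axis i 1) \<phi> x)\<^sup>2)" for i
    using set_integrable_subset[OF \<phi>(4) _ sub] open_layer[of k] by simp
  moreover have "\<forall>x\<in>layer \<Gamma> k - cball 0 R. \<phi> x = 0" using z R by auto
  ultimately show ?thesis
    unfolding admissible_def using C1_on_subset[OF \<phi>(3) sub] by blast
qed

text \<open>Equal traces have equal velocities, so the velocities of the two waves glue to a continuous
  function, and its product with the cut-off \<open>\<zeta>\<close> is a test function. The homogeneous flux condition
  applied to it says that the two weighted boundary fluxes of the energy method cancel.\<close>

lemma glued_flux:
  assumes j: "j \<in> {1, 2}"
    and w: "wave_solution (layer \<Gamma> j) c w" "wave_solution (layer \<Gamma> (j + 1)) c' w'"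
    and trace: "\<And>x t. x \<in> \<Gamma> j \<Longrightarrow> 0 < t \<Longrightarrow> t < T \<Longrightarrow> w' (x, t) = w (x, t)"
    and flux: "\<And>\<phi>. \<phi> \<in> test_functions \<Gamma> j \<Longrightarrow>
       normal_deriv \<Gamma> j (j + 1) w' s \<phi> / \<rho> (j + 1) - normal_deriv \<Gamma> j j w s \<phi> / \<rho> j = 0"
    and s: "0 < s" "s < T"
    and \<zeta>: "C1_on UNIV \<zeta>" "compact F" "F \<subseteq> around j" "\<And>x. x \<notin> F \<Longrightarrow> \<zeta> x = 0"
  shows "green (layer \<Gamma> j) w s (\<lambda>x. \<zeta> x * dt w (x, s)) / \<rho> j
       + green (layer \<Gamma> (j + 1)) w' s (\<lambda>x. \<zeta> x * dt w' (x, s)) / \<rho> (j + 1) = 0"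
proof -
  let ?L = "layer \<Gamma> j" and ?L' = "layer \<Gamma> (j + 1)"
  note LS = layer_side[OF j]
  obtain v where v: "continuous_on (closure ?L \<times> {0..}) v" "\<And>x t. x \<in> ?L \<Longrightarrow> t > 0 \<Longrightarrow> v (x, t) = dt w (x, t)"
    "\<And>x t. x \<in> closure ?L \<Longrightarrow> t > 0 \<Longrightarrow> ((\<lambda>s. w (x, s)) has_real_derivative v (x, t)) (at t)"
    by (rule wave_solution_velocity_extension[OF w(1)]) (rule that)
  obtain v' where v': "continuous_on (closure ?L' \<times> {0..}) v'" "\<And>x t. x \<in> ?L' \<Longrightarrow> t > 0 \<Longrightarrow> v' (x, t) = dt w' (x, t)"
    "\<And>x t. x \<in> closure ?L' \<Longrightarrow> t > 0 \<Longrightarrow> ((\<lambda>s. w' (x, s)) has_real_derivative v' (x, t)) (at t)"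
    by (rule wave_solution_velocity_extension[OF w(2)]) (rule that)
  \<comment> \<open>The traces agree on a whole time interval around \<open>s\<close>, hence so do their derivatives.\<close>
  have eq: "v' (x, s) = v (x, s)" if x: "x \<in> \<Gamma> j" for x
  proof -
    have "x \<in> closure ?L" "x \<in> closure ?L'" using x LS(6,7) by auto
    from v(3)[OF this(1) s(1)] v'(3)[OF this(2) s(1)]
    have d: "((\<lambda>s. w (x, s)) has_real_derivative v (x, s)) (at s)"
      "((\<lambda>s. w' (x, s)) has_real_derivative v' (x, s)) (at s)" .
    from d(1) have "((\<lambda>s. w' (x, s)) has_real_derivative v (x, s)) (at s)"
      by (rule has_field_derivative_transform_within_open[of _ _ _ "{0<..<T}"]) (use trace x s in auto)
    then show ?thesis by (rule DERIV_unique[OF d(2)])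
  qed
  define \<phi> where "\<phi> x = (if x \<in> ?L \<union> \<Gamma> j then \<zeta> x * v (x, s) else if x \<in> ?L' then \<zeta> x * v' (x, s) else 0)" for x
  have \<phi>0: "\<phi> x = 0" if "x \<notin> F" for x using \<zeta>(4)[OF that] by (simp add: \<phi>_def)
  have zc: "continuous_on A \<zeta>" for A by (rule continuous_on_subset[OF C1_on_continuous[OF \<zeta>(1)]]) simp
  have "?L \<union> \<Gamma> j \<subseteq> closure ?L" "?L' \<union> \<Gamma> j \<subseteq> closure ?L'"
    using LS(6,7) closure_subset[of ?L] closure_subset[of ?L'] by blast+
  then have "continuous_on (?L \<union> \<Gamma> j) (\<lambda>x. v (x, s))" "continuous_on (?L' \<union> \<Gamma> j) (\<lambda>x. v' (x, s))"
    using s continuous_on_cross(2)[OF v(1), of s] continuous_on_cross(2)[OF v'(1), of s]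
    by (auto intro: continuous_on_subset)
  then have cv: "continuous_on (?L \<union> \<Gamma> j) (\<lambda>x. \<zeta> x * v (x, s))"
    "continuous_on (?L' \<union> \<Gamma> j) (\<lambda>x. \<zeta> x * v' (x, s))"
    using zc by (auto intro!: continuous_on_mult)
  have ar: "around j = (?L \<union> \<Gamma> j) \<union> (?L' \<union> \<Gamma> j)" unfolding around_def by auto
  have "continuous_on (around j) \<phi>"
  proof -
    have "?L \<union> \<Gamma> j = around j \<inter> - ?L'" "?L' \<union> \<Gamma> j = around j \<inter> - ?L"
      using LS(3-5) unfolding around_def by auto
    then have c: "closedin (top_of_set (around j)) (?L \<union> \<Gamma> j)" "closedin (top_of_set (around j)) (?L' \<union> \<Gamma> j)"
      using closedin_closed_Int[OF closed_Compl[OF open_layer], of "around j"] by metis+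
    have "continuous_on ((?L \<union> \<Gamma> j) \<union> (?L' \<union> \<Gamma> j))
       (\<lambda>x. if x \<in> ?L \<union> \<Gamma> j then \<zeta> x * v (x, s) else \<zeta> x * v' (x, s))"
      by (rule continuous_on_cases_local[OF c[unfolded ar] cv]) (use eq LS(3-5) in auto)
    then show ?thesis
      unfolding ar[symmetric]
      by (rule continuous_on_eq) (auto simp: \<phi>_def around_def)
  qed
  moreover have "continuous_on (- F) \<phi>"
    by (rule continuous_on_eq[OF continuous_on_const[of _ 0]]) (simp add: \<phi>0)
  moreover have "open (- F)" using \<zeta>(2) by (simp add: compact_imp_closed open_Compl)
  ultimately have "continuous_on (around j \<union> - F) \<phi>"
    by (intro continuous_on_open_Un open_around j)
  moreover have "around j \<union> - F = UNIV" using \<zeta>(3) by blast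
  ultimately have contphi: "continuous_on UNIV \<phi>" by simp
  obtain R where "F \<subseteq> cball 0 R" using compact_in_cball[OF \<zeta>(2)] .
  then have R: "\<zeta> x = 0" if "x \<notin> cball 0 R" for x using \<zeta>(4) that by blast
  have on: "\<zeta> x * dt w (x, s) = \<phi> x" if "x \<in> ?L" for x
    using that v(2)[OF that s(1)] by (simp add: \<phi>_def)
  have on': "\<zeta> x * dt w' (x, s) = \<phi> x" if "x \<in> ?L'" for x
  proof -
    have "x \<notin> ?L \<union> \<Gamma> j" using that LS(3,5) by blast
    then show ?thesis using that v'(2)[OF that s(1)] by (simp add: \<phi>_def)
  qed
  have "admissible ?L (\<lambda>x. \<zeta> x * dt w (x, s))" "admissible ?L' (\<lambda>x. \<zeta> x * dt w' (x, s))"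
    by (rule admissible_cutoff_velocity[OF open_layer w(1) s(1) \<zeta>(1)], erule R)
      (rule admissible_cutoff_velocity[OF open_layer w(2) s(1) \<zeta>(1)], erule R)
  then have "admissible ?L \<phi>" "admissible ?L' \<phi>"
    by (auto elim: admissible_cong[OF open_layer, rotated] simp: on on')
  then have "\<phi> \<in> test_functions \<Gamma> j"
    by (intro test_function_intro[OF j contphi \<zeta>(2,3) \<phi>0])
  from flux[OF this] have "green ?L w s \<phi> / \<rho> j + green ?L' w' s \<phi> / \<rho> (j + 1) = 0"
    unfolding normal_deriv_green by simp
  then show ?thesis
    using green_cong[OF open_layer on] green_cong[OF open_layer on'] by simp
qed

text \<open>A partition of unity that is meaningful on the ball \<open>cball 0 R\<close> only. There \<open>\<theta> 1\<close> is \<open>1\<close> on and above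
  \<open>\<Gamma> 1\<close> and \<open>0\<close> on and below \<open>\<Gamma> 2\<close>, with a neighbourhood in both cases, so the transition takes place
  inside the middle layer.\<close>

definition interface_partition :: "real \<Rightarrow> (nat \<Rightarrow> pt \<Rightarrow> real) \<Rightarrow> (nat \<Rightarrow> pt set) \<Rightarrow> bool" where
  "interface_partition R \<theta> U \<longleftrightarrow>
    (\<forall>j\<in>{1, 2}. C1_on UNIV (\<theta> j) \<and> open (U j) \<and> (\<forall>x\<in>U j. \<theta> j x = 1)) \<and> (\<forall>x. \<theta> 1 x + \<theta> 2 x = 1) \<and>
    (above (\<Gamma> 1) \<union> \<Gamma> 1) \<inter> cball 0 R \<subseteq> U 1 \<and> (below (\<Gamma> 2) \<union> \<Gamma> 2) \<inter> cball 0 R \<subseteq> U 2"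

lemma interface_partition_exists:
  obtains \<theta> U where "interface_partition R \<theta> U"
proof -
  have j: "1 \<in> {1, 2::nat}" "2 \<in> {1, 2::nat}" by auto
  let ?A = "above (\<Gamma> 1) \<union> \<Gamma> 1" and ?B = "below (\<Gamma> 2) \<union> \<Gamma> 2"
  have A: "?A = - below (\<Gamma> 1)" and B: "?B = - above (\<Gamma> 2)"
    using sides(3,4)[OF j(1)] sides(3,4)[OF j(2)] by blast+
  have "closed ?A" "closed ?B"
    unfolding A B using sides(1)[OF j(2)] sides(2)[OF j(1)] by auto
  moreover have "?A \<inter> ?B = {}" using nested(2) A by blast
  moreover have "?A \<noteq> {}" "?B \<noteq> {}" using interface_components(4)[OF interface] by auto
  ultimately obtain \<theta> U V where t: "C1_on UNIV \<theta>" "open U" "open V" "?A \<inter> cball 0 R \<subseteq> U" "?B \<inter> cball 0 R \<subseteq> V"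
    "\<And>x. x \<in> U \<Longrightarrow> \<theta> x = 1" "\<And>x. x \<in> V \<Longrightarrow> \<theta> x = (0::real)"
    using C1_separation[OF _ _ _ _ _ compact_cball] by metis
  have t2: "C1_on UNIV (\<lambda>x. 1 - \<theta> x)"
    using C1_on_linear[OF open_UNIV C1_on_const[of UNIV 1] t(1), of "-1"] by simp
  show thesis
    by (rule that[of "\<lambda>j. if j = 1 then \<theta> else (\<lambda>x. 1 - \<theta> x)" "\<lambda>j. if j = 1 then U else V"])
      (use t t2 in \<open>auto simp: interface_partition_def\<close>)
qed

end

section \<open>Uniqueness for the transmission problems\<close>

context layers begin

text \<open>The cut-off vanishes near the boundary \<open>G\<close> of \<open>E\<close>, so that \<open>\<zeta> \<partial>\<^sub>tw\<close> has compact support in \<open>E\<close>. It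
  serves for the part of a cut-off of a two-layered field that belongs to the other interface.\<close>

lemma green_away_from_interface:
  assumes E: "open E" "closure E \<subseteq> E \<union> G" and w: "wave_solution E c w" and s: "0 < s"
    and \<zeta>: "C1_on UNIV \<zeta>" "\<And>x. x \<notin> cball 0 R \<Longrightarrow> \<zeta> x = 0"
    and U: "open U" "G \<inter> cball 0 R \<subseteq> U" "\<And>x. x \<in> U \<Longrightarrow> \<zeta> x = 0"
  shows "green E w s (\<lambda>x. \<zeta> x * dt w (x, s)) = 0"
proof (rule green_interior_support[OF E(1) wave_solutionD(1)[OF w] s])
  show "C1_on E (\<lambda>x. \<zeta> x * dt w (x, s))"
    by (rule C1_on_mult[OF C1_on_subset[OF \<zeta>(1)] space_slice_C1[OF wave_solution_C1(2)[OF w] s]]) simp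
  have "compact (cball 0 R \<inter> (closure E - U))"
    using U(1) by (intro compact_Int_closed closed_Diff) auto
  moreover have "(cball 0 R - U) \<inter> closure E = cball 0 R \<inter> (closure E - U)" by blast
  ultimately show "compact ((cball 0 R - U) \<inter> closure E)" by (simp only:)
  show "(cball 0 R - U) \<inter> closure E \<subseteq> E" using E(2) U(2) by blast
  fix x i assume x: "x \<in> E - (cball 0 R - U) \<inter> closure E"
  then have "x \<notin> cball 0 R \<or> x \<in> U" using closure_subset[of E] by blast
  then show "\<zeta> x * dt w (x, s) * dx i w (x, s) = 0" using \<zeta>(2) U(3) by auto
qed

lemma green_restrict:
  assumes E: "open E" and w: "wave_solution E c w" and c: "c > 0" and s: "s > 0"
    and O: "open A" and \<zeta>: "C1_on UNIV \<zeta>" "compact F" "F \<subseteq> A" "\<And>x. x \<notin> F \<Longrightarrow> \<zeta> x = 0"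
  shows "green E w s (\<lambda>x. \<zeta> x * dt w (x, s)) = green (E \<inter> A) w s (\<lambda>x. \<zeta> x * dt w (x, s))"
proof -
  obtain R where "F \<subseteq> cball 0 R" using compact_in_cball[OF \<zeta>(2)] .
  then have R: "\<zeta> x = 0" if "x \<notin> cball 0 R" for x using \<zeta>(4) that by blast
  let ?\<phi> = "\<lambda>x. \<zeta> x * dt w (x, s)"
  let ?g = "\<lambda>x. laplacian w (x, s) * ?\<phi> x + (\<Sum>i\<in>UNIV. dx i w (x, s) * partial (axis i 1) ?\<phi> x)"
  have adm: "admissible E ?\<phi>" by (rule admissible_cutoff_velocity[OF E w s \<zeta>(1) R])
  have int: "set_integrable lborel E ?g" by (rule green_integrable[OF E w c s adm])
  have int': "set_integrable lborel (E \<inter> A) ?g"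
    by (rule set_integrable_subset[OF int]) (use E O in auto)
  have z: "?g x = 0" if x: "x \<in> E - A" for x
  proof -
    have xF: "x \<in> E - F" using x \<zeta>(3) by blast
    have "partial (axis i 1) ?\<phi> x = 0" for i
      by (rule partial_zero_outside[OF E compact_imp_closed[OF \<zeta>(2)] _ xF]) (simp add: \<zeta>(4))
    then show ?thesis using \<zeta>(4) xF by simp
  qed
  show ?thesis unfolding green_def by (rule set_integrable_zero_off(2)[OF int' z])
qed

lemma closure_side: "j \<in> {1, 2} \<Longrightarrow> closure (above (\<Gamma> j)) \<subseteq> above (\<Gamma> j) \<union> \<Gamma> j"
  "j \<in> {1, 2} \<Longrightarrow> closure (below (\<Gamma> j)) \<subseteq> below (\<Gamma> j) \<union> \<Gamma> j"
proof -
  assume j: "j \<in> {1, 2}"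
  note f = sides[OF j]
  have "above (\<Gamma> j) \<union> \<Gamma> j = - below (\<Gamma> j)" "below (\<Gamma> j) \<union> \<Gamma> j = - above (\<Gamma> j)"
    using f(3,4) by blast+
  then have "closed (above (\<Gamma> j) \<union> \<Gamma> j)" "closed (below (\<Gamma> j) \<union> \<Gamma> j)" using f(1,2) by (simp_all add: closed_def)
  then show "closure (above (\<Gamma> j)) \<subseteq> above (\<Gamma> j) \<union> \<Gamma> j" "closure (below (\<Gamma> j)) \<subseteq> below (\<Gamma> j) \<union> \<Gamma> j"
    using closure_minimal[OF Un_upper1] by blast+
qed

text \<open>The neighbourhood \<open>U (3 - j)\<close>, where \<open>\<theta> j\<close> vanishes, contains the part of the ball that is not in
  \<open>around j\<close>. So \<open>\<theta> j \<eta>\<close> may be used as the cut-off in \<open>glued_flux\<close>, and near \<open>\<Gamma> j\<close> the other part of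
  \<open>\<eta>\<close> vanishes.\<close>

lemma partition_support:
  assumes j: "j \<in> {1, 2}"
    and part: "interface_partition R \<theta> U"
    and \<eta>: "\<forall>x. x \<notin> cball 0 R \<longrightarrow> \<eta> x = (0::real)"
  shows "compact (cball 0 R - U (3 - j))" "cball 0 R - U (3 - j) \<subseteq> around j"
    "\<And>x. x \<notin> cball 0 R - U (3 - j) \<Longrightarrow> \<theta> j x * \<eta> x = 0"
    "\<Gamma> j \<inter> cball 0 R \<subseteq> U j" "\<And>x. x \<in> U j \<Longrightarrow> \<theta> (3 - j) x = 0"
proof -
  have j': "3 - j \<in> {1, 2}" using j by auto
  have U: "\<And>j. j \<in> {1, 2} \<Longrightarrow> open (U j)" "(above (\<Gamma> 1) \<union> \<Gamma> 1) \<inter> cball 0 R \<subseteq> U 1"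
      "(below (\<Gamma> 2) \<union> \<Gamma> 2) \<inter> cball 0 R \<subseteq> U 2" "\<And>j x. j \<in> {1, 2} \<Longrightarrow> x \<in> U j \<Longrightarrow> \<theta> j x = 1"
    and \<theta>: "\<theta> 1 x + \<theta> 2 x = 1" for x
    using part unfolding interface_partition_def by blast+
  show "compact (cball 0 R - U (3 - j))" by (rule compact_diff[OF compact_cball U(1)[OF j']])
  have 1: "1 \<in> {1, 2::nat}" and 2: "2 \<in> {1, 2::nat}" by auto
  have "- around 1 = below (\<Gamma> 2) \<union> \<Gamma> 2" "- around 2 = above (\<Gamma> 1) \<union> \<Gamma> 1"
    unfolding around_eq using sides(3,4)[OF 1] sides(3,4)[OF 2] by blast+
  then have "cball 0 R - U 2 \<subseteq> around 1" "cball 0 R - U 1 \<subseteq> around 2" using U(2,3) by blast+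
  then show "cball 0 R - U (3 - j) \<subseteq> around j" using j by auto
  have t: "\<theta> j x = 1 - \<theta> (3 - j) x" "\<theta> (3 - j) x = 1 - \<theta> j x" for x
    using \<theta>[of x] j by auto
  show "\<theta> j x * \<eta> x = 0" if "x \<notin> cball 0 R - U (3 - j)" for x
    using that \<eta> U(4)[OF j', of x] t(1)[of x] by auto
  show "\<Gamma> j \<inter> cball 0 R \<subseteq> U j" using j U(2,3) by auto
  show "\<theta> (3 - j) x = 0" if "x \<in> U j" for x using U(4)[OF j that] t(2)[of x] by simp
qed

text \<open>The cut-off is split as \<open>\<eta> = \<theta> j \<eta> + \<theta> (3 - j) \<eta>\<close>. The first part gives cancelling fluxes by
  the transmission conditions on \<open>\<Gamma> j\<close>; the second part vanishes near \<open>\<Gamma> j\<close>, and the other interface is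
  an interior curve for the two-layered problem, so it gives none. The split is needed because the
  test functions for \<open>\<Gamma> j\<close> have to stay away from the other interface.\<close>

lemma two_layer_uniqueness:
  assumes j: "j \<in> {1, 2}" and pos: "\<forall>j\<in>{1, 2, 3}. c j > 0 \<and> \<rho> j > 0"
    and sol: "two_layer_solution \<Gamma> c \<rho> j f g v_up v_low"
    and f: "\<And>x t. x \<in> \<Gamma> j \<Longrightarrow> 0 < t \<Longrightarrow> t < T \<Longrightarrow> f (x, t) = 0"
    and g: "\<And>\<phi> t. \<phi> \<in> test_functions \<Gamma> j \<Longrightarrow> 0 < t \<Longrightarrow> t < T \<Longrightarrow> g t \<phi> = 0"
  shows "\<And>x t. x \<in> above (\<Gamma> j) \<Longrightarrow> 0 \<le> t \<Longrightarrow> t \<le> T \<Longrightarrow> v_up (x, t) = 0"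
    "\<And>x t. x \<in> below (\<Gamma> j) \<Longrightarrow> 0 \<le> t \<Longrightarrow> t \<le> T \<Longrightarrow> v_low (x, t) = 0"
proof -
  define D where "D k = (if k = j then above (\<Gamma> j) else below (\<Gamma> j))" for k
  define w where "w k = (if k = j then v_up else v_low)" for k
  let ?C = "max (c j) (c (j + 1))"
  have cp: "c j > 0" "c (j + 1) > 0" "\<rho> j > 0" "\<rho> (j + 1) > 0" using pos j by (auto simp: eval_nat_numeral)
  have up: "wave_solution (above (\<Gamma> j)) (c j) v_up" and low: "wave_solution (below (\<Gamma> j)) (c (j + 1)) v_low"
    and tr: "transmission \<Gamma> \<rho> j f g v_up v_low"
    using sol unfolding two_layer_solution_def by auto
  note S = sides[OF j] and LS = layer_side[OF j]
  have key: "w k (x, t) = 0" if k: "k \<in> {j, j + 1}" and x: "x \<in> D k" and t: "0 \<le> t" "t \<le> T" for k x t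
  proof -
    \<comment> \<open>Any \<open>r > ?C * t\<close> keeps the point \<open>(x, t)\<close> inside the cone.\<close>
    define r where "r = ?C * t + 1"
    show ?thesis
    proof (rule energy_uniqueness[of "{j, j + 1}" D c w ?C "\<lambda>k. 1 / \<rho> k" t r x k x t])
      show "open (D k) \<and> wave_solution (D k) (c k) (w k) \<and> 0 < c k \<and> c k \<le> ?C \<and> 0 < 1 / \<rho> k"
        if "k \<in> {j, j + 1}" for k
        using that S(1,2) up low cp by (auto simp: D_def w_def)
      fix s assume s: "0 < s" "s < t"
      then have sT: "s < T" using t by simp
      have Cs: "?C * s \<le> r"
        using s cp mult_left_mono[of s t ?C] unfolding r_def by linarith
      define R where "R = norm x + r"
      let ?\<eta> = "\<lambda>y. cone_cutoff x r ?C (y, s)"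
      have \<eta>0: "?\<eta> y = 0" if "y \<notin> cball 0 R" for y
        using cone_cutoff_support(1)[of ?C s r y x] that cp s Cs unfolding R_def by simp
      obtain \<theta> U where part: "interface_partition R \<theta> U" by (rule interface_partition_exists)
      then have \<theta>: "\<And>j. j \<in> {1, 2} \<Longrightarrow> C1_on UNIV (\<theta> j)" "\<And>x. \<theta> 1 x + \<theta> 2 x = 1"
        and U: "\<And>j. j \<in> {1, 2} \<Longrightarrow> open (U j)" "(above (\<Gamma> 1) \<union> \<Gamma> 1) \<inter> cball 0 R \<subseteq> U 1"
          "(below (\<Gamma> 2) \<union> \<Gamma> 2) \<inter> cball 0 R \<subseteq> U 2"
        unfolding interface_partition_def by blast+
      have \<eta>0': "\<forall>y. y \<notin> cball 0 R \<longrightarrow> ?\<eta> y = 0" using \<eta>0 by blast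
      note PS = partition_support[OF j part \<eta>0']
      have j': "3 - j \<in> {1, 2}" using j by auto
      let ?\<zeta> = "\<lambda>y. \<theta> j y * ?\<eta> y" and ?\<xi> = "\<lambda>y. \<theta> (3 - j) y * ?\<eta> y"
      have C1: "C1_on UNIV ?\<zeta>" "C1_on UNIV ?\<xi>"
        by (rule C1_on_mult[OF \<theta>(1)[OF j] cone_cutoff_C1], rule C1_on_mult[OF \<theta>(1)[OF j'] cone_cutoff_C1])
      have out: "?\<zeta> y = 0" "?\<xi> y = 0" if "y \<notin> cball 0 R" for y
        by (simp_all only: \<eta>0[OF that] mult_zero_right)
      have split: "?\<eta> y = ?\<zeta> y + ?\<xi> y" for y
      proof -
        have "\<theta> j y + \<theta> (3 - j) y = 1" using \<theta>(2)[of y] j by (auto simp: add.commute)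
        then show ?thesis by (metis distrib_right mult_1)
      qed
      have side: "green E v s (\<lambda>y. ?\<eta> y * dt v (y, s)) = green (E \<inter> around j) v s (\<lambda>y. ?\<zeta> y * dt v (y, s))"
        if E: "open E" "closure E \<subseteq> E \<union> \<Gamma> j" and v: "wave_solution E d v" and d: "0 < d" for E v d
      proof -
        have "green E v s (\<lambda>y. ?\<eta> y * dt v (y, s))
            = green E v s (\<lambda>y. ?\<zeta> y * dt v (y, s) + ?\<xi> y * dt v (y, s))"
          by (rule green_cong[OF E(1)]) (subst split, simp add: distrib_right)
        also have "\<dots> = green E v s (\<lambda>y. ?\<zeta> y * dt v (y, s)) + green E v s (\<lambda>y. ?\<xi> y * dt v (y, s))"
          by (rule green_add[OF E(1) v d s(1)])
            (rule admissible_cutoff_velocity[OF E(1) v s(1)], rule C1, erule out)+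
        also have "green E v s (\<lambda>y. ?\<xi> y * dt v (y, s)) = 0"
        proof (rule green_away_from_interface[OF E v s(1) C1(2) out(2) U(1)[OF j] PS(4)])
          show "?\<xi> y = 0" if "y \<in> U j" for y
            by (simp only: PS(5)[OF that] mult_zero_left)
        qed
        also have "green E v s (\<lambda>y. ?\<zeta> y * dt v (y, s)) = green (E \<inter> around j) v s (\<lambda>y. ?\<zeta> y * dt v (y, s))"
          by (rule green_restrict[OF E(1) v d s(1) open_around[OF j] C1(1) PS(1,2)]) (rule PS(3))
        finally show ?thesis by simp
      qed
      have "green (layer \<Gamma> j) v_up s (\<lambda>y. ?\<zeta> y * dt v_up (y, s)) / \<rho> j
          + green (layer \<Gamma> (j + 1)) v_low s (\<lambda>y. ?\<zeta> y * dt v_low (y, s)) / \<rho> (j + 1) = 0"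
      proof (rule glued_flux[OF j _ _ _ _ s(1) sT C1(1) PS(1,2)])
        show "wave_solution (layer \<Gamma> j) (c j) v_up"
          by (rule wave_solution_subset[OF up open_layer]) (use LS(1) in blast)
        show "wave_solution (layer \<Gamma> (j + 1)) (c (j + 1)) v_low"
          by (rule wave_solution_subset[OF low open_layer]) (use LS(2) in blast)
        show "v_low (y, s) = v_up (y, s)" if "y \<in> \<Gamma> j" "0 < s" "s < T" for y s
          using tr f[OF that] that unfolding transmission_def by force
        show "normal_deriv \<Gamma> j (j + 1) v_low s \<phi> / \<rho> (j + 1) - normal_deriv \<Gamma> j j v_up s \<phi> / \<rho> j = 0"
          if "\<phi> \<in> test_functions \<Gamma> j" for \<phi>
          using tr that s(1) g[OF that s(1) sT] unfolding transmission_def by metis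
        show "?\<zeta> y = 0" if "y \<notin> cball 0 R - U (3 - j)" for y by (rule PS(3)[OF that])
      qed
      moreover have "green (above (\<Gamma> j)) v_up s (\<lambda>y. ?\<eta> y * dt v_up (y, s))
          = green (layer \<Gamma> j) v_up s (\<lambda>y. ?\<zeta> y * dt v_up (y, s))"
        using side[OF S(1) closure_side(1)[OF j] up cp(1)] LS(1) by simp
      moreover have "green (below (\<Gamma> j)) v_low s (\<lambda>y. ?\<eta> y * dt v_low (y, s))
          = green (layer \<Gamma> (j + 1)) v_low s (\<lambda>y. ?\<zeta> y * dt v_low (y, s))"
        using side[OF S(2) closure_side(2)[OF j] low cp(2)] LS(2) by simp
      ultimately show "(\<Sum>k\<in>{j, j + 1}. 1 / \<rho> k * green (D k) (w k) s (\<lambda>y. cone_cutoff x r ?C (y, s) * dt (w k) (y, s))) \<le> 0"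
        by (simp add: D_def w_def)
    qed (use k x t cp in \<open>auto simp: r_def\<close>)
  qed
  show "v_up (x, t) = 0" if "x \<in> above (\<Gamma> j)" "0 \<le> t" "t \<le> T" for x t
    using key[of j x t] that by (simp add: D_def w_def)
  show "v_low (x, t) = 0" if "x \<in> below (\<Gamma> j)" "0 \<le> t" "t \<le> T" for x t
    using key[of "j + 1" x t] that by (simp add: D_def w_def)
qed

text \<open>The same splitting, but now both parts of the cut-off meet an interface with cancelling fluxes:
  \<open>\<theta> j \<eta>\<close> vanishes in the layer that is not adjacent to \<open>\<Gamma> j\<close> and is a cut-off for the pair of layers
  \<open>j\<close> and \<open>j + 1\<close>.\<close>

lemma three_layer_uniqueness:
  assumes pos: "\<forall>j\<in>{1, 2, 3}. c j > 0 \<and> \<rho> j > 0"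
    and w: "\<And>k. k \<in> {1, 2, 3} \<Longrightarrow> wave_solution (layer \<Gamma> k) (c k) (w k)"
    and trace: "\<And>j x t. j \<in> {1, 2} \<Longrightarrow> x \<in> \<Gamma> j \<Longrightarrow> 0 < t \<Longrightarrow> t < T \<Longrightarrow> w (j + 1) (x, t) = w j (x, t)"
    and flux: "\<And>j \<phi> t. j \<in> {1, 2} \<Longrightarrow> \<phi> \<in> test_functions \<Gamma> j \<Longrightarrow> 0 < t \<Longrightarrow> t < T \<Longrightarrow>
      normal_deriv \<Gamma> j (j + 1) (w (j + 1)) t \<phi> / \<rho> (j + 1) - normal_deriv \<Gamma> j j (w j) t \<phi> / \<rho> j = 0"
    and k: "k \<in> {1, 2, 3}" and x: "x \<in> layer \<Gamma> k" and t: "0 \<le> t" "t \<le> T"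
  shows "w k (x, t) = 0"
proof -
  let ?C = "max (c 1) (max (c 2) (c 3))"
  have cp: "c 1 > 0" "c 2 > 0" "c 3 > 0" "\<rho> 1 > 0" "\<rho> 2 > 0" "\<rho> 3 > 0" using pos by auto
  define r where "r = ?C * t + 1"
  show ?thesis
  proof (rule energy_uniqueness[of "{1, 2, 3}" "layer \<Gamma>" c w ?C "\<lambda>k. 1 / \<rho> k" t r x k x t])
    show "open (layer \<Gamma> k) \<and> wave_solution (layer \<Gamma> k) (c k) (w k) \<and> 0 < c k \<and> c k \<le> ?C \<and> 0 < 1 / \<rho> k"
      if "k \<in> {1, 2, 3}" for k
      using that open_layer w[OF that] cp by auto
    fix s assume s: "0 < s" "s < t"
    then have sT: "s < T" using t by simp
    have Cs: "?C * s \<le> r"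
      using s cp mult_left_mono[of s t ?C] unfolding r_def by linarith
    define R where "R = norm x + r"
    let ?\<eta> = "\<lambda>y. cone_cutoff x r ?C (y, s)"
    have \<eta>0: "?\<eta> y = 0" if "y \<notin> cball 0 R" for y
      using cone_cutoff_support(1)[of ?C s r y x] that cp s Cs unfolding R_def by simp
    obtain \<theta> U where part: "interface_partition R \<theta> U" by (rule interface_partition_exists)
    then have \<theta>: "\<And>j. j \<in> {1, 2} \<Longrightarrow> C1_on UNIV (\<theta> j)" "\<And>x. \<theta> 1 x + \<theta> 2 x = 1"
      and U: "\<And>j. j \<in> {1, 2} \<Longrightarrow> open (U j)" "(above (\<Gamma> 1) \<union> \<Gamma> 1) \<inter> cball 0 R \<subseteq> U 1"
        "(below (\<Gamma> 2) \<union> \<Gamma> 2) \<inter> cball 0 R \<subseteq> U 2"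
      unfolding interface_partition_def by blast+
    have \<eta>0': "\<forall>y. y \<notin> cball 0 R \<longrightarrow> ?\<eta> y = 0" using \<eta>0 by blast
    have j1: "1 \<in> {1, 2::nat}" and j2: "2 \<in> {1, 2::nat}" by auto
    define \<zeta> where "\<zeta> j y = \<theta> j y * ?\<eta> y" for j y
    have C1: "C1_on UNIV (\<zeta> j)" if "j \<in> {1, 2}" for j
      unfolding \<zeta>_def by (intro C1_on_mult \<theta>(1) cone_cutoff_C1 that)
    have out: "\<zeta> j y = 0" if "y \<notin> cball 0 R" for j y
      by (simp only: \<zeta>_def \<eta>0[OF that] mult_zero_right)
    have split: "?\<eta> y = \<zeta> 1 y + \<zeta> 2 y" for y
      unfolding \<zeta>_def using \<theta>(2)[of y] by (metis distrib_right mult_1)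
    define G where "G j k = green (layer \<Gamma> k) (w k) s (\<lambda>y. \<zeta> j y * dt (w k) (y, s))" for j k
    have G: "green (layer \<Gamma> k) (w k) s (\<lambda>y. ?\<eta> y * dt (w k) (y, s)) = G 1 k + G 2 k" if k: "k \<in> {1, 2, 3}" for k
    proof -
      have ck: "c k > 0" using pos k by blast
      have "green (layer \<Gamma> k) (w k) s (\<lambda>y. ?\<eta> y * dt (w k) (y, s))
          = green (layer \<Gamma> k) (w k) s (\<lambda>y. \<zeta> 1 y * dt (w k) (y, s) + \<zeta> 2 y * dt (w k) (y, s))"
        by (rule green_cong[OF open_layer]) (subst split, simp add: distrib_right)
      also have "\<dots> = G 1 k + G 2 k"
        unfolding G_def
      proof (rule green_add[OF open_layer w[OF k] ck s(1)])
        have "admissible (layer \<Gamma> k) (\<lambda>y. \<zeta> j y * dt (w k) (y, s))" if "j \<in> {1, 2}" for j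
          by (rule admissible_cutoff_velocity[OF open_layer w[OF k] s(1) C1[OF that] out])
        from this[OF j1] this[OF j2]
        show "admissible (layer \<Gamma> k) (\<lambda>y. \<zeta> 1 y * dt (w k) (y, s))"
          "admissible (layer \<Gamma> k) (\<lambda>y. \<zeta> 2 y * dt (w k) (y, s))" .
      qed
      finally show ?thesis .
    qed
    have pair: "G j j / \<rho> j + G j (j + 1) / \<rho> (j + 1) = 0" if j: "j \<in> {1, 2}" for j
    proof -
      note PS = partition_support[OF j part \<eta>0']
      have k: "j \<in> {1, 2, 3}" "j + 1 \<in> {1, 2, 3}" using j by auto
      have "\<zeta> j y = 0" if "y \<notin> cball 0 R - U (3 - j)" for y
        unfolding \<zeta>_def by (rule PS(3)[OF that])
      then show ?thesis
        unfolding G_def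
        by (intro glued_flux[OF j w[OF k(1)] w[OF k(2)] trace[OF j] flux[OF j _ s(1) sT] s(1) sT C1[OF j] PS(1,2)])
    qed
    have "\<theta> 2 y * ?\<eta> y = 0" if "y \<in> layer \<Gamma> 1" for y
      using that U(2) \<eta>0[of y] partition_support(5)[OF j1 part \<eta>0', of y]
      by (cases "y \<in> cball 0 R") (auto simp: layer_simps)
    then have z1: "G 2 1 = 0" unfolding G_def \<zeta>_def by (intro green_zero_test[OF open_layer]) simp
    have "\<theta> 1 y * ?\<eta> y = 0" if "y \<in> layer \<Gamma> 3" for y
      using that U(3) \<eta>0[of y] partition_support(5)[OF j2 part \<eta>0', of y]
      by (cases "y \<in> cball 0 R") (auto simp: layer_simps)
    then have z3: "G 1 3 = 0" unfolding G_def \<zeta>_def by (intro green_zero_test[OF open_layer]) simp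
    have "(\<Sum>k\<in>{1, 2, 3}. 1 / \<rho> k * (G 1 k + G 2 k))
        = (G 1 1 / \<rho> 1 + G 1 2 / \<rho> 2) + (G 2 2 / \<rho> 2 + G 2 3 / \<rho> 3)"
      using z1 z3 by (simp add: add_divide_distrib)
    also have "\<dots> = 0" using pair[OF j1] pair[OF j2] by (simp add: numeral_eq_Suc)
    finally show "(\<Sum>k\<in>{1, 2, 3}. 1 / \<rho> k * green (layer \<Gamma> k) (w k) s (\<lambda>y. cone_cutoff x r ?C (y, s) * dt (w k) (y, s))) \<le> 0"
      using G by simp
  qed (use k x t cp in \<open>auto simp: r_def\<close>)
qed

end

section \<open>Superposition of solutions\<close>

lemma square_integrable_lincomb:
  fixes f g :: "'a::euclidean_space \<Rightarrow> real"
  assumes A: "open A" and c: "continuous_on A f" "continuous_on A g"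
    and f: "set_integrable lborel A (\<lambda>x. (f x)\<^sup>2)" "(LINT x:A|lborel. (f x)\<^sup>2) \<le> C"
    and g: "set_integrable lborel A (\<lambda>x. (g x)\<^sup>2)" "(LINT x:A|lborel. (g x)\<^sup>2) \<le> C'"
  shows "set_integrable lborel A (\<lambda>x. (f x + a * g x)\<^sup>2)"
    "(LINT x:A|lborel. (f x + a * g x)\<^sup>2) \<le> 2 * C + 2 * a\<^sup>2 * C'"
proof -
  let ?h = "\<lambda>x. 2 * (f x)\<^sup>2 + 2 * a\<^sup>2 * (g x)\<^sup>2"
  have le: "(f x + a * g x)\<^sup>2 \<le> ?h x" for x
    using zero_le_power2[of "f x - a * g x"] by (simp add: power2_sum power2_diff power_mult_distrib)
  have i: "set_integrable lborel A (\<lambda>x. 2 * (f x)\<^sup>2)" "set_integrable lborel A (\<lambda>x. 2 * a\<^sup>2 * (g x)\<^sup>2)"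
    using f(1) g(1) by (auto intro!: set_integrable_mult_right)
  have h: "set_integrable lborel A ?h" by (rule set_integral_add(1)[OF i])
  show int: "set_integrable lborel A (\<lambda>x. (f x + a * g x)\<^sup>2)"
    by (rule set_integrable_dominated[OF A _ h]) (use c le in \<open>auto intro!: continuous_intros\<close>)
  have "(LINT x:A|lborel. (f x + a * g x)\<^sup>2) \<le> (LINT x:A|lborel. ?h x)"
    by (rule set_integral_mono[OF int h le])
  also have "\<dots> = 2 * (LINT x:A|lborel. (f x)\<^sup>2) + 2 * a\<^sup>2 * (LINT x:A|lborel. (g x)\<^sup>2)"
    unfolding set_integral_add(2)[OF i] set_integral_mult_right ..
  also have "\<dots> \<le> 2 * C + 2 * a\<^sup>2 * C'"
    using f(2) g(2) by (intro add_mono mult_left_mono) auto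
  finally show "(LINT x:A|lborel. (f x + a * g x)\<^sup>2) \<le> 2 * C + 2 * a\<^sup>2 * C'" .
qed

lemma wave_solution_lincomb:
  assumes D: "open D" and u: "wave_solution D c u" "wave_solution D c v"
  shows "wave_solution D c (\<lambda>p. u p + a * v p)"
proof -
  let ?S = "D \<times> {0::real<..}" and ?w = "\<lambda>p. u p + a * v p"
  have S: "open ?S" using D by (intro open_Times) auto
  note L = field_derivatives_lincomb[OF D u]
  have ext: "\<exists>w. continuous_on B w \<and> (\<forall>p\<in>?S. w p = P p)"
    if e: "\<exists>w. continuous_on B w \<and> (\<forall>p\<in>?S. w p = Q p)" "\<exists>w. continuous_on B w \<and> (\<forall>p\<in>?S. w p = Q' p)"
      and PQ: "\<And>p. p \<in> ?S \<Longrightarrow> P p = Q p + a * Q' p" for B and P Q Q' :: field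
  proof -
    obtain w1 w2 where "continuous_on B w1" "\<forall>p\<in>?S. w1 p = Q p" "continuous_on B w2" "\<forall>p\<in>?S. w2 p = Q' p"
      using e by blast
    then show ?thesis
      using PQ by (intro exI[of _ "\<lambda>p. w1 p + a * w2 p"]) (auto intro!: continuous_intros)
  qed
  have bound: "\<exists>C. \<forall>t\<in>{0<..T}. \<forall>q\<in>energy_fields ?w.
          set_integrable lborel (D \<inter> ball 0 R) (\<lambda>x. (q (x, t))\<^sup>2) \<and>
          (LINT x:D \<inter> ball 0 R|lborel. (q (x, t))\<^sup>2) \<le> C" for R T
  proof -
    let ?A = "D \<inter> ball 0 R"
    obtain C where C:
      "\<And>t q. 0 < t \<Longrightarrow> t \<le> T \<Longrightarrow> q \<in> energy_fields u \<Longrightarrow> set_integrable lborel ?A (\<lambda>x. (q (x, t))\<^sup>2)"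
      "\<And>t q. 0 < t \<Longrightarrow> t \<le> T \<Longrightarrow> q \<in> energy_fields u \<Longrightarrow> (LINT x:?A|lborel. (q (x, t))\<^sup>2) \<le> C"
      by (rule wave_solution_energy_bound[OF u(1)]) (rule that)
    obtain C' where C':
      "\<And>t q. 0 < t \<Longrightarrow> t \<le> T \<Longrightarrow> q \<in> energy_fields v \<Longrightarrow> set_integrable lborel ?A (\<lambda>x. (q (x, t))\<^sup>2)"
      "\<And>t q. 0 < t \<Longrightarrow> t \<le> T \<Longrightarrow> q \<in> energy_fields v \<Longrightarrow> (LINT x:?A|lborel. (q (x, t))\<^sup>2) \<le> C'"
      by (rule wave_solution_energy_bound[OF u(2)]) (rule that)
    show ?thesis
    proof (intro exI[of _ "2 * C + 2 * a\<^sup>2 * C'"] ballI)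
      fix t q assume "t \<in> {0<..T}" and q: "q \<in> energy_fields ?w"
      then have t: "0 < t" "t \<le> T" by auto
      have A: "open ?A" using D by auto
      have step: "set_integrable lborel ?A (\<lambda>x. (q (x, t))\<^sup>2) \<and>
          (LINT x:?A|lborel. (q (x, t))\<^sup>2) \<le> 2 * C + 2 * a\<^sup>2 * C'"
        if q1: "q1 \<in> energy_fields u" and q2: "q2 \<in> energy_fields v"
          and qq: "\<And>p. p \<in> ?S \<Longrightarrow> q p = q1 p + a * q2 p" for q1 q2
      proof -
        have "continuous_on ?S q1" using q1 jet_continuous[OF u(1)] unfolding energy_fields_def by blast
        moreover have "continuous_on ?S q2" using q2 jet_continuous[OF u(2)] unfolding energy_fields_def by blast
        ultimately have c: "continuous_on ?A (\<lambda>x. q1 (x, t))" "continuous_on ?A (\<lambda>x. q2 (x, t))"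
          using t by (auto intro!: continuous_on_subset[OF continuous_on_cross(2), of D "{0<..}"])
        have eq: "q (x, t) = q1 (x, t) + a * q2 (x, t)" if "x \<in> ?A" for x
          using qq[of "(x, t)"] that t by auto
        have "set_integrable lborel ?A (\<lambda>x. (q (x, t))\<^sup>2) \<longleftrightarrow>
            set_integrable lborel ?A (\<lambda>x. (q1 (x, t) + a * q2 (x, t))\<^sup>2)"
          "(LINT x:?A|lborel. (q (x, t))\<^sup>2) = (LINT x:?A|lborel. (q1 (x, t) + a * q2 (x, t))\<^sup>2)"
        proof -
          have eq2: "(q (x, t))\<^sup>2 = (q1 (x, t) + a * q2 (x, t))\<^sup>2" if "x \<in> ?A" for x
            by (simp only: eq[OF that])
          show "set_integrable lborel ?A (\<lambda>x. (q (x, t))\<^sup>2) \<longleftrightarrow>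
            set_integrable lborel ?A (\<lambda>x. (q1 (x, t) + a * q2 (x, t))\<^sup>2)"
            by (rule set_integrable_cong[OF refl refl eq2])
          show "(LINT x:?A|lborel. (q (x, t))\<^sup>2) = (LINT x:?A|lborel. (q1 (x, t) + a * q2 (x, t))\<^sup>2)"
            by (rule set_lebesgue_integral_cong) (use A eq2 in auto)
        qed
        moreover note square_integrable_lincomb[OF A c C(1)[OF t q1] C(2)[OF t q1] C'(1)[OF t q2] C'(2)[OF t q2], of a]
        ultimately show ?thesis by simp
      qed
      consider "q = dt ?w" | "q = dt (dt ?w)" | i where "q = dx i ?w" | i where "q = dx i (dt ?w)"
        using q unfolding energy_fields_def by blast
      then show "set_integrable lborel ?A (\<lambda>x. (q (x, t))\<^sup>2) \<and>
          (LINT x:?A|lborel. (q (x, t))\<^sup>2) \<le> 2 * C + 2 * a\<^sup>2 * C'"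
      proof cases
        case 1 show ?thesis by (rule step[of "dt u" "dt v"]) (use 1 L(1) in \<open>auto simp: energy_fields_def\<close>)
      next
        case 2 show ?thesis by (rule step[of "dt (dt u)" "dt (dt v)"]) (use 2 L(3) in \<open>auto simp: energy_fields_def\<close>)
      next
        case (3 i) show ?thesis by (rule step[of "dx i u" "dx i v"]) (use 3 L(2) in \<open>auto simp: energy_fields_def\<close>)
      next
        case (4 i) show ?thesis by (rule step[of "dx i (dt u)" "dx i (dt v)"]) (use 4 L(4) in \<open>auto simp: energy_fields_def\<close>)
      qed
    qed
  qed
  have "Ck_on 2 ?S ?w" by (rule Ck_on_linear[OF S wave_solutionD(1)[OF u(1)] wave_solutionD(1)[OF u(2)]])
  moreover have "continuous_on (closure D \<times> {0..}) ?w"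
    by (intro continuous_intros wave_solutionD(2)[OF u(1)] wave_solutionD(2)[OF u(2)])
  moreover have "\<exists>w. continuous_on (closure D \<times> {0..}) w \<and> (\<forall>p\<in>?S. w p = dt ?w p)"
    by (rule ext[OF wave_solutionD(3)[OF u(1)] wave_solutionD(3)[OF u(2)] L(1)])
  moreover have "\<exists>w. continuous_on (D \<times> {0..}) w \<and> (\<forall>p\<in>?S. w p = dx i ?w p)" for i
    by (rule ext[OF wave_solutionD(4)[OF u(1)] wave_solutionD(4)[OF u(2)] L(2)])
  ultimately have "solution_class D ?w"
    using bound unfolding solution_class_def energy_fields_def by blast
  moreover have "dt (dt ?w) p - c\<^sup>2 * laplacian ?w p = 0" if pS: "p \<in> ?S" for p
  proof -
    obtain x t where p: "p = (x, t)" "x \<in> D" "t > 0" using pS by (cases p) auto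
    show ?thesis
      unfolding L(3)[OF pS] L(5)[OF pS]
      using wave_solutionD(5)[OF u(1) p(2,3)] wave_solutionD(5)[OF u(2) p(2,3)] p(1) by (simp add: algebra_simps)
  qed
  moreover have "?w (x, 0) = 0 \<and> ((\<lambda>t. ?w (x, t)) has_real_derivative 0) (at 0 within {0..})"
    if "x \<in> D" for x
    using wave_solutionD(6)[OF u(1) that] wave_solutionD(6)[OF u(2) that]
      DERIV_add[OF wave_solutionD(7)[OF u(1) that] DERIV_cmult[OF wave_solutionD(7)[OF u(2) that], of a]]
    by simp
  ultimately show ?thesis unfolding wave_solution_def by blast
qed

lemma wave_solution_zero:
  assumes "open D" "wave_solution D c u"
  shows "wave_solution D c (\<lambda>_. 0)"
  using wave_solution_lincomb[OF assms(1,2,2), of "-1"] by simp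

lemma green_zero_field: "green D (\<lambda>_. 0) t \<phi> = 0"
proof -
  have "dx i (\<lambda>_. 0) = (\<lambda>_. 0)" for i by (rule ext) (rule partial_zero_fun)
  then show ?thesis by (simp add: green_def laplacian_def set_lebesgue_integral_def)
qed

section \<open>Travel time between the interfaces\<close>

context layers begin

lemma normal_deriv_lincomb:
  assumes "\<phi> \<in> test_functions \<Gamma> j" "k = j \<or> k = j + 1" "t > 0" "d > 0"
    and "wave_solution (layer \<Gamma> k) d u" "wave_solution (layer \<Gamma> k) d v"
  shows "normal_deriv \<Gamma> j k (\<lambda>p. u p + a * v p) t \<phi>
    = normal_deriv \<Gamma> j k u t \<phi> + a * normal_deriv \<Gamma> j k v t \<phi>"
  using green_lincomb[OF open_layer assms(5,6,4,3) test_function_admissible[OF assms(1,2)], of a]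
  by (simp add: normal_deriv_green algebra_simps)

text \<open>The side of \<open>\<Gamma> J\<close> that contains the middle layer; both of these domains carry the wave speed
  \<open>c 2\<close> in the scattering scheme.\<close>

definition inner_side :: "nat \<Rightarrow> pt set" where
  "inner_side J = (if J = 1 then below (\<Gamma> 1) else above (\<Gamma> 2))"

lemma inner_side:
  assumes J: "J \<in> {1, 2}"
  shows "open (inner_side J)" "layer \<Gamma> 2 \<subseteq> inner_side J" "\<Gamma> (3 - J) \<subseteq> inner_side J"
    "x \<in> inner_side J \<Longrightarrow> ball x (infdist x (\<Gamma> J)) \<subseteq> inner_side J"
    "inner_side J = around (3 - J)" "inner_side J \<inter> \<Gamma> J = {}"
proof -
  have j1: "1 \<in> {1, 2::nat}" and j2: "2 \<in> {1, 2::nat}" by auto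
  note S1 = sides[OF j1] and S2 = sides[OF j2]
  show "open (inner_side J)" using S1(2) S2(1) by (simp add: inner_side_def)
  show "layer \<Gamma> 2 \<subseteq> inner_side J" unfolding layer_simps inner_side_def by auto
  show "\<Gamma> (3 - J) \<subseteq> inner_side J" using J nested by (auto simp: inner_side_def)
  show "inner_side J = around (3 - J)" using J around_eq by (auto simp: inner_side_def)
  have "below (\<Gamma> 1) \<inter> \<Gamma> 1 = {}" "above (\<Gamma> 2) \<inter> \<Gamma> 2 = {}" using S1(4) S2(4) by blast+
  then show "inner_side J \<inter> \<Gamma> J = {}" using J by (auto simp: inner_side_def)
  assume x: "x \<in> inner_side J"
  have dis: "ball x (infdist x (\<Gamma> J)) \<inter> \<Gamma> J = {}"
    using infdist_le[of _ "\<Gamma> J" x] by fastforce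
  show "ball x (infdist x (\<Gamma> J)) \<subseteq> inner_side J"
  proof (cases "infdist x (\<Gamma> J) > 0")
    case True
    consider "J = 1" | "J = 2" using J by auto
    then show ?thesis
    proof cases
      case 1
      have "below (\<Gamma> 1) \<inter> above (\<Gamma> 1) = {}" "- \<Gamma> 1 = below (\<Gamma> 1) \<union> above (\<Gamma> 1)"
        using S1(3,4) by blast+
      from ball_in_side[OF S1(2,1) this _ dis[unfolded 1] True[unfolded 1]] x show ?thesis
        by (simp add: inner_side_def 1)
    next
      case 2
      from ball_in_side[OF S2(1,2,3,4) _ dis[unfolded 2] True[unfolded 2]] x show ?thesis
        by (simp add: inner_side_def 2)
    qed
  next
    case False
    then have "ball x (infdist x (\<Gamma> J)) = {}" by (intro ball_empty) simp
    then show ?thesis by blast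
  qed
qed

lemma setdist_le_infdist:
  assumes "J \<in> {1, 2}" "x \<in> \<Gamma> (3 - J)"
  shows "setdist (\<Gamma> 1) (\<Gamma> 2) \<le> infdist x (\<Gamma> J)"
proof -
  have "setdist (\<Gamma> (3 - J)) (\<Gamma> J) \<le> setdist {x} (\<Gamma> J)"
    using assms(2) by (intro setdist_subset_left) auto
  moreover have "setdist (\<Gamma> (3 - J)) (\<Gamma> J) = setdist (\<Gamma> 1) (\<Gamma> 2)"
    using assms(1) setdist_sym by auto
  ultimately show ?thesis by (simp add: infdist_eq_setdist)
qed

text \<open>By the domain of dependence the wave vanishes at time \<open>t\<close> in the set \<open>N\<close> of points farther from
  \<open>\<Gamma> J\<close> than \<open>c (t - S)\<close>. This is a neighbourhood of the other interface, so the flux integrand has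
  compact support inside the middle layer, whatever the test function does at the interface.\<close>

lemma arrival_at_other_interface:
  assumes J: "J \<in> {1, 2}" and v: "wave_solution (inner_side J) c v" and c: "0 < c" and S: "0 \<le> S"
    and van: "\<forall>x\<in>inner_side J. \<forall>t. 0 < t \<and> t < S \<longrightarrow> v (x, t) = 0"
    and t: "0 < t" "t < S + setdist (\<Gamma> 1) (\<Gamma> 2) / c"
  shows "\<And>x. x \<in> \<Gamma> (3 - J) \<Longrightarrow> v (x, t) = 0"
    "\<And>\<phi>. \<phi> \<in> test_functions \<Gamma> (3 - J) \<Longrightarrow> normal_deriv \<Gamma> (3 - J) 2 v t \<phi> = 0"
proof -
  let ?E = "inner_side J"
  define N where "N = {x \<in> ?E. infdist x (\<Gamma> J) > max 0 (c * (t - S))}"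
  note E = inner_side[OF J]
  have "continuous_on UNIV (\<lambda>x. infdist x (\<Gamma> J))" by (intro continuous_intros)
  then have "open {x. infdist x (\<Gamma> J) > max 0 (c * (t - S))}" by (intro open_Collect_less) auto
  then have N: "open N" unfolding N_def using E(1) by (simp add: Collect_conj_eq open_Int)
  have zero: "v (x, t) = 0" if "x \<in> N" for x
    by (rule cone_vanishing[OF E(1) v c _ S _ E(4)]) (use that t van in \<open>auto simp: N_def\<close>)
  have ct: "c * (t - S) < setdist (\<Gamma> 1) (\<Gamma> 2)"
    using t(2) c by (simp add: field_simps)
  have dpos: "0 < setdist (\<Gamma> 1) (\<Gamma> 2)" using geometry unfolding layered_geometry_def by blast
  have sub: "\<Gamma> (3 - J) \<subseteq> N"
  proof
    fix x assume x: "x \<in> \<Gamma> (3 - J)"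
    then show "x \<in> N"
      using setdist_le_infdist[OF J x] ct dpos E(3) unfolding N_def by auto
  qed
  then show "v (x, t) = 0" if "x \<in> \<Gamma> (3 - J)" for x using zero that by blast
  fix \<phi> assume \<phi>: "\<phi> \<in> test_functions \<Gamma> (3 - J)"
  have k: "2 = 3 - J \<or> 2 = 3 - J + 1" using J by auto
  have sup: "compact (supp \<phi>)" "supp \<phi> \<subseteq> around (3 - J)"
    using \<phi> unfolding test_functions_def around_def by blast+
  have C1: "C1_on (layer \<Gamma> 2) \<phi>"
    using test_function_admissible[OF \<phi> k] unfolding admissible_def by blast
  have w2: "wave_solution (layer \<Gamma> 2) c v" by (rule wave_solution_subset[OF v open_layer E(2)])
  have "green (layer \<Gamma> 2) v t \<phi> = 0"
  proof (rule green_interior_support[OF open_layer wave_solutionD(1)[OF w2] t(1) C1])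
    have "compact (supp \<phi> \<inter> (closure (layer \<Gamma> 2) - N))"
      using sup(1) N by (intro compact_Int_closed closed_Diff) auto
    then show "compact (supp \<phi> \<inter> (closure (layer \<Gamma> 2) - N))" .
    have "closure (layer \<Gamma> 2) \<subseteq> closure (below (\<Gamma> 1)) \<inter> closure (above (\<Gamma> 2))"
      unfolding layer_simps by (simp add: closure_mono)
    then have "closure (layer \<Gamma> 2) \<subseteq> layer \<Gamma> 2 \<union> \<Gamma> 1 \<union> \<Gamma> 2"
      using closure_side(2)[of 1] closure_side(1)[of 2] unfolding layer_simps by blast
    then have "closure (layer \<Gamma> 2) \<subseteq> layer \<Gamma> 2 \<union> \<Gamma> J \<union> \<Gamma> (3 - J)" using J by auto
    moreover have "supp \<phi> \<inter> \<Gamma> J = {}" using sup(2) E(5,6) by blast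
    ultimately show "supp \<phi> \<inter> (closure (layer \<Gamma> 2) - N) \<subseteq> layer \<Gamma> 2" using sub by blast
    fix x i assume x: "x \<in> layer \<Gamma> 2 - supp \<phi> \<inter> (closure (layer \<Gamma> 2) - N)"
    show "\<phi> x * dx i v (x, t) = 0"
    proof (cases "x \<in> N")
      case True
      have "dx i v (x, t) = partial (axis i 1) (\<lambda>y. v (y, t)) x"
        using x by (intro space_slice(2)[symmetric] wave_solution_diff(1)[OF w2] t) auto
      also have "\<dots> = partial (axis i 1) (\<lambda>_. 0) x" by (rule partial_cong_open[OF N True zero])
      finally show ?thesis by (simp add: partial_zero_fun)
    next
      case False
      then have "x \<notin> supp \<phi>" using x closure_subset[of "layer \<Gamma> 2"] by blast
      then have "\<phi> x = 0" using closure_subset[of "{p. \<phi> p \<noteq> 0}"] unfolding supp_def by blast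
      then show ?thesis by simp
    qed
  qed
  then show "normal_deriv \<Gamma> (3 - J) 2 v t \<phi> = 0" by (simp add: normal_deriv_green)
qed

end

section \<open>Exactness of the scattering sums\<close>

lemma nat_half: "nat \<lceil>real M / 2\<rceil> = (M + 1) div 2" "nat \<lfloor>real M / 2\<rfloor> = M div 2"
proof -
  show "nat \<lfloor>real M / 2\<rfloor> = M div 2"
    using floor_divide_of_nat_eq[where 'a=real, of M 2] by simp
  show "nat \<lceil>real M / 2\<rceil> = (M + 1) div 2"
  proof (cases "even M")
    case True
    then obtain k where "M = 2 * k" by (rule evenE)
    then show ?thesis by simp
  next
    case False
    then obtain k where k: "M = 2 * k + 1" by (rule oddE)
    have "\<lceil>real M / 2\<rceil> = int (k + 1)" unfolding k by (rule ceiling_unique) auto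
    then show ?thesis by (simp add: k)
  qed
qed

lemma scattering_sum_Suc:
  "scattering_sum v_up v_low (Suc M) 1 p = scattering_sum v_up v_low M 1 p + (if odd (Suc M) then v_up (Suc M) p else 0)"
  "scattering_sum v_up v_low (Suc M) 2 p = scattering_sum v_up v_low M 2 p
     + (if odd (Suc M) then v_low (Suc M) p else v_up (Suc M) p)"
  "scattering_sum v_up v_low (Suc M) 3 p = scattering_sum v_up v_low M 3 p + (if even (Suc M) then v_low (Suc M) p else 0)"
  unfolding scattering_sum_def nat_half by (cases "even M"; auto elim!: evenE oddE)+

lemma scattering_sum_1:
  "scattering_sum v_up v_low 1 1 = v_up 1" "scattering_sum v_up v_low 1 2 = v_low 1"
  "scattering_sum v_up v_low 1 3 = (\<lambda>_. 0)"
  unfolding scattering_sum_def nat_half fun_eq_iff by auto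

locale scattering = layers +
  fixes c \<rho> :: "nat \<Rightarrow> real" and t0 :: real and f :: "nat \<Rightarrow> field" and g :: "nat \<Rightarrow> neumann"
    and v_up v_low :: "nat \<Rightarrow> field"
  assumes pos: "\<forall>j\<in>{1, 2, 3}. c j > 0 \<and> \<rho> j > 0" and t0: "t0 > 0"
    and quiet: "\<forall>j\<in>{1, 2}. \<forall>t\<in>{0<..t0}.
      (\<forall>x\<in>\<Gamma> j. f j (x, t) = 0) \<and> (\<forall>\<phi>\<in>test_functions \<Gamma> j. g j t \<phi> = 0)"
    and scat: "multiplicative_scattering \<Gamma> c \<rho> f g v_up v_low"
begin

lemma positive: "c 1 > 0" "c 2 > 0" "c 3 > 0" "\<rho> 1 > 0" "\<rho> 2 > 0" "\<rho> 3 > 0"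
  using pos by auto

lemma jp_cases: "jp m \<in> {1, 2}" "odd m \<Longrightarrow> jp m = 1" "even m \<Longrightarrow> jp m = 2" "jp (Suc m) = 3 - jp m"
  by (auto simp: jp_def odd_iff_mod_2_eq_one mod_Suc)

lemma step: "m \<ge> 1 \<Longrightarrow> two_layer_solution \<Gamma> c \<rho> (jp m)
    (scattering_f f v_up v_low m) (scattering_g \<Gamma> \<rho> g v_up v_low m) (v_up m) (v_low m)"
  using scat unfolding multiplicative_scattering_def by blast

lemma step_waves:
  assumes "m \<ge> 1"
  shows "odd m \<Longrightarrow> wave_solution (above (\<Gamma> 1)) (c 1) (v_up m)"
    "odd m \<Longrightarrow> wave_solution (below (\<Gamma> 1)) (c 2) (v_low m)"
    "even m \<Longrightarrow> wave_solution (above (\<Gamma> 2)) (c 2) (v_up m)"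
    "even m \<Longrightarrow> wave_solution (below (\<Gamma> 2)) (c 3) (v_low m)"
  using step[OF assms] jp_cases(2,3)[of m] by (auto simp: two_layer_solution_def eval_nat_numeral)

text \<open>The field of step \<open>m\<close> in the middle layer, whose trace and flux on the other interface are
  the data of step \<open>m + 1\<close>, up to sign.\<close>

definition outgoing :: "nat \<Rightarrow> field" where
  "outgoing m = (if odd m then v_low m else v_up m)"

lemma outgoing_wave:
  assumes "m \<ge> 1"
  shows "wave_solution (inner_side (jp m)) (c 2) (outgoing m)"
  using step_waves[OF assms] jp_cases(2,3)[of m] by (auto simp: outgoing_def inner_side_def)

lemma travel_time_pos: "0 < setdist (\<Gamma> 1) (\<Gamma> 2) / c 2"
  using geometry positive unfolding layered_geometry_def by simp

lemma arrival_bound_Suc: "arrival_bound \<Gamma> c t0 (Suc n) = arrival_bound \<Gamma> c t0 n + setdist (\<Gamma> 1) (\<Gamma> 2) / c 2"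
  "arrival_bound \<Gamma> c t0 0 = t0" "arrival_bound \<Gamma> c t0 n > 0"
proof -
  show "arrival_bound \<Gamma> c t0 (Suc n) = arrival_bound \<Gamma> c t0 n + setdist (\<Gamma> 1) (\<Gamma> 2) / c 2"
    "arrival_bound \<Gamma> c t0 0 = t0" unfolding arrival_bound_def of_nat_Suc distrib_left by simp_all
  have "0 \<le> setdist (\<Gamma> 1) (\<Gamma> 2) / c 2 * real n"
    using travel_time_pos by (intro mult_nonneg_nonneg) auto
  then show "arrival_bound \<Gamma> c t0 n > 0" using t0 unfolding arrival_bound_def by linarith
qed

text \<open>Each step delays the onset by one travel time, because its data are the outgoing field of the step
  before, seen on the other interface. The first two steps both start at \<open>t0\<close>, as the data of the
  second contain \<open>f 2\<close> and \<open>g 2\<close>; this is why the onset of step \<open>m\<close> is \<open>T(m - 2)\<close>, with truncated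
  subtraction.\<close>

lemma step_quiet:
  assumes "m \<ge> 1"
  shows "(\<forall>x\<in>above (\<Gamma> (jp m)). \<forall>t\<in>{0..arrival_bound \<Gamma> c t0 (m - 2)}. v_up m (x, t) = 0) \<and>
    (\<forall>x\<in>below (\<Gamma> (jp m)). \<forall>t\<in>{0..arrival_bound \<Gamma> c t0 (m - 2)}. v_low m (x, t) = 0)"
  using assms
proof (induction m rule: nat_induct_at_least)
  case base
  note U = two_layer_uniqueness[OF jp_cases(1) pos step[OF order_refl], of t0]
  have F: "scattering_f f v_up v_low 1 (x, t) = 0" if "x \<in> \<Gamma> (jp 1)" "0 < t" "t < t0" for x t
    using quiet that jp_cases(2)[of 1] by (auto simp: scattering_f_def)
  have G: "scattering_g \<Gamma> \<rho> g v_up v_low 1 t \<phi> = 0" if "\<phi> \<in> test_functions \<Gamma> (jp 1)" "0 < t" "t < t0" for \<phi> t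
    using quiet that jp_cases(2)[of 1] by (auto simp: scattering_g_def)
  have t1: "arrival_bound \<Gamma> c t0 (1 - 2) = t0" by (simp add: arrival_bound_def)
  show ?case unfolding t1 using U[OF F G] by auto
next
  case (Suc m)
  let ?J = "jp m" and ?T = "arrival_bound \<Gamma> c t0 (Suc m - 2)"
  have J: "?J \<in> {1, 2}" by (rule jp_cases)
  have m: "m = 1 \<or> m \<ge> 2" using Suc.hyps by auto
  have T: "?T < arrival_bound \<Gamma> c t0 (m - 2) + setdist (\<Gamma> 1) (\<Gamma> 2) / c 2 \<and> m = 1 \<or>
     ?T = arrival_bound \<Gamma> c t0 (m - 2) + setdist (\<Gamma> 1) (\<Gamma> 2) / c 2 \<and> m \<ge> 2"
  proof (cases "m = 1")
    case True
    then show ?thesis using travel_time_pos by simp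
  next
    case False
    then have "Suc m - 2 = Suc (m - 2)" using m by simp
    then show ?thesis using arrival_bound_Suc(1)[of "m - 2"] m False by simp
  qed
  have van: "\<forall>x\<in>inner_side ?J. \<forall>t. 0 < t \<and> t < arrival_bound \<Gamma> c t0 (m - 2) \<longrightarrow> outgoing m (x, t) = 0"
    using Suc.IH jp_cases(2,3)[of m] by (auto simp: outgoing_def inner_side_def)
  have O: "x \<in> \<Gamma> (3 - ?J) \<Longrightarrow> outgoing m (x, t) = 0"
    "\<phi> \<in> test_functions \<Gamma> (3 - ?J) \<Longrightarrow> normal_deriv \<Gamma> (3 - ?J) 2 (outgoing m) t \<phi> = 0"
    if t: "0 < t" "t < ?T" for x t \<phi>
  proof -
    have t2: "t < arrival_bound \<Gamma> c t0 (m - 2) + setdist (\<Gamma> 1) (\<Gamma> 2) / c 2" using T t by auto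
    note A = arrival_at_other_interface[OF J outgoing_wave[OF Suc.hyps] positive(2)
        less_imp_le[OF arrival_bound_Suc(3)] van t(1) t2]
    show "x \<in> \<Gamma> (3 - ?J) \<Longrightarrow> outgoing m (x, t) = 0"
      "\<phi> \<in> test_functions \<Gamma> (3 - ?J) \<Longrightarrow> normal_deriv \<Gamma> (3 - ?J) 2 (outgoing m) t \<phi> = 0"
      by (erule A)+
  qed
  have first: "t \<le> t0" if "m = 1" "t < ?T" for t using that by (simp add: arrival_bound_def)
  have F: "scattering_f f v_up v_low (Suc m) (x, t) = 0" if x: "x \<in> \<Gamma> (jp (Suc m))" and t: "0 < t" "t < ?T" for x t
  proof (cases "m = 1")
    case True
    then have "f 2 (x, t) = 0" using quiet x t first[OF True t(2)] jp_cases(3)[of 2] by (auto simp: eval_nat_numeral)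
    then show ?thesis
      using True O(1)[OF t, of x] x jp_cases(4)[of m] by (simp add: scattering_f_def outgoing_def)
  next
    case False
    then show ?thesis
      using Suc.hyps O(1)[OF t, of x] x jp_cases(4)[of m] by (auto simp: scattering_f_def outgoing_def)
  qed
  have G: "scattering_g \<Gamma> \<rho> g v_up v_low (Suc m) t \<phi> = 0"
    if \<phi>: "\<phi> \<in> test_functions \<Gamma> (jp (Suc m))" and t: "0 < t" "t < ?T" for \<phi> t
  proof (cases "m = 1")
    case True
    then have J1: "?J = 1" using jp_cases(2)[of m] by simp
    then have \<phi>': "\<phi> \<in> test_functions \<Gamma> 2" using \<phi> jp_cases(4)[of m] by (simp add: eval_nat_numeral)
    then have "g 2 t \<phi> = 0" using quiet t first[OF True t(2)] by auto
    moreover have "normal_deriv \<Gamma> 2 2 (v_low 1) t \<phi> = 0"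
      using O(2)[OF t, of \<phi>] \<phi>' J1 True by (simp add: outgoing_def eval_nat_numeral)
    ultimately show ?thesis using True by (simp add: scattering_g_def)
  next
    case False
    then have *: "normal_deriv \<Gamma> (3 - ?J) 2 (outgoing m) t \<phi> = 0"
      using O(2)[OF t, of \<phi>] \<phi> jp_cases(4)[of m] by simp
    show ?thesis
    proof (cases "odd m")
      case True
      then have "3 - ?J = 2" using jp_cases(2)[of m] by simp
      then show ?thesis using * True False Suc.hyps by (simp add: scattering_g_def outgoing_def)
    next
      case ev: False
      then have "3 - ?J = 1" using jp_cases(3)[of m] by simp
      then show ?thesis using * ev False Suc.hyps by (simp add: scattering_g_def outgoing_def)
    qed
  qed
  have m1: "Suc m \<ge> 1" by simp
  note U = two_layer_uniqueness[OF jp_cases(1) pos step[OF m1], of ?T]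
  show ?case using U[OF F G] by auto
qed

lemma outgoing_quiet:
  assumes m: "m \<ge> 2" and t: "0 < t" "t < arrival_bound \<Gamma> c t0 (m - 1)"
  shows "x \<in> \<Gamma> (3 - jp m) \<Longrightarrow> outgoing m (x, t) = 0"
    "\<phi> \<in> test_functions \<Gamma> (3 - jp m) \<Longrightarrow> normal_deriv \<Gamma> (3 - jp m) 2 (outgoing m) t \<phi> = 0"
proof -
  have m1: "m \<ge> 1" using m by simp
  have "m - 1 = Suc (m - 2)" using m by simp
  then have t2: "t < arrival_bound \<Gamma> c t0 (m - 2) + setdist (\<Gamma> 1) (\<Gamma> 2) / c 2"
    using t arrival_bound_Suc(1)[of "m - 2"] by simp
  have van: "\<forall>x\<in>inner_side (jp m). \<forall>t. 0 < t \<and> t < arrival_bound \<Gamma> c t0 (m - 2) \<longrightarrow> outgoing m (x, t) = 0"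
    using step_quiet[OF m1] jp_cases(2,3)[of m] by (auto simp: outgoing_def inner_side_def)
  note A = arrival_at_other_interface[OF jp_cases(1) outgoing_wave[OF m1] positive(2)
      less_imp_le[OF arrival_bound_Suc(3)] van t(1) t2]
  show "x \<in> \<Gamma> (3 - jp m) \<Longrightarrow> outgoing m (x, t) = 0"
    "\<phi> \<in> test_functions \<Gamma> (3 - jp m) \<Longrightarrow> normal_deriv \<Gamma> (3 - jp m) 2 (outgoing m) t \<phi> = 0"
    by (erule A)+
qed

abbreviation "S \<equiv> scattering_sum v_up v_low"

lemma step_waves_layer:
  assumes "m \<ge> 1"
  shows "odd m \<Longrightarrow> wave_solution (layer \<Gamma> 1) (c 1) (v_up m)"
    "odd m \<Longrightarrow> wave_solution (layer \<Gamma> 2) (c 2) (v_low m)"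
    "even m \<Longrightarrow> wave_solution (layer \<Gamma> 2) (c 2) (v_up m)"
    "even m \<Longrightarrow> wave_solution (layer \<Gamma> 3) (c 3) (v_low m)"
  by (rule wave_solution_subset[OF _ open_layer], erule step_waves[OF assms], simp add: layer_simps)+

lemma step_transmission:
  assumes m: "m \<ge> 1" and t: "t > 0"
  shows "odd m \<Longrightarrow> x \<in> \<Gamma> 1 \<Longrightarrow> v_low m (x, t) - v_up m (x, t) = scattering_f f v_up v_low m (x, t)"
    "even m \<Longrightarrow> x \<in> \<Gamma> 2 \<Longrightarrow> v_low m (x, t) - v_up m (x, t) = scattering_f f v_up v_low m (x, t)"
    "odd m \<Longrightarrow> \<phi> \<in> test_functions \<Gamma> 1 \<Longrightarrow> normal_deriv \<Gamma> 1 2 (v_low m) t \<phi> / \<rho> 2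
       - normal_deriv \<Gamma> 1 1 (v_up m) t \<phi> / \<rho> 1 = scattering_g \<Gamma> \<rho> g v_up v_low m t \<phi>"
    "even m \<Longrightarrow> \<phi> \<in> test_functions \<Gamma> 2 \<Longrightarrow> normal_deriv \<Gamma> 2 3 (v_low m) t \<phi> / \<rho> 3
       - normal_deriv \<Gamma> 2 2 (v_up m) t \<phi> / \<rho> 2 = scattering_g \<Gamma> \<rho> g v_up v_low m t \<phi>"
proof -
  have n: "(1::nat) + 1 = 2" "(2::nat) + 1 = 3" by simp_all
  have "transmission \<Gamma> \<rho> (jp m) (scattering_f f v_up v_low m) (scattering_g \<Gamma> \<rho> g v_up v_low m) (v_up m) (v_low m)"
    using step[OF m] by (simp add: two_layer_solution_def)
  then have T: "x \<in> \<Gamma> (jp m) \<Longrightarrow> v_low m (x, t) - v_up m (x, t) = scattering_f f v_up v_low m (x, t)"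
    "\<phi> \<in> test_functions \<Gamma> (jp m) \<Longrightarrow> normal_deriv \<Gamma> (jp m) (jp m + 1) (v_low m) t \<phi> / \<rho> (jp m + 1)
       - normal_deriv \<Gamma> (jp m) (jp m) (v_up m) t \<phi> / \<rho> (jp m) = scattering_g \<Gamma> \<rho> g v_up v_low m t \<phi>"
    using t unfolding transmission_def by blast+
  show "v_low m (x, t) - v_up m (x, t) = scattering_f f v_up v_low m (x, t)" if "odd m" "x \<in> \<Gamma> 1"
    using T(1) that(2) by (simp only: jp_cases(2)[OF that(1)])
  show "normal_deriv \<Gamma> 1 2 (v_low m) t \<phi> / \<rho> 2
       - normal_deriv \<Gamma> 1 1 (v_up m) t \<phi> / \<rho> 1 = scattering_g \<Gamma> \<rho> g v_up v_low m t \<phi>"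
    if "odd m" "\<phi> \<in> test_functions \<Gamma> 1"
    using T(2) that(2) by (simp only: jp_cases(2)[OF that(1)] n)
  show "v_low m (x, t) - v_up m (x, t) = scattering_f f v_up v_low m (x, t)" if "even m" "x \<in> \<Gamma> 2"
    using T(1) that(2) by (simp only: jp_cases(3)[OF that(1)])
  show "normal_deriv \<Gamma> 2 3 (v_low m) t \<phi> / \<rho> 3
       - normal_deriv \<Gamma> 2 2 (v_up m) t \<phi> / \<rho> 2 = scattering_g \<Gamma> \<rho> g v_up v_low m t \<phi>"
    if "even m" "\<phi> \<in> test_functions \<Gamma> 2"
    using T(2) that(2) by (simp only: jp_cases(3)[OF that(1)] n)
qed

lemma scattering_sum_increment:
  "S (Suc M) 1 = (if odd (Suc M) then (\<lambda>p. S M 1 p + 1 * v_up (Suc M) p) else S M 1)"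
  "S (Suc M) 2 = (if odd (Suc M) then (\<lambda>p. S M 2 p + 1 * v_low (Suc M) p) else (\<lambda>p. S M 2 p + 1 * v_up (Suc M) p))"
  "S (Suc M) 3 = (if odd (Suc M) then S M 3 else (\<lambda>p. S M 3 p + 1 * v_low (Suc M) p))"
  unfolding fun_eq_iff scattering_sum_Suc by auto

lemma sum_waves:
  assumes "M \<ge> 1"
  shows "wave_solution (layer \<Gamma> 1) (c 1) (S M 1) \<and> wave_solution (layer \<Gamma> 2) (c 2) (S M 2) \<and>
    wave_solution (layer \<Gamma> 3) (c 3) (S M 3)"
  using assms
proof (induction M rule: nat_induct_at_least)
  case base
  have "wave_solution (layer \<Gamma> 3) (c 3) (\<lambda>_. 0)"
    by (rule wave_solution_zero[OF open_layer step_waves_layer(4)[of 2]]) auto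
  then show ?case
    using step_waves_layer(1,2)[of 1] unfolding scattering_sum_1 by auto
next
  case (Suc M)
  note L = wave_solution_lincomb[OF open_layer _ step_waves_layer(1)[of "Suc M"], of "S M 1" 1]
    wave_solution_lincomb[OF open_layer _ step_waves_layer(2)[of "Suc M"], of "S M 2" 1]
    wave_solution_lincomb[OF open_layer _ step_waves_layer(3)[of "Suc M"], of "S M 2" 1]
    wave_solution_lincomb[OF open_layer _ step_waves_layer(4)[of "Suc M"], of "S M 3" 1]
  show ?case
  proof (cases "odd (Suc M)")
    case True
    then show ?thesis using Suc.IH L(1,2) unfolding scattering_sum_increment by simp
  next
    case False
    then show ?thesis using Suc.IH L(3,4) unfolding scattering_sum_increment by simp
  qed
qed

text \<open>The sums telescope: the data of step \<open>m + 1\<close> cancel the outgoing field of step \<open>m\<close>, so only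
  the outgoing field of the last step remains as a defect of the transmission conditions. The data
  \<open>f 2\<close> enter with the second step.\<close>

lemma sum_jumps:
  assumes "M \<ge> 1" and t: "t > 0"
  shows "x \<in> \<Gamma> 1 \<Longrightarrow> S M 2 (x, t) - S M 1 (x, t) = f 1 (x, t) + (if even M then v_up M (x, t) else 0)"
    "x \<in> \<Gamma> 2 \<Longrightarrow> S M 3 (x, t) - S M 2 (x, t)
      = (if M \<ge> 2 then f 2 (x, t) else 0) - (if odd M then v_low M (x, t) else 0)"
proof -
  let ?P1 = "\<lambda>M. S M 2 (x, t) - S M 1 (x, t) = f 1 (x, t) + (if even M then v_up M (x, t) else 0)"
  let ?P2 = "\<lambda>M. S M 3 (x, t) - S M 2 (x, t)
      = (if M \<ge> 2 then f 2 (x, t) else 0) - (if odd M then v_low M (x, t) else 0)"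
  have "(x \<in> \<Gamma> 1 \<longrightarrow> ?P1 M) \<and> (x \<in> \<Gamma> 2 \<longrightarrow> ?P2 M)"
    using assms(1)
  proof (induction M rule: nat_induct_at_least)
    case base
    show ?case
      using step_transmission(1)[of 1 t x] t unfolding scattering_sum_1 by (simp add: scattering_f_def)
  next
    case (Suc M)
    show ?case
    proof (cases "odd (Suc M)")
      case True
      then show ?thesis
        using Suc step_transmission(1)[of "Suc M" t x] t unfolding scattering_sum_Suc
        by (auto simp: scattering_f_def)
    next
      case False
      then have "scattering_f f v_up v_low (Suc M) (x, t) = (if M = 1 then f 2 (x, t) else 0) + v_low M (x, t)"
        using Suc.hyps by (auto simp: scattering_f_def)
      moreover have "2 \<le> M \<longleftrightarrow> M \<noteq> 1" using Suc.hyps by auto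
      ultimately show ?thesis
        using False Suc step_transmission(2)[of "Suc M" t x] t unfolding scattering_sum_Suc
        by auto
    qed
  qed
  then show "x \<in> \<Gamma> 1 \<Longrightarrow> ?P1 M" "x \<in> \<Gamma> 2 \<Longrightarrow> ?P2 M" by blast+
qed

text \<open>The same telescoping as in \<open>sum_jumps\<close>, for the Neumann data.\<close>

lemma sum_fluxes:
  assumes "M \<ge> 1" and t: "t > 0"
  shows "\<phi> \<in> test_functions \<Gamma> 1 \<Longrightarrow>
      normal_deriv \<Gamma> 1 2 (S M 2) t \<phi> / \<rho> 2 - normal_deriv \<Gamma> 1 1 (S M 1) t \<phi> / \<rho> 1
      = g 1 t \<phi> + (if even M then normal_deriv \<Gamma> 1 2 (v_up M) t \<phi> / \<rho> 2 else 0)"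
    "\<phi> \<in> test_functions \<Gamma> 2 \<Longrightarrow>
      normal_deriv \<Gamma> 2 3 (S M 3) t \<phi> / \<rho> 3 - normal_deriv \<Gamma> 2 2 (S M 2) t \<phi> / \<rho> 2
      = (if M \<ge> 2 then g 2 t \<phi> else 0) - (if odd M then normal_deriv \<Gamma> 2 2 (v_low M) t \<phi> / \<rho> 2 else 0)"
proof -
  have n: "(1::nat) = 1 \<or> (1::nat) = 1 + 1" "(2::nat) = 1 \<or> (2::nat) = 1 + 1"
    "(2::nat) = 2 \<or> (2::nat) = 2 + 1" "(3::nat) = 2 \<or> (3::nat) = 2 + 1" by simp_all
  let ?P1 = "\<lambda>M. normal_deriv \<Gamma> 1 2 (S M 2) t \<phi> / \<rho> 2 - normal_deriv \<Gamma> 1 1 (S M 1) t \<phi> / \<rho> 1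
      = g 1 t \<phi> + (if even M then normal_deriv \<Gamma> 1 2 (v_up M) t \<phi> / \<rho> 2 else 0)"
  let ?P2 = "\<lambda>M. normal_deriv \<Gamma> 2 3 (S M 3) t \<phi> / \<rho> 3 - normal_deriv \<Gamma> 2 2 (S M 2) t \<phi> / \<rho> 2
      = (if M \<ge> 2 then g 2 t \<phi> else 0) - (if odd M then normal_deriv \<Gamma> 2 2 (v_low M) t \<phi> / \<rho> 2 else 0)"
  have "(\<phi> \<in> test_functions \<Gamma> 1 \<longrightarrow> ?P1 M) \<and> (\<phi> \<in> test_functions \<Gamma> 2 \<longrightarrow> ?P2 M)"
    using assms(1)
  proof (induction M rule: nat_induct_at_least)
    case base
    have "normal_deriv \<Gamma> 2 3 (\<lambda>_. 0) t \<phi> = 0" by (simp add: normal_deriv_green green_zero_field)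
    then show ?case
      using step_transmission(3)[of 1 t \<phi>] t unfolding scattering_sum_1 by (simp add: scattering_g_def)
  next
    case (Suc M)
    note W = sum_waves[OF Suc.hyps]
    have M1: "Suc M \<ge> 1" by simp
    show ?case
    proof (cases "odd (Suc M)")
      case True
      note V = step_waves_layer(1,2)[OF M1 True]
      have "normal_deriv \<Gamma> 1 1 (S (Suc M) 1) t \<phi> = normal_deriv \<Gamma> 1 1 (S M 1) t \<phi> + 1 * normal_deriv \<Gamma> 1 1 (v_up (Suc M)) t \<phi>"
        "normal_deriv \<Gamma> 1 2 (S (Suc M) 2) t \<phi> = normal_deriv \<Gamma> 1 2 (S M 2) t \<phi> + 1 * normal_deriv \<Gamma> 1 2 (v_low (Suc M)) t \<phi>"
        if "\<phi> \<in> test_functions \<Gamma> 1"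
        unfolding scattering_sum_increment if_P[OF True] using W V
        by (blast intro: normal_deriv_lincomb[OF that n(1) t positive(1)] normal_deriv_lincomb[OF that n(2) t positive(2)])+
      moreover have "normal_deriv \<Gamma> 2 2 (S (Suc M) 2) t \<phi> = normal_deriv \<Gamma> 2 2 (S M 2) t \<phi> + 1 * normal_deriv \<Gamma> 2 2 (v_low (Suc M)) t \<phi>"
        if "\<phi> \<in> test_functions \<Gamma> 2"
        unfolding scattering_sum_increment if_P[OF True] using W V
        by (blast intro: normal_deriv_lincomb[OF that n(3) t positive(2)])
      moreover have "S (Suc M) 3 = S M 3" unfolding scattering_sum_increment using True by simp
      ultimately show ?thesis
        using True Suc step_transmission(3)[of "Suc M" t \<phi>] t
        by (auto simp: scattering_g_def add_divide_distrib)
    next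
      case False
      then have ev: "even (Suc M)" by simp
      note V = step_waves_layer(3,4)[OF M1 ev]
      have "normal_deriv \<Gamma> 2 3 (S (Suc M) 3) t \<phi> = normal_deriv \<Gamma> 2 3 (S M 3) t \<phi> + 1 * normal_deriv \<Gamma> 2 3 (v_low (Suc M)) t \<phi>"
        "normal_deriv \<Gamma> 2 2 (S (Suc M) 2) t \<phi> = normal_deriv \<Gamma> 2 2 (S M 2) t \<phi> + 1 * normal_deriv \<Gamma> 2 2 (v_up (Suc M)) t \<phi>"
        if "\<phi> \<in> test_functions \<Gamma> 2"
        unfolding scattering_sum_increment if_not_P[OF False] using W V
        by (blast intro: normal_deriv_lincomb[OF that n(4) t positive(3)] normal_deriv_lincomb[OF that n(3) t positive(2)])+
      moreover have "normal_deriv \<Gamma> 1 2 (S (Suc M) 2) t \<phi> = normal_deriv \<Gamma> 1 2 (S M 2) t \<phi> + 1 * normal_deriv \<Gamma> 1 2 (v_up (Suc M)) t \<phi>"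
        if "\<phi> \<in> test_functions \<Gamma> 1"
        unfolding scattering_sum_increment if_not_P[OF False] using W V
        by (blast intro: normal_deriv_lincomb[OF that n(2) t positive(2)])
      moreover have "S (Suc M) 1 = S M 1" unfolding scattering_sum_increment using False by simp
      moreover have "scattering_g \<Gamma> \<rho> g v_up v_low (Suc M) t \<phi>
          = (if M = 1 then g 2 t \<phi> else 0) + normal_deriv \<Gamma> 2 2 (v_low M) t \<phi> / \<rho> 2"
        using False Suc.hyps by (auto simp: scattering_g_def)
      moreover have "2 \<le> M \<longleftrightarrow> M \<noteq> 1" using Suc.hyps by auto
      ultimately show ?thesis
        using False Suc step_transmission(4)[of "Suc M" t \<phi>] t
        by (auto simp: add_divide_distrib)
    qed
  qed
  then show "\<phi> \<in> test_functions \<Gamma> 1 \<Longrightarrow> ?P1 M" "\<phi> \<in> test_functions \<Gamma> 2 \<Longrightarrow> ?P2 M" by blast+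
qed

text \<open>The difference \<open>w\<close> of the solution and the sum of order \<open>M\<close> solves the three-layered problem with
  the outgoing field of step \<open>M\<close> as its only datum, which arrives at time \<open>T(M - 1)\<close>. For \<open>M = 1\<close> the
  datum \<open>f 2\<close> would be missing from the sum.\<close>

theorem scattering_sum_exact:
  assumes u: "three_layer_solution \<Gamma> c \<rho> f g u" and M: "M \<ge> 2"
    and j: "j \<in> {1, 2, 3::nat}" and x: "x \<in> layer \<Gamma> j" and t: "0 \<le> t" "t \<le> arrival_bound \<Gamma> c t0 (M - 1)"
  shows "u j (x, t) = S M j (x, t)"
proof -
  let ?T = "arrival_bound \<Gamma> c t0 (M - 1)"
  have M1: "M \<ge> 1" using M by simp
  define w where "w k = (\<lambda>p. u k p + (- 1) * S M k p)" for k
  have uw: "wave_solution (layer \<Gamma> k) (c k) (u k)" if "k \<in> {1, 2, 3}" for k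
    using u that unfolding three_layer_solution_def by blast
  have Sw: "wave_solution (layer \<Gamma> k) (c k) (S M k)" if "k \<in> {1, 2, 3}" for k
    using sum_waves[OF M1] that by blast
  have tr: "transmission \<Gamma> \<rho> j (f j) (g j) (u j) (u (j + 1))" if "j \<in> {1, 2}" for j
    using u that unfolding three_layer_solution_def by blast
  have n: "(1::nat) + 1 = 2" "(2::nat) + 1 = 3" by simp_all
  have "w j (x, t) = 0"
  proof (rule three_layer_uniqueness[OF pos _ _ _ j x t])
    show "wave_solution (layer \<Gamma> k) (c k) (w k)" if "k \<in> {1, 2, 3}" for k
      unfolding w_def by (rule wave_solution_lincomb[OF open_layer uw[OF that] Sw[OF that]])
    fix j :: nat and t assume j: "j \<in> {1, 2}" and t: "0 < t" "t < ?T"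
    note out = outgoing_quiet[OF M t]
    have trace: "u (j + 1) (x, t) - u j (x, t) = f j (x, t)" if "x \<in> \<Gamma> j" for x
      using tr[OF j] that t(1) unfolding transmission_def by blast
    show "w (j + 1) (x, t) = w j (x, t)" if x: "x \<in> \<Gamma> j" for x
    proof (cases "j = 1")
      case True
      have "S M 2 (x, t) - S M 1 (x, t) = f 1 (x, t)"
        using sum_jumps(1)[OF M1 t(1), of x] out(1)[of x] x True jp_cases(3)[of M] by (auto simp: outgoing_def)
      then show ?thesis using trace[OF x] unfolding w_def True n by simp
    next
      case False
      then have j2: "j = 2" using j by simp
      have "S M 3 (x, t) - S M 2 (x, t) = f 2 (x, t)"
        using sum_jumps(2)[OF M1 t(1), of x] out(1)[of x] x j2 jp_cases(2)[of M] M
        by (auto simp: outgoing_def eval_nat_numeral)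
      then show ?thesis using trace[OF x] unfolding w_def j2 n by simp
    qed
    fix \<phi> assume \<phi>: "\<phi> \<in> test_functions \<Gamma> j"
    have k: "j \<in> {1, 2, 3}" "j + 1 \<in> {1, 2, 3}" using j by auto
    have flux: "normal_deriv \<Gamma> j (j + 1) (u (j + 1)) t \<phi> / \<rho> (j + 1) - normal_deriv \<Gamma> j j (u j) t \<phi> / \<rho> j = g j t \<phi>"
      using tr[OF j] \<phi> t(1) unfolding transmission_def by blast
    have lin: "normal_deriv \<Gamma> j k (w k) t \<phi> = normal_deriv \<Gamma> j k (u k) t \<phi> + (- 1) * normal_deriv \<Gamma> j k (S M k) t \<phi>"
      if "k = j \<or> k = j + 1" "k \<in> {1, 2, 3}" for k
      unfolding w_def
      by (rule normal_deriv_lincomb[OF \<phi> that(1) t(1) _ uw[OF that(2)] Sw[OF that(2)]]) (use pos that(2) in blast)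
    have sumflux: "normal_deriv \<Gamma> j (j + 1) (S M (j + 1)) t \<phi> / \<rho> (j + 1) - normal_deriv \<Gamma> j j (S M j) t \<phi> / \<rho> j = g j t \<phi>"
    proof (cases "j = 1")
      case True
      show ?thesis
        using sum_fluxes(1)[OF M1 t(1), of \<phi>] out(2)[of \<phi>] \<phi> jp_cases(3)[of M]
        unfolding True n by (cases "even M") (simp_all add: outgoing_def)
    next
      case False
      then have j2: "j = 2" using j by simp
      show ?thesis
        using sum_fluxes(2)[OF M1 t(1), of \<phi>] out(2)[of \<phi>] \<phi> jp_cases(2)[of M] M
        unfolding j2 n by (cases "odd M") (simp_all add: outgoing_def eval_nat_numeral)
    qed
    show "normal_deriv \<Gamma> j (j + 1) (w (j + 1)) t \<phi> / \<rho> (j + 1) - normal_deriv \<Gamma> j j (w j) t \<phi> / \<rho> j = 0"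
      using flux sumflux lin[OF _ k(1)] lin[OF _ k(2)] by (simp add: diff_divide_distrib)
  qed
  then show ?thesis by (simp add: w_def)
qed

end

theorem theorem3p2:
  fixes \<Gamma> :: "nat \<Rightarrow> pt set" and c \<rho> :: "nat \<Rightarrow> real" and t0 :: real
    and uinc :: field and f :: "nat \<Rightarrow> field" and g :: "nat \<Rightarrow> neumann"
    and u v_up v_low :: "nat \<Rightarrow> field" and M :: nat
  assumes "layered_geometry \<Gamma>"
    and "\<forall>j\<in>{1, 2, 3}. c j > 0 \<and> \<rho> j > 0"
    and "t0 > 0"
    and "plane_wave_data \<Gamma> c \<rho> uinc f g \<or> point_source_data \<Gamma> c \<rho> uinc f g"
    and "\<forall>j\<in>{1, 2}. \<forall>t\<in>{0<..t0}.
           (\<forall>x\<in>\<Gamma> j. f j (x, t) = 0) \<and> (\<forall>\<phi>\<in>test_functions \<Gamma> j. g j t \<phi> = 0)"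
    and "three_layer_solution \<Gamma> c \<rho> f g u"
    and "multiplicative_scattering \<Gamma> c \<rho> f g v_up v_low"
    and "M \<ge> 2"
  shows "\<forall>j\<in>{1, 2, 3}. \<forall>x\<in>layer \<Gamma> j. \<forall>t\<in>{0..arrival_bound \<Gamma> c t0 (M - 1)}.
           u j (x, t) = scattering_sum v_up v_low M j (x, t)"
proof -
  interpret scattering \<Gamma> c \<rho> t0 f g v_up v_low
    by unfold_locales (use assms in blast)+
  show ?thesis using scattering_sum_exact[OF assms(6) assms(8)] by auto
qed

end
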